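(* Suppose: (i) the directed graph $\mathcal G$ is strongly connected and $W=[w_{ij}]\in\mathbb R^{n\times n}$ is a nonnegative doubly stochastic weight matrix for it ($W\mathbf 1_n=\mathbf 1_n$, $\mathbf 1_n^TW=\mathbf 1_n^T$, $w_{ii}>0$ for all $i$, and for $i\neq j$, $w_{ij}>0$ if agent $i$ can receive information from agent $j$ and $w_{ij}=0$ otherwise); (ii) there is $L_f>0$ with $\|\nabla F_i(X)-\nabla F_i(Y)\|\le L_f\|X-Y\|$ for all $X,Y\in\mathbb R^d$ and all $i\in\mathcal V$; (iii) $F$ satisfies the Polyak--Łojasiewicz condition with constant $\nu>0$: $\frac12\|\nabla F(X)\|^2\ge\nu(F(X)-F^\star)$ for all $X\in\mathbb R^d$; (iv) the compressor $\mathcal C:\mathbb R^d\to\mathbb R^d$ satisfies, for some constants $r>0$ and $\psi\in(0,1]$, $\mathbf E_{\mathcal C}\big[\|\mathcal C(X)/r-X\|^2\big]\le(1-\psi)\|X\|^2$ for all $X\in\mathbb R^d$. Let $\varphi_X,\varphi_Y\in(0,\frac1r)$, $c_1=\frac{\varphi_X\psi r}{2}$, $c_2=\frac{\varphi_Y\psi r}{2}$, $C=2r^2(1-\psi)+2(1-r)^2$, $\phi=\frac{(1-\sigma)^2}{320L_f^2}$, $\hat\phi=\frac{0.1}{C}\min\{c_1(2c_1+1),c_2(2c_2+1)\}$, and $$\Pi=\min\Big\{\tfrac{1-\sigma}{160(1+c_1^{-1})},\tfrac{1-\sigma}{40000(1+c_2^{-1})L_f^2},\tfrac{c_1(1-\sigma)}{40C},\tfrac{c_1}{8\sqrt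 C},\tfrac{c_1}{10L_f\sqrt{C(1+c_2^{-1})}},\tfrac{c_2L_f^2}{C},\tfrac{c_2}{10\sqrt C}\Big\}.$$ Let every agent run Algorithm 2 (defined in the context) with these $\varphi_X,\varphi_Y$ and with $$\gamma\in\Big(0,\min\Big\{\tfrac{c_1(1-\sigma)}{160C},\tfrac{c_1}{16\sqrt C},\tfrac{c_1}{20L_f\sqrt{C(1+c_2^{-1})}},\tfrac{c_2L_f^2}{4C},\tfrac{c_2}{20\sqrt C},\tfrac{1}{4(1+c_1^{-1})+5(1+c_2^{-1})L_f^2},\tfrac{(1-\sigma)\hat\phi}{4(16(1+4\phi L_f^2)+8(1-\sigma))},\tfrac1{5(1+c_2^{-1})},\tfrac{(1-\sigma)\hat\phi}{32(2\phi+(1-\sigma))},\Pi\Big\}\Big),$$ $$\eta\in\Big(0,\min\Big\{\tfrac{(1-\sigma)^2\gamma}{40L_f},\tfrac{0.4(1-\sigma)\gamma}{L_f^2},\tfrac{(1-\sigma)^2}{80L_f}\sqrt{\tfrac{\gamma}{1+c_1^{-1}}},\tfrac{9}{40(4(1+c_1^{-1})+5(1+c_2^{-1}))},\tfrac1{2L_f},\gamma\Big\}\Big),$$ $$\varsigma\in\Big(0,\min\Big\{\tfrac1{2\sqrt C},\tfrac1{\sqrt{2C+1}}\Big\}\Big).$$ Then for every $k\ge0$, $$\mathbf E_{\mathcal C}\big[\|\boldsymbol X(k)-\bar{\boldsymbol X}(k)\|^2+n(F(\bar X(k))-F^\star)\big]\le(1-\hat\theta_3)^kU(0),$$ where $\hat\theta_3=\min\{\hat\theta_2,2\nu\theta_2\}$,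 $\hat\theta_2=\min\{0.07(1-\sigma)\gamma,\ 0.24c_1(2c_1+1),\ 0.57c_2(2c_2+1),\ 0.25\}$, $\theta_2=\frac\eta4-(\phi\varepsilon_1+\varepsilon_2+\varepsilon_3)$, $\varepsilon_1=\frac{8L_f^2}{(1-\sigma)\gamma}\eta^2$, $\varepsilon_2=4(1+c_1^{-1})\eta^2$, $\varepsilon_3=5(1+c_2^{-1})\eta^2$.
   Context: Problem. A group of $n$ agents $\mathcal V=\{1,\dots,n\}$ communicates over a directed graph $\mathcal G=(\mathcal V,\mathcal E)$. Agent $i$ has a differentiable (possibly nonconvex) cost $F_i:\mathbb R^d\to\mathbb R$; $F=\frac1n\sum_{i=1}^nF_i$; the set $\operatorname{argmin}F$ is nonempty and $F^\star=\min F>-\infty$. $\|\cdot\|$ is the Euclidean norm (spectral norm for matrices). $\sigma\in(0,1)$ denotes the spectral norm of $W-\frac1n\mathbf 1_n\mathbf 1_n^T$. Compressor. $\mathcal C$ is a possibly randomized map; $\mathbf E_{\mathcal C}$ is expectation over its internal randomness. Each application of $\mathcal C$ in the algorithm uses fresh randomness, independent of the past. Algorithm 2 (error feedback). Parameters $\gamma,\eta,\varphi_X,\varphi_Y,\varsigma>0$. Initialization for each $i\in\mathcal V$: $X_i(0)\in\mathbb R^d$ arbitrary, $Y_i(0)=\nabla F_i(X_i(0))$, $A_i(0)=B_i(0)=C_i(0)=D_i(0)=\mathbf 0_d$, $E_i^X(0)=E_i^Y(0)=\mathbf 0_d$, $Q_i^X(0)=\hat Q_i^X(0)=\mathcal C(X_i(0))$,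 $Q_i^Y(0)=\hat Q_i^Y(0)=\mathcal C(Y_i(0))$. For $k\ge0$ and each $i$: $A_i(k+1)=A_i(k)+\varphi_XQ_i^X(k)$; $B_i(k+1)=B_i(k)+\varphi_X\big(Q_i^X(k)-\sum_jw_{ij}Q_j^X(k)\big)$; $C_i(k+1)=C_i(k)+\varphi_YQ_i^Y(k)$; $D_i(k+1)=D_i(k)+\varphi_Y\big(Q_i^Y(k)-\sum_jw_{ij}Q_j^Y(k)\big)$; $X_i(k+1)=X_i(k)-\gamma\big[B_i(k)+\hat Q_i^X(k)-\sum_jw_{ij}\hat Q_j^X(k)\big]-\eta Y_i(k)$; $Y_i(k+1)=Y_i(k)-\gamma\big[D_i(k)+\hat Q_i^Y(k)-\sum_jw_{ij}\hat Q_j^Y(k)\big]+\nabla F_i(X_i(k+1))-\nabla F_i(X_i(k))$; $Q_i^X(k+1)=\mathcal C(X_i(k+1)-A_i(k+1))$; $Q_i^Y(k+1)=\mathcal C(Y_i(k+1)-C_i(k+1))$; $E_i^X(k+1)=\varsigma E_i^X(k)+X_i(k)-A_i(k)-\hat Q_i^X(k)$; $E_i^Y(k+1)=\varsigma E_i^Y(k)+Y_i(k)-C_i(k)-\hat Q_i^Y(k)$; $\hat Q_i^X(k+1)=\mathcal C(\varsigma E_i^X(k+1)+X_i(k+1)-A_i(k+1))$; $\hat Q_i^Y(k+1)=\mathcal C(\varsigma E_i^Y(k+1)+Y_i(k+1)-C_i(k+1))$. Notation. $\boldsymbol X,\boldsymbol Y,\boldsymbol A,\boldsymbol C\in\mathbb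 R^{nd}$ are the stacked vectors of $X_i,Y_i,A_i,C_i$; $\bar X(k)=\frac1n\sum_iX_i(k)$; $\bar{\boldsymbol X}(k)=\mathbf 1_n\otimes\bar X(k)$; $\bar{\boldsymbol Y}(k)=\mathbf 1_n\otimes\frac1n\sum_iY_i(k)$. With $\phi$ as in the claim, $$V(k)=\|\boldsymbol X(k)-\bar{\boldsymbol X}(k)\|^2+\phi\|\boldsymbol Y(k)-\bar{\boldsymbol Y}(k)\|^2+\|\boldsymbol X(k)-\boldsymbol A(k)\|^2+\|\boldsymbol Y(k)-\boldsymbol C(k)\|^2,$$ $$U(k)=V(k)+n(F(\bar X(k))-F^\star).$$ *)

theory Defs
  imports "HOL-Probability.Probability" "Graph_Theory.Graph_Theory"
begin

section \<open>Gradients\<close>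

definition gradient :: "('a::euclidean_space \<Rightarrow> real) \<Rightarrow> 'a \<Rightarrow> 'a" where
  "gradient f x = (THE D. GDERIV f x :> D)"

lemma gradient_eqI:
  assumes "GDERIV f x :> D"
  shows "gradient f x = D"
  unfolding gradient_def
proof (rule the_equality)
  fix D' assume "GDERIV f x :> D'"
  then have "(\<lambda>h. inner h D') = (\<lambda>h. inner h D)"
    using assms unfolding gderiv_def by (rule has_derivative_unique)
  then have "inner h D' = inner h D" for h
    by (rule fun_cong)
  then show "D' = D"
    using vector_eq_ldot by blast
qed (fact assms)

lemma GDERIV_gradient:
  assumes "f differentiable (at x)"
  shows "GDERIV f x :> gradient f x"
proof -
  from assms obtain f' where f': "(f has_derivative f') (at x)"
    unfolding differentiable_def by blast
  then interpret bounded_linear f'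
    by (rule has_derivative_bounded_linear)
  have "f' h = inner h (\<Sum>b\<in>Basis. f' b *\<^sub>R b)" for h
  proof -
    have "f' h = f' (\<Sum>b\<in>Basis. inner h b *\<^sub>R b)"
      by (simp add: euclidean_representation)
    also have "\<dots> = (\<Sum>b\<in>Basis. inner h b * f' b)"
      by (simp only: sum scaleR real_scaleR_def)
    also have "\<dots> = inner h (\<Sum>b\<in>Basis. f' b *\<^sub>R b)"
      by (simp add: inner_sum_right mult.commute)
    finally show ?thesis .
  qed
  then have "f' = (\<lambda>h. inner h (\<Sum>b\<in>Basis. f' b *\<^sub>R b))" by blast
  with f' have "GDERIV f x :> (\<Sum>b\<in>Basis. f' b *\<^sub>R b)"
    unfolding gderiv_def by simp
  then show ?thesis by (simp only: gradient_eqI)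
qed

section \<open>Network\<close>

text \<open>
  The agents are the elements of a finite type \<open>'n\<close>.  A stacked vector in
  \<open>\<real>\<^sup>n\<^sup>d\<close> is an element of \<^typ>\<open>real^'d^'n\<close>, whose norm is the Euclidean norm of
  the concatenation of its blocks.  An arc \<open>(j, i)\<close> of the graph means that agent \<open>i\<close>
  can receive information from agent \<open>j\<close>.
\<close>

definition doubly_stochastic_weights :: "'n::finite pair_pre_digraph \<Rightarrow> real^'n^'n \<Rightarrow> bool" where
  "doubly_stochastic_weights G W \<longleftrightarrow>
     (\<forall>i j. 0 \<le> W $ i $ j) \<and> W *v 1 = 1 \<and> 1 v* W = 1 \<and> (\<forall>i. 0 < W $ i $ i) \<and>
     (\<forall>i j. i \<noteq> j \<longrightarrow> (if (j, i) \<in> parcs G then 0 < W $ i $ j else W $ i $ j = 0))"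

definition spectral_norm :: "real^'n^'m \<Rightarrow> real" where
  "spectral_norm M = onorm (\<lambda>x. M *v x)"

definition averaging_matrix :: "real^'n^'n" where
  "averaging_matrix = (\<chi> i j. 1 / real CARD('n))"

definition mean :: "real^'d^'n \<Rightarrow> real^'d" where
  "mean Z = (1 / real CARD('n)) *\<^sub>R (\<Sum>i\<in>UNIV. Z $ i)"

definition replicated_mean :: "real^'d^'n \<Rightarrow> real^'d^'n" where
  "replicated_mean Z = (\<chi> i. mean Z)"

definition laplacian :: "real^'n^'n \<Rightarrow> real^'d^'n \<Rightarrow> real^'d^'n" where
  "laplacian W Z = (\<chi> i. Z $ i - (\<Sum>j\<in>UNIV. W $ i $ j *\<^sub>R Z $ j))"

definition mean_cost :: "('n::finite \<Rightarrow> real^'d \<Rightarrow> real) \<Rightarrow> real^'d \<Rightarrow> real" where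
  "mean_cost F x = (1 / real CARD('n)) * (\<Sum>i\<in>UNIV. F i x)"

definition local_gradients :: "('n::finite \<Rightarrow> real^'d \<Rightarrow> real) \<Rightarrow> real^'d^'n \<Rightarrow> real^'d^'n" where
  "local_gradients F Z = (\<chi> i. gradient (F i) (Z $ i))"

section \<open>Compressor\<close>

text \<open>
  A randomized compressor is a map \<open>\<C> s x\<close> of an internal random seed \<open>s\<close>, drawn from
  the probability measure \<open>R\<close>, and of the vector \<open>x\<close> to be compressed.  Integrability is
  required explicitly because a Bochner integral of a non-integrable function is \<open>0\<close>.
\<close>

definition compressor :: "'r measure \<Rightarrow> ('r \<Rightarrow> real^'d \<Rightarrow> real^'d) \<Rightarrow> real \<Rightarrow> real \<Rightarrow> bool" where
  "compressor R \<C> r \<psi> \<longleftrightarrow>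
     prob_space R \<and> case_prod \<C> \<in> borel_measurable (R \<Otimes>\<^sub>M borel) \<and>
     (\<forall>x. integrable R (\<lambda>s. (norm (\<C> s x /\<^sub>R r - x))\<^sup>2) \<and>
          (\<integral>s. (norm (\<C> s x /\<^sub>R r - x))\<^sup>2 \<partial>R) \<le> (1 - \<psi>) * (norm x)\<^sup>2)"

section \<open>The algorithm with error feedback\<close>

record ('d::finite, 'n::finite) alg_state =
  st_X :: "real^'d^'n"
  st_Y :: "real^'d^'n"
  st_A :: "real^'d^'n"
  st_B :: "real^'d^'n"
  st_C :: "real^'d^'n"
  st_D :: "real^'d^'n"
  st_EX :: "real^'d^'n"
  st_EY :: "real^'d^'n"
  st_QX :: "real^'d^'n"
  st_QY :: "real^'d^'n"
  st_QhatX :: "real^'d^'n"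
  st_QhatY :: "real^'d^'n"

text \<open>
  The four applications of the compressor by one agent in one iteration.  The argument
  \<open>cmp ch i k\<close> below is the realized compression map of agent \<open>i\<close> at time \<open>k\<close>
  for the application \<open>ch\<close>.  At time \<open>0\<close> a single compressed value serves as both
  \<open>Q\<close> and \<open>Qhat\<close>, so the maps \<open>cmp CQhatX i 0\<close> and \<open>cmp CQhatY i 0\<close> are unused.
\<close>

datatype channel = CQX | CQY | CQhatX | CQhatY

definition alg_init ::
  "('n::finite \<Rightarrow> real^'d \<Rightarrow> real) \<Rightarrow> (channel \<Rightarrow> 'n \<Rightarrow> nat \<Rightarrow> real^'d \<Rightarrow> real^'d) \<Rightarrow>
   real^'d^'n \<Rightarrow> ('d::finite, 'n) alg_state" where
  "alg_init F cmp X0 =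
    (let Y0 = local_gradients F X0;
         QX0 = (\<chi> i. cmp CQX i 0 (X0 $ i));
         QY0 = (\<chi> i. cmp CQY i 0 (Y0 $ i))
     in \<lparr> st_X = X0, st_Y = Y0, st_A = 0, st_B = 0, st_C = 0, st_D = 0, st_EX = 0, st_EY = 0,
          st_QX = QX0, st_QY = QY0, st_QhatX = QX0, st_QhatY = QY0 \<rparr>)"

definition alg_step ::
  "('n::finite \<Rightarrow> real^'d \<Rightarrow> real) \<Rightarrow> real^'n^'n \<Rightarrow> real \<Rightarrow> real \<Rightarrow> real \<Rightarrow> real \<Rightarrow> real \<Rightarrow>
   (channel \<Rightarrow> 'n \<Rightarrow> nat \<Rightarrow> real^'d \<Rightarrow> real^'d) \<Rightarrow> nat \<Rightarrow>
   ('d::finite, 'n) alg_state \<Rightarrow> ('d, 'n) alg_state" where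
  "alg_step F W \<gamma> \<eta> \<phi>\<^sub>X \<phi>\<^sub>Y varsigma cmp k s =
    (let A' = st_A s + \<phi>\<^sub>X *\<^sub>R st_QX s;
         B' = st_B s + \<phi>\<^sub>X *\<^sub>R laplacian W (st_QX s);
         C' = st_C s + \<phi>\<^sub>Y *\<^sub>R st_QY s;
         D' = st_D s + \<phi>\<^sub>Y *\<^sub>R laplacian W (st_QY s);
         X' = st_X s - \<gamma> *\<^sub>R (st_B s + laplacian W (st_QhatX s)) - \<eta> *\<^sub>R st_Y s;
         Y' = st_Y s - \<gamma> *\<^sub>R (st_D s + laplacian W (st_QhatY s))
                + local_gradients F X' - local_gradients F (st_X s);
         EX' = varsigma *\<^sub>R st_EX s + st_X s - st_A s - st_QhatX s;
         EY' = varsigma *\<^sub>R st_EY s + st_Y s - st_C s - st_QhatY s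
     in \<lparr> st_X = X', st_Y = Y', st_A = A', st_B = B', st_C = C', st_D = D',
          st_EX = EX', st_EY = EY',
          st_QX = (\<chi> i. cmp CQX i (Suc k) ((X' - A') $ i)),
          st_QY = (\<chi> i. cmp CQY i (Suc k) ((Y' - C') $ i)),
          st_QhatX = (\<chi> i. cmp CQhatX i (Suc k) ((varsigma *\<^sub>R EX' + X' - A') $ i)),
          st_QhatY = (\<chi> i. cmp CQhatY i (Suc k) ((varsigma *\<^sub>R EY' + Y' - C') $ i)) \<rparr>)"

primrec alg ::
  "('n::finite \<Rightarrow> real^'d \<Rightarrow> real) \<Rightarrow> real^'n^'n \<Rightarrow> real \<Rightarrow> real \<Rightarrow> real \<Rightarrow> real \<Rightarrow> real \<Rightarrow>
   (channel \<Rightarrow> 'n \<Rightarrow> nat \<Rightarrow> real^'d \<Rightarrow> real^'d) \<Rightarrow> real^'d^'n \<Rightarrow> nat \<Rightarrow>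
   ('d::finite, 'n) alg_state" where
  "alg F W \<gamma> \<eta> \<phi>\<^sub>X \<phi>\<^sub>Y varsigma cmp X0 0 = alg_init F cmp X0"
| "alg F W \<gamma> \<eta> \<phi>\<^sub>X \<phi>\<^sub>Y varsigma cmp X0 (Suc k) =
     alg_step F W \<gamma> \<eta> \<phi>\<^sub>X \<phi>\<^sub>Y varsigma cmp k (alg F W \<gamma> \<eta> \<phi>\<^sub>X \<phi>\<^sub>Y varsigma cmp X0 k)"

section \<open>Lyapunov function\<close>

text \<open>
  The constant \<open>C = 2 r\<^sup>2 (1 - \<psi>) + 2 (1 - r)\<^sup>2\<close> vanishes for \<open>r = \<psi> = 1\<close>.
  The parameter bounds that divide by \<open>C\<close> are therefore formed in \<^typ>\<open>ereal\<close>, where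
  \<open>a / 0 = \<infinity>\<close> for \<open>a > 0\<close>: such a bound then imposes no restriction.  With real
  division, where \<open>a / 0 = 0\<close>, no admissible step size would remain.
\<close>

definition lyap_V ::
  "real \<Rightarrow> real^'d^'n \<Rightarrow> real^'d^'n \<Rightarrow> real^'d^'n \<Rightarrow> real^'d^'n \<Rightarrow> real" where
  "lyap_V \<phi> X Y A C =
     (norm (X - replicated_mean X))\<^sup>2 + \<phi> * (norm (Y - replicated_mean Y))\<^sup>2
     + (norm (X - A))\<^sup>2 + (norm (Y - C))\<^sup>2"

definition lyap_U ::
  "('n::finite \<Rightarrow> real^'d \<Rightarrow> real) \<Rightarrow> real \<Rightarrow> real \<Rightarrow>
   real^'d^'n \<Rightarrow> real^'d^'n \<Rightarrow> real^'d^'n \<Rightarrow> real^'d^'n \<Rightarrow> real" where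
  "lyap_U F Fstar \<phi> X Y A C =
     lyap_V \<phi> X Y A C + real CARD('n) * (mean_cost F (mean X) - Fstar)"

text \<open>
  The value of \<open>U\<close> at time \<open>0\<close> does not depend on the randomness of the compressor.
\<close>

definition initial_U ::
  "('n::finite \<Rightarrow> real^'d \<Rightarrow> real) \<Rightarrow> real \<Rightarrow> real \<Rightarrow> real^'d^'n \<Rightarrow> real" where
  "initial_U F Fstar \<phi> X0 = lyap_U F Fstar \<phi> X0 (local_gradients F X0) 0 0"

lemma initial_U_eq:
  "lyap_U F Fstar \<phi> (st_X s) (st_Y s) (st_A s) (st_C s) = initial_U F Fstar \<phi> X0"
  if "s = alg F W \<gamma> \<eta> \<phi>\<^sub>X \<phi>\<^sub>Y varsigma cmp X0 0"
  using that by (simp add: initial_U_def alg_init_def Let_def)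

end

theory Submission
  imports Defs
begin

text \<open>
  Only unconditional second moments are needed.  Writing \<open>s = 1 - \<sigma>\<close> and
  \<open>h\<^sup>X = varsigma E\<^sup>X(k) - E\<^sup>X(k+1)\<close>, the invariant \<open>B = (I - W) A\<close> turns the update into
  \<open>X(k+1) = X(k) - \<gamma> (I - W) (X(k) + h\<^sup>X) - \<eta> Y(k)\<close>, and similarly for \<open>Y\<close>, so compression enters
  only through the accumulated errors, whose second moments at least halve in each step up to
  a multiple \<open>2 C\<close> of the tracking errors \<open>\<parallel>X - A\<parallel>\<^sup>2\<close> and \<open>\<parallel>Y - C\<parallel>\<^sup>2\<close>.  The Lyapunov function
  \<open>\<parallel>X - Xbar\<parallel>\<^sup>2 + \<phi> \<parallel>Y - Ybar\<parallel>\<^sup>2 + \<parallel>X - A\<parallel>\<^sup>2 + s \<parallel>Y - C\<parallel>\<^sup>2 + \<rho> \<parallel>E\<^sup>X\<parallel>\<^sup>2 + \<tau> \<parallel>E\<^sup>Y\<parallel>\<^sup>2 + n (F(Xbar) - F\<^sup>\<star>)\<close>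
  then contracts in expectation by the factor \<open>1 - \<theta>\<close>.  The errors vanish at time 0 and \<open>s \<le> 1\<close>, so
  its initial value is at most \<open>U(0)\<close>.  With weight 1 instead of \<open>s\<close> on \<open>\<parallel>Y - C\<parallel>\<^sup>2\<close> the step-size
  bounds would not suffice for small \<open>s\<close>; with weight \<open>s\<close>, the contribution of \<open>\<gamma> (I - W) Y\<close> to \<open>\<parallel>Y - C\<parallel>\<^sup>2\<close> is
  absorbed by the dissipation \<open>\<gamma> \<parallel>(I - W) Y\<parallel>\<^sup>2\<close> of the averaging step.
\<close>

section \<open>Averaging\<close>

text \<open>Seen as n x d matrices, stacked vectors are averaged and mixed by multiplication from
  the left. Identities between these operators then follow from associativity and from the row and
  column sums of \<open>W\<close>.\<close>

lemma replicated_mean_eq: "replicated_mean Z = averaging_matrix ** Z"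
  by (simp add: replicated_mean_def mean_def averaging_matrix_def matrix_matrix_mult_def vec_eq_iff
      sum_component sum_distrib_left)

lemma laplacian_eq: "laplacian W Z = Z - W ** Z"
  by (simp add: laplacian_def matrix_matrix_mult_def vec_eq_iff sum_component)

lemma norm_vec_sq: "(norm Z)\<^sup>2 = (\<Sum>i\<in>UNIV. (norm (Z $ i))\<^sup>2)" for Z :: "'a::real_inner^'n"
  unfolding power2_norm_eq_inner inner_vec_def[of Z] ..

text \<open>\<open>M\<close> acts on each column of \<open>Z\<close> separately, and the squared
  norm of a stacked vector is the sum of the squared norms of its columns. The operator bound for
  single vectors therefore carries over with the same constant.\<close>

lemma norm_matrix_mult_le:
  fixes M :: "real^'n^'m" and Z :: "real^'d^'n"
  shows "norm (M ** Z) \<le> spectral_norm M * norm Z"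
proof -
  have columns: "(norm A)\<^sup>2 = (\<Sum>l\<in>UNIV. (norm (column l A))\<^sup>2)" for A :: "real^'d^'k"
  proof -
    have "(norm A)\<^sup>2 = (\<Sum>i\<in>UNIV. \<Sum>l\<in>UNIV. (A$i$l)\<^sup>2)"
      unfolding power2_norm_eq_inner inner_vec_def by (simp add: power2_eq_square)
    also have "\<dots> = (\<Sum>l\<in>UNIV. \<Sum>i\<in>UNIV. (A$i$l)\<^sup>2)" by (rule sum.swap)
    finally show ?thesis
      unfolding power2_norm_eq_inner inner_vec_def by (simp add: power2_eq_square column_def)
  qed
  have col: "column l (M ** Z) = M *v column l Z" for l
    by (simp add: column_def matrix_matrix_mult_def matrix_vector_mult_def vec_eq_iff)
  have bound: "norm (M *v x) \<le> spectral_norm M * norm x" for x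
    unfolding spectral_norm_def by (rule onorm) (rule matrix_vector_mul_bounded_linear)
  have nonneg: "0 \<le> spectral_norm M" unfolding spectral_norm_def by (rule onorm_pos_le) (rule matrix_vector_mul_bounded_linear)
  have "(norm (M ** Z))\<^sup>2 \<le> (\<Sum>l\<in>UNIV. (spectral_norm M * norm (column l Z))\<^sup>2)"
    unfolding columns col by (intro sum_mono power_mono bound) simp
  also have "\<dots> = (spectral_norm M * norm Z)\<^sup>2"
    by (simp add: power_mult_distrib columns[of Z] sum_distrib_left)
  finally show ?thesis
    by (rule power2_le_imp_le) (simp add: nonneg)
qed

lemma linear_matrix_mult: "linear (\<lambda>Z::real^'d^'n. M ** Z)"
  by (rule linearI)
    (simp_all add: matrix_matrix_mult_def vec_eq_iff sum.distrib sum_distrib_left algebra_simps)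

lemma linear_mean: "linear (mean :: real^'d^'n \<Rightarrow> real^'d)"
  by (rule linearI) (simp_all add: mean_def sum.distrib scaleR_sum_right algebra_simps)

lemma linear_replicated_mean: "linear (replicated_mean :: real^'d^'n \<Rightarrow> _)"
  using linear_matrix_mult[of averaging_matrix] by (simp add: replicated_mean_eq[abs_def])

lemma linear_laplacian: "linear (laplacian W :: real^'d^'n \<Rightarrow> _)"
  using linear_compose_sub[OF linear_id linear_matrix_mult[of W]]
  by (simp add: laplacian_eq[abs_def] id_def)

lemma mean_replicated_mean [simp]: "mean (replicated_mean Z) = mean Z"
  by (simp add: replicated_mean_def mean_def sum_constant_scaleR del: sum_constant)

lemma replicated_mean_nth [simp]: "replicated_mean Z $ i = mean Z"
  by (simp add: replicated_mean_def)

lemma replicated_mean_idem [simp]: "replicated_mean (replicated_mean Z) = replicated_mean Z"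
  by (simp add: vec_eq_iff)

lemma norm_replicated_mean_sq:
  "(norm (replicated_mean (Z :: real^'d^'n)))\<^sup>2 = real CARD('n) * (norm (mean Z))\<^sup>2"
  unfolding power2_norm_eq_inner inner_vec_def[of "replicated_mean Z"]
  by (simp add: replicated_mean_def)

text \<open>Pythagoras: \<open>replicated_mean\<close> is the orthogonal projection onto the
  consensus subspace, so \<open>Z\<close> and its projection have the squared norm of the projection
  as inner product.\<close>

lemma norm_deviation_sq:
  fixes Z :: "real^'d^'n"
  shows "(norm (Z - replicated_mean Z))\<^sup>2 = (norm Z)\<^sup>2 - (norm (replicated_mean Z))\<^sup>2"
proof -
  have "inner Z (replicated_mean Z) = (\<Sum>i\<in>UNIV. Z $ i) \<bullet> mean Z"
    by (simp add: inner_vec_def[of Z] replicated_mean_def inner_sum_left)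
  also have "(\<Sum>i\<in>UNIV. Z $ i) = real CARD('n) *\<^sub>R mean Z"
    by (simp add: mean_def)
  finally have "inner Z (replicated_mean Z) = (norm (replicated_mean Z))\<^sup>2"
    by (simp only: norm_replicated_mean_sq) (simp add: power2_norm_eq_inner)
  then show ?thesis
    by (simp add: power2_norm_eq_inner inner_diff inner_commute)
qed

lemma norm_deviation_le: "norm (Z - replicated_mean Z) \<le> norm (Z :: real^'d^'n)"
  by (rule power2_le_imp_le) (simp_all add: norm_deviation_sq)

lemma norm_replicated_mean_le: "norm (replicated_mean Z) \<le> norm (Z :: real^'d^'n)"
proof (rule power2_le_imp_le)
  show "(norm (replicated_mean Z))\<^sup>2 \<le> (norm Z)\<^sup>2"
    using norm_deviation_sq[of Z] zero_le_power2[of "norm (Z - replicated_mean Z)"] by linarith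
qed simp

lemma mult_averaging_matrix:
  fixes W :: "real^'n^'n"
  assumes "W *v 1 = 1"
  shows "W ** averaging_matrix = averaging_matrix"
proof -
  have "(\<Sum>k\<in>UNIV. W $ i $ k) = 1" for i
    using arg_cong[OF assms, of "\<lambda>v. v $ i"] by (simp add: matrix_vector_mult_def)
  then show ?thesis
    by (simp add: matrix_matrix_mult_def averaging_matrix_def vec_eq_iff flip: sum_divide_distrib)
qed

lemma averaging_matrix_mult:
  fixes W :: "real^'n^'n"
  assumes "1 v* W = 1"
  shows "averaging_matrix ** W = averaging_matrix"
proof -
  have "(\<Sum>k\<in>UNIV. W $ k $ i) = 1" for i
    using arg_cong[OF assms, of "\<lambda>v. v $ i"] by (simp add: vector_matrix_mult_def)
  then show ?thesis
    by (simp add: matrix_matrix_mult_def averaging_matrix_def vec_eq_iff flip: sum_divide_distrib)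
qed

lemma laplacian_replicated_mean:
  assumes "W *v 1 = 1"
  shows "laplacian W (replicated_mean Z) = 0"
  by (simp add: laplacian_eq replicated_mean_eq matrix_mul_assoc mult_averaging_matrix[OF assms])

lemma replicated_mean_laplacian:
  assumes "1 v* W = 1"
  shows "replicated_mean (laplacian W Z) = 0"
  by (simp add: laplacian_eq replicated_mean_eq linear_diff[OF linear_matrix_mult] matrix_mul_assoc
      averaging_matrix_mult[OF assms])

lemma mean_eq_0_iff: "mean Z = 0 \<longleftrightarrow> replicated_mean Z = 0"
  by (simp add: replicated_mean_def vec_eq_iff)

text \<open>Deviations have mean zero, so \<open>averaging_matrix\<close> annihilates them and
  \<open>W\<close> acts on them as \<open>W - averaging_matrix\<close>.\<close>

lemma norm_weighted_deviation_le:
  fixes W :: "real^'n^'n" and Z :: "real^'d^'n"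
  assumes "W *v 1 = 1"
  shows "norm (W ** (Z - replicated_mean Z))
    \<le> spectral_norm (W - averaging_matrix) * norm (Z - replicated_mean Z)"
proof -
  let ?U = "Z - replicated_mean Z"
  have "(W - averaging_matrix) ** A = W ** A - averaging_matrix ** A" for A :: "real^'d^'n"
    by (simp add: matrix_matrix_mult_def vec_eq_iff sum_subtractf left_diff_distrib)
  moreover have "averaging_matrix ** ?U = 0"
    by (simp flip: replicated_mean_eq add: linear_diff[OF linear_replicated_mean])
  ultimately show ?thesis
    using norm_matrix_mult_le[of "W - averaging_matrix" ?U] by simp
qed

lemma laplacian_deviation:
  assumes "W *v 1 = 1"
  shows "laplacian W (Z - replicated_mean Z) = laplacian W Z"
  by (simp add: linear_diff[OF linear_laplacian] laplacian_replicated_mean[OF assms])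

text \<open>I - W does not see the consensus part, and \<open>W\<close> is nonexpansive on the
  deviation; the triangle inequality costs the factor 2.\<close>

lemma norm_laplacian_le:
  assumes "W *v 1 = 1" "spectral_norm (W - averaging_matrix) \<le> 1"
  shows "norm (laplacian W Z) \<le> 2 * norm (Z - replicated_mean Z)"
proof -
  have "norm (laplacian W Z) \<le> norm (Z - replicated_mean Z) + norm (W ** (Z - replicated_mean Z))"
    unfolding laplacian_deviation[OF assms(1), of Z, symmetric] laplacian_eq[of W "Z - replicated_mean Z"]
    by (rule norm_triangle_ineq4)
  also have "norm (W ** (Z - replicated_mean Z)) \<le> 1 * norm (Z - replicated_mean Z)"
    using norm_weighted_deviation_le[OF assms(1), of Z] mult_right_mono[OF assms(2)]
    by (meson norm_ge_zero order_trans)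
  finally show ?thesis by simp
qed

lemma norm_laplacian_le':
  assumes "W *v 1 = 1" "spectral_norm (W - averaging_matrix) \<le> 1"
  shows "norm (laplacian W Z) \<le> 2 * norm Z"
  using norm_laplacian_le[OF assms, of Z] norm_deviation_le[of Z] by linarith

section \<open>Weighted Young inequalities and the contraction of one averaging step\<close>

lemma norm_add_sq_le: "(norm (a + b))\<^sup>2 \<le> 2 * (norm a)\<^sup>2 + 2 * (norm (b::'a::real_inner))\<^sup>2"
  using zero_le_power2[of "norm (a - b)"]
  by (simp add: power2_norm_eq_inner inner_add inner_diff inner_commute)

text \<open>After the triangle inequality the defect is a perfect square. This form lets
  \<open>t\<close> be matched to a contraction rate: \<open>\<gamma> * s\<close> for the averaging
  step, \<open>c / (1 + c)\<close> for the compressed tracking errors.\<close>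

lemma norm_add_sq_le_weighted:
  fixes a b :: "'a::real_inner"
  assumes "0 < t" "t < 1"
  shows "(norm (a + b))\<^sup>2 \<le> (norm a)\<^sup>2 / (1 - t) + (norm b)\<^sup>2 / t"
proof -
  have "(norm (a + b))\<^sup>2 \<le> (norm a + norm b)\<^sup>2"
    by (intro power_mono norm_triangle_ineq norm_ge_zero)
  also have "\<dots> = (norm a)\<^sup>2 / (1 - t) + (norm b)\<^sup>2 / t
      - (t * norm a - (1 - t) * norm b)\<^sup>2 / (t * (1 - t))"
    using assms by (simp add: divide_simps) (simp add: power2_eq_square algebra_simps)
  also have "\<dots> \<le> (norm a)\<^sup>2 / (1 - t) + (norm b)\<^sup>2 / t"
    using assms by simp
  finally show ?thesis .
qed

text \<open>The negative term on the right comes from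
  \<open>\<parallel>(1 - \<gamma>) u + \<gamma> v\<parallel>\<^sup>2 = (1 - \<gamma>) \<parallel>u\<parallel>\<^sup>2 + \<gamma> \<parallel>v\<parallel>\<^sup>2 - \<gamma> (1 - \<gamma>) \<parallel>u - v\<parallel>\<^sup>2\<close>.\<close>

lemma lazy_contraction:
  fixes u v :: "'a::real_inner"
  assumes v: "norm v \<le> (1 - s) * norm u" and s: "0 < s" "s < 1" and \<gamma>: "0 < \<gamma>" "\<gamma> \<le> 1/5"
  shows "(norm (u - \<gamma> *\<^sub>R (u - v)))\<^sup>2 / (1 - \<gamma> * s)
    \<le> (1 - 23/25 * \<gamma> * s) * (norm u)\<^sup>2 - 2/25 * \<gamma> * (norm (u - v))\<^sup>2"
proof -
  define U z where "U = (norm u)\<^sup>2" and "z = (norm (u - v))\<^sup>2"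
  have t: "\<gamma> * s < 1" using s \<gamma> mult_strict_mono[of \<gamma> 1 s 1] by simp
  have "U \<ge> 0" by (simp add: U_def)
  \<comment> \<open>By the reverse triangle inequality the residual \<open>u - v\<close> is not
    small compared with \<open>u\<close>, so dissipation in \<open>z\<close> can be traded for decay
    of \<open>U\<close>.\<close>
  have "s * norm u \<le> norm (u - v)"
    using v norm_triangle_ineq2[of u v] by (simp add: algebra_simps)
  then have "(s * norm u)\<^sup>2 \<le> z"
    unfolding z_def using s by (intro power_mono) auto
  then have z: "s\<^sup>2 * U \<le> z" by (simp add: U_def power_mult_distrib)
  have "(norm v)\<^sup>2 \<le> ((1 - s) * norm u)\<^sup>2"
    using v by (intro power_mono) auto
  then have V: "\<gamma> * (norm v)\<^sup>2 \<le> \<gamma> * ((1 - s)\<^sup>2 * U)"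
    using \<gamma> by (intro mult_left_mono) (auto simp: U_def power_mult_distrib)
  have "(norm (u - \<gamma> *\<^sub>R (u - v)))\<^sup>2 = (1 - \<gamma>) * U + \<gamma> * (norm v)\<^sup>2 - \<gamma> * (1 - \<gamma>) * z"
    by (simp add: U_def z_def power2_norm_eq_inner inner_diff inner_commute algebra_simps)
  also have "\<dots> \<le> (1 - 2 * \<gamma> * s + \<gamma> * s\<^sup>2) * U - \<gamma> * (1 - \<gamma>) * z"
    using V by (simp add: power2_eq_square algebra_simps)
  \<comment> \<open>The right side minus the left side equals the sum of the two nonnegative terms
    below. Keeping the fraction 2/25 of the dissipation lowers the decay rate from
    \<open>\<gamma> * s\<close> to 23/25 of it.\<close>
  also have "\<dots> \<le> ((1 - 23/25 * \<gamma> * s) * U - 2/25 * \<gamma> * z) * (1 - \<gamma> * s)"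
  proof -
    have "0 \<le> (1 - \<gamma>) - 2/25 * (1 - \<gamma> * s)"
      using \<gamma> mult_left_mono[of "1 - \<gamma> * s" 1 "2/25"] mult_pos_pos[OF \<gamma>(1) s(1)] by simp
    then have "0 \<le> \<gamma> * ((1 - \<gamma>) - 2/25 * (1 - \<gamma> * s)) * (z - s\<^sup>2 * U)"
      using z \<gamma> by simp
    moreover have "0 \<le> 2/25 * \<gamma> * s * (1 - s) * (1 - \<gamma> * s) * U"
      using s \<gamma> t \<open>U \<ge> 0\<close> by (intro mult_nonneg_nonneg) auto
    ultimately show ?thesis by (simp add: power2_eq_square field_simps)
  qed
  finally show ?thesis
    using t by (simp add: U_def z_def pos_divide_le_eq)
qed

text \<open>The range of I - W has mean zero, so the deviation performs a lazy averaging step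
  perturbed by \<open>h\<close> and \<open>w\<close>. Young's inequality with weight
  \<open>\<gamma> * s\<close> separates the two, and its factor
  \<open>1 / (1 - \<gamma> * s)\<close> is the one already absorbed in
  \<open>lazy_contraction\<close>.\<close>

lemma consensus_step:
  fixes Z h w :: "real^'d^'n"
  assumes W: "W *v 1 = 1" "1 v* W = 1"
    and s: "spectral_norm (W - averaging_matrix) = 1 - s" "0 < s" "s < 1"
    and \<gamma>: "0 < \<gamma>" "\<gamma> \<le> 1/5"
    and Z': "Z' = Z - \<gamma> *\<^sub>R laplacian W (Z + h) + w"
  shows "(norm (Z' - replicated_mean Z'))\<^sup>2
    \<le> (1 - 23/25 * \<gamma> * s) * (norm (Z - replicated_mean Z))\<^sup>2 - 2/25 * \<gamma> * (norm (laplacian W Z))\<^sup>2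
      + 8 * \<gamma> / s * (norm h)\<^sup>2 + 2 / (\<gamma> * s) * (norm (w - replicated_mean w))\<^sup>2"
proof -
  define U v where "U = Z - replicated_mean Z" and "v = - (\<gamma> *\<^sub>R laplacian W h) + (w - replicated_mean w)"
  have LU: "laplacian W Z = U - W ** U"
    using laplacian_deviation[OF W(1), of Z] by (simp add: U_def laplacian_eq)
  have t: "0 < \<gamma> * s" "\<gamma> * s < 1" using s \<gamma> mult_strict_mono[of \<gamma> 1 s 1] by simp_all
  have "Z' - replicated_mean Z' = (U - \<gamma> *\<^sub>R (U - W ** U)) + v"
    unfolding Z' linear_add[OF linear_laplacian]
    by (simp add: linear_add[OF linear_replicated_mean] linear_diff[OF linear_replicated_mean]
        linear_scale[OF linear_replicated_mean] replicated_mean_laplacian[OF W(2)] LU[symmetric]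
        scaleR_add_right) (simp add: U_def v_def)
  then have "(norm (Z' - replicated_mean Z'))\<^sup>2
      \<le> (norm (U - \<gamma> *\<^sub>R (U - W ** U)))\<^sup>2 / (1 - \<gamma> * s) + (norm v)\<^sup>2 / (\<gamma> * s)"
    using norm_add_sq_le_weighted[OF t] by simp
  moreover have "(norm (U - \<gamma> *\<^sub>R (U - W ** U)))\<^sup>2 / (1 - \<gamma> * s)
      \<le> (1 - 23/25 * \<gamma> * s) * (norm U)\<^sup>2 - 2/25 * \<gamma> * (norm (laplacian W Z))\<^sup>2"
    unfolding LU using norm_weighted_deviation_le[OF W(1), of Z] s
    by (intro lazy_contraction s \<gamma>) (simp add: U_def)
  \<comment> \<open>The 8 is a 2 from splitting the perturbation times a 4 from the squared norm
    bound 2 of I - W.\<close>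
  moreover have "(norm v)\<^sup>2 / (\<gamma> * s)
      \<le> 8 * \<gamma> / s * (norm h)\<^sup>2 + 2 / (\<gamma> * s) * (norm (w - replicated_mean w))\<^sup>2"
  proof -
    have "(norm v)\<^sup>2 \<le> 2 * (\<gamma> * norm (laplacian W h))\<^sup>2 + 2 * (norm (w - replicated_mean w))\<^sup>2"
      using norm_add_sq_le[of "- (\<gamma> *\<^sub>R laplacian W h)" "w - replicated_mean w"] \<gamma>
      by (simp add: v_def)
    also have "(\<gamma> * norm (laplacian W h))\<^sup>2 \<le> (\<gamma> * (2 * norm h))\<^sup>2"
      using norm_laplacian_le'[OF W(1), of h] s \<gamma> by (intro power_mono mult_left_mono) auto
    finally have "(norm v)\<^sup>2 / (\<gamma> * s) \<le> (8 * \<gamma>\<^sup>2 * (norm h)\<^sup>2 + 2 * (norm (w - replicated_mean w))\<^sup>2) / (\<gamma> * s)"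
      using t by (intro divide_right_mono) (auto simp: power_mult_distrib)
    also have "\<dots> = 8 * \<gamma> / s * (norm h)\<^sup>2 + 2 / (\<gamma> * s) * (norm (w - replicated_mean w))\<^sup>2"
      using s \<gamma> by (simp add: field_simps power2_eq_square)
    finally show ?thesis .
  qed
  ultimately show ?thesis by (simp add: U_def)
qed

section \<open>Gradient descent\<close>

lemma gradient_mean_cost:
  fixes F :: "'n::finite \<Rightarrow> real^'d \<Rightarrow> real"
  assumes "\<And>i x. F i differentiable (at x)"
  shows "GDERIV (mean_cost F) x :> mean (local_gradients F (\<chi> i. x))"
proof -
  have "((\<lambda>y. (1 / real CARD('n)) * (\<Sum>i\<in>UNIV. F i y)) has_derivative
      (\<lambda>h. (1 / real CARD('n)) * (\<Sum>i\<in>UNIV. h \<bullet> gradient (F i) x))) (at x)"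
    using GDERIV_gradient[OF assms, unfolded gderiv_def]
    by (intro has_derivative_mult_right has_derivative_sum)
  then show ?thesis
    unfolding gderiv_def mean_cost_def[abs_def]
    by (simp add: mean_def local_gradients_def inner_sum_right)
qed

lemma norm_local_gradients_diff_le:
  fixes F :: "'n::finite \<Rightarrow> real^'d \<Rightarrow> real"
  assumes "L \<ge> 0" "\<And>i x y. norm (gradient (F i) x - gradient (F i) y) \<le> L * norm (x - y)"
  shows "norm (local_gradients F X - local_gradients F Y) \<le> L * norm (X - Y)"
proof (rule power2_le_imp_le)
  have "(norm (local_gradients F X - local_gradients F Y))\<^sup>2 \<le> (\<Sum>i\<in>UNIV. (L * norm (X $ i - Y $ i))\<^sup>2)"
    unfolding norm_vec_sq[of "_ :: real^'d^'n"] by (intro sum_mono power_mono) (auto simp: local_gradients_def assms)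
  also have "\<dots> = (L * norm (X - Y))\<^sup>2"
    by (simp add: norm_vec_sq[of "X - Y"] power_mult_distrib sum_distrib_left)
  finally show "(norm (local_gradients F X - local_gradients F Y))\<^sup>2 \<le> (L * norm (X - Y))\<^sup>2" .
qed (use assms in auto)

lemma descent_lemma:
  fixes f :: "'a::real_inner \<Rightarrow> real"
  assumes f: "\<And>x. GDERIV f x :> g x" and L: "\<And>x y. norm (g x - g y) \<le> L * norm (x - y)"
  shows "f (x + d) \<le> f x + g x \<bullet> d + L / 2 * (norm d)\<^sup>2"
proof -
  \<comment> \<open>\<open>\<phi>\<close> is \<open>f\<close> along the segment minus its linear and
    quadratic upper model; Lipschitz continuity of the gradient makes it nonincreasing.\<close>
  define \<phi> where "\<phi> t = f (x + t *\<^sub>R d) - t * (g x \<bullet> d) - L / 2 * t\<^sup>2 * (norm d)\<^sup>2" for t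
  have "\<phi> 1 \<le> \<phi> 0"
  proof (rule DERIV_nonpos_imp_nonincreasing[of 0 1])
    fix t :: real assume t: "0 \<le> t" "t \<le> 1"
    have "((\<lambda>t. f (x + t *\<^sub>R d)) has_derivative (\<lambda>h. (h *\<^sub>R d) \<bullet> g (x + t *\<^sub>R d))) (at t)"
    proof -
      have "((\<lambda>t. x + t *\<^sub>R d) has_derivative (\<lambda>h. h *\<^sub>R d)) (at t)"
        by (auto intro!: derivative_eq_intros)
      from has_derivative_compose[OF this f[unfolded gderiv_def]] show ?thesis .
    qed
    then have "DERIV (\<lambda>t. f (x + t *\<^sub>R d)) t :> g (x + t *\<^sub>R d) \<bullet> d"
      by (rule has_derivative_imp_has_field_derivative) (simp add: inner_commute)
    then have "DERIV \<phi> t :> g (x + t *\<^sub>R d) \<bullet> d - g x \<bullet> d - L * t * (norm d)\<^sup>2"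
      unfolding \<phi>_def by (auto intro!: derivative_eq_intros)
    moreover have "g (x + t *\<^sub>R d) \<bullet> d - g x \<bullet> d \<le> L * t * (norm d)\<^sup>2"
    proof -
      have "g (x + t *\<^sub>R d) \<bullet> d - g x \<bullet> d \<le> norm (g (x + t *\<^sub>R d) - g x) * norm d"
        using norm_cauchy_schwarz[of "g (x + t *\<^sub>R d) - g x" d] by (simp add: inner_diff)
      also have "\<dots> \<le> (L * norm (t *\<^sub>R d)) * norm d"
        using L[of "x + t *\<^sub>R d" x] by (intro mult_right_mono) auto
      finally show ?thesis using t by (simp add: power2_eq_square algebra_simps)
    qed
    ultimately show "\<exists>y. DERIV \<phi> t :> y \<and> y \<le> 0" by force
  qed simp
  then show ?thesis by (simp add: \<phi>_def)
qed

text \<open>This is inexact gradient descent for the mean cost: \<open>mean Y\<close> averages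
  gradients taken at the agents' own points, and its distance to the gradient at
  \<open>mean X\<close> is controlled by the consensus error.\<close>

lemma gradient_step:
  fixes F :: "'n::finite \<Rightarrow> real^'d \<Rightarrow> real" and X Y :: "real^'d^'n"
  assumes diff: "\<And>i x. F i differentiable (at x)"
    and L: "L \<ge> 0" "\<And>i x y. norm (gradient (F i) x - gradient (F i) y) \<le> L * norm (x - y)"
    and PL: "\<And>x. 1 / 2 * (norm (gradient (mean_cost F) x))\<^sup>2 \<ge> \<nu> * (mean_cost F x - m)"
    and \<eta>: "0 < \<eta>" "2 * L * \<eta> \<le> 1"
    and Y: "mean Y = mean (local_gradients F X)"
  shows "real CARD('n) * (mean_cost F (mean X - \<eta> *\<^sub>R mean Y) - m)
    \<le> (1 - \<eta> * \<nu>) * (real CARD('n) * (mean_cost F (mean X) - m))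
      - \<eta> / 4 * (norm (replicated_mean Y))\<^sup>2 + \<eta> * L\<^sup>2 / 2 * (norm (X - replicated_mean X))\<^sup>2"
proof -
  define g where "g x = mean (local_gradients F (\<chi> i. x))" for x
  have G: "GDERIV (mean_cost F) x :> g x" for x
    unfolding g_def by (rule gradient_mean_cost[OF diff])
  \<comment> \<open>This bound serves twice: on constant stacked vectors it gives the Lipschitz
    constant of \<open>g\<close>, and on \<open>X\<close> against its replicated mean it gives the
    gradient error \<open>err\<close>.\<close>
  have dev: "real CARD('n) * (norm (mean (local_gradients F A) - mean (local_gradients F B)))\<^sup>2
      \<le> L\<^sup>2 * (norm (A - B))\<^sup>2" for A B :: "real^'d^'n"
  proof -
    have "real CARD('n) * (norm (mean (local_gradients F A) - mean (local_gradients F B)))\<^sup>2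
        = (norm (replicated_mean (local_gradients F A - local_gradients F B)))\<^sup>2"
      by (simp add: norm_replicated_mean_sq linear_diff[OF linear_mean])
    also have "\<dots> \<le> (L * norm (A - B))\<^sup>2"
      by (intro power_mono order_trans[OF norm_replicated_mean_le norm_local_gradients_diff_le[OF L]]) auto
    finally show ?thesis by (simp add: power_mult_distrib)
  qed
  have lip: "norm (g x - g y) \<le> L * norm (x - y)" for x y
  proof -
    have "(norm ((\<chi> i. x) - (\<chi> i. y) :: real^'d^'n))\<^sup>2 = real CARD('n) * (norm (x - y))\<^sup>2"
      unfolding power2_norm_eq_inner inner_vec_def[of "(\<chi> i. x) - (\<chi> i. y)"] by simp
    then have "(norm (g x - g y))\<^sup>2 \<le> (L * norm (x - y))\<^sup>2"
      using dev[of "\<chi> i. x" "\<chi> i. y"] by (simp add: g_def power_mult_distrib)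
    then show ?thesis by (rule power2_le_imp_le) (use L in auto)
  qed
  let ?x = "mean X" and ?y = "mean Y"
  have err: "real CARD('n) * (norm (g ?x - ?y))\<^sup>2 \<le> L\<^sup>2 * (norm (X - replicated_mean X))\<^sup>2"
    using dev[of "replicated_mean X" X] by (simp add: g_def Y replicated_mean_def norm_minus_commute)
  have "mean_cost F (?x - \<eta> *\<^sub>R ?y) \<le> mean_cost F ?x - \<eta> * (g ?x \<bullet> ?y) + L / 2 * \<eta>\<^sup>2 * (norm ?y)\<^sup>2"
    using descent_lemma[OF G lip, of ?x "- (\<eta> *\<^sub>R ?y)"] by (simp add: power_mult_distrib)
  \<comment> \<open>\<open>2 * L * \<eta> \<le> 1\<close> limits the curvature term to half of the
    \<open>\<eta> / 2\<close> that the next identity provides, so \<open>\<eta> / 4\<close>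
    survives.\<close>
  moreover have "L / 2 * \<eta>\<^sup>2 * (norm ?y)\<^sup>2 \<le> \<eta> / 4 * (norm ?y)\<^sup>2"
    using \<eta> mult_right_mono[OF \<eta>(2), of \<eta>] by (intro mult_right_mono) (auto simp: power2_eq_square)
  \<comment> \<open>Polarization splits the inner product: the term in \<open>g ?x\<close> feeds the
    Polyak-Lojasiewicz inequality, the one in \<open>?y\<close> is kept as dissipation, and the
    difference is the gradient error.\<close>
  moreover have "\<eta> * (g ?x \<bullet> ?y) = \<eta> / 2 * ((norm (g ?x))\<^sup>2 + (norm ?y)\<^sup>2 - (norm (g ?x - ?y))\<^sup>2)"
    by (simp add: power2_norm_eq_inner inner_diff inner_commute algebra_simps)
  moreover have "\<dots> \<ge> \<eta> / 2 * (2 * \<nu> * (mean_cost F ?x - m) + (norm ?y)\<^sup>2 - (norm (g ?x - ?y))\<^sup>2)"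
    using \<eta> PL[of ?x] gradient_eqI[OF G, of ?x] by (intro mult_left_mono) auto
  ultimately have "mean_cost F (?x - \<eta> *\<^sub>R ?y) - m
      \<le> (1 - \<eta> * \<nu>) * (mean_cost F ?x - m) - \<eta> / 4 * (norm ?y)\<^sup>2 + \<eta> / 2 * (norm (g ?x - ?y))\<^sup>2"
    by (simp add: algebra_simps)
  then have "real CARD('n) * (mean_cost F (?x - \<eta> *\<^sub>R ?y) - m)
      \<le> real CARD('n) * ((1 - \<eta> * \<nu>) * (mean_cost F ?x - m) - \<eta> / 4 * (norm ?y)\<^sup>2 + \<eta> / 2 * (norm (g ?x - ?y))\<^sup>2)"
    by (intro mult_left_mono) auto
  also have "\<dots> = (1 - \<eta> * \<nu>) * (real CARD('n) * (mean_cost F ?x - m))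
      - \<eta> / 4 * (norm (replicated_mean Y))\<^sup>2 + \<eta> / 2 * (real CARD('n) * (norm (g ?x - ?y))\<^sup>2)"
    by (simp add: norm_replicated_mean_sq algebra_simps)
  also have "\<eta> / 2 * (real CARD('n) * (norm (g ?x - ?y))\<^sup>2) \<le> \<eta> / 2 * (L\<^sup>2 * (norm (X - replicated_mean X))\<^sup>2)"
    using err \<eta> by (intro mult_left_mono) auto
  finally show ?thesis by simp
qed

section \<open>Compression of independent vectors\<close>

text \<open>Measurability is demanded separately because integrability of the squared norm does not
  imply it.\<close>

definition sq_integrable :: "'a measure \<Rightarrow> ('a \<Rightarrow> 'b::euclidean_space) \<Rightarrow> bool" where
  "sq_integrable M v \<longleftrightarrow> v \<in> borel_measurable M \<and> integrable M (\<lambda>\<omega>. (norm (v \<omega>))\<^sup>2)"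

lemma sq_integrable_bound:
  assumes u: "sq_integrable M u" and v: "v \<in> borel_measurable M"
    and le: "\<And>\<omega>. norm (v \<omega>) \<le> K * norm (u \<omega>)"
  shows "sq_integrable M v"
  unfolding sq_integrable_def
proof
  have "integrable M (\<lambda>\<omega>. K\<^sup>2 * (norm (u \<omega>))\<^sup>2)"
    using u by (simp add: sq_integrable_def)
  then show "integrable M (\<lambda>\<omega>. (norm (v \<omega>))\<^sup>2)"
  proof (rule Bochner_Integration.integrable_bound)
    show "(\<lambda>\<omega>. (norm (v \<omega>))\<^sup>2) \<in> borel_measurable M"
      using v by measurable
    have "(norm (v \<omega>))\<^sup>2 \<le> (K * norm (u \<omega>))\<^sup>2" for \<omega>
      by (intro power_mono le) simp
    then show "AE \<omega> in M. norm ((norm (v \<omega>))\<^sup>2) \<le> norm (K\<^sup>2 * (norm (u \<omega>))\<^sup>2)"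
      by (simp add: power_mult_distrib)
  qed
qed fact

lemma sq_integrable_add:
  assumes "sq_integrable M u" "sq_integrable M v"
  shows "sq_integrable M (\<lambda>\<omega>. u \<omega> + v \<omega>)"
  unfolding sq_integrable_def
proof
  show m: "(\<lambda>\<omega>. u \<omega> + v \<omega>) \<in> borel_measurable M"
    using assms unfolding sq_integrable_def by (intro borel_measurable_add) auto
  have "integrable M (\<lambda>\<omega>. 2 * (norm (u \<omega>))\<^sup>2 + 2 * (norm (v \<omega>))\<^sup>2)"
    using assms by (simp add: sq_integrable_def)
  then show "integrable M (\<lambda>\<omega>. (norm (u \<omega> + v \<omega>))\<^sup>2)"
  proof (rule Bochner_Integration.integrable_bound)
    show "(\<lambda>\<omega>. (norm (u \<omega> + v \<omega>))\<^sup>2) \<in> borel_measurable M"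
      using m by measurable
    show "AE \<omega> in M. norm ((norm (u \<omega> + v \<omega>))\<^sup>2) \<le> norm (2 * (norm (u \<omega>))\<^sup>2 + 2 * (norm (v \<omega>))\<^sup>2)"
      by (intro AE_I2) (simp add: norm_add_sq_le)
  qed
qed

lemma sq_integrable_linear:
  fixes f :: "'b::euclidean_space \<Rightarrow> 'c::euclidean_space"
  assumes "linear f" "sq_integrable M v"
  shows "sq_integrable M (\<lambda>\<omega>. f (v \<omega>))"
proof -
  interpret bounded_linear f using assms(1) by (rule linear_conv_bounded_linear[THEN iffD1])
  from bounded obtain K where "\<And>x. norm (f x) \<le> K * norm x" by (auto simp: mult.commute)
  moreover have "f \<in> borel_measurable borel"
    by (intro borel_measurable_continuous_onI linear_continuous_on bounded_linear_axioms)
  then have "(\<lambda>\<omega>. f (v \<omega>)) \<in> borel_measurable M"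
    using assms(2) by (auto simp: sq_integrable_def intro: measurable_compose)
  ultimately show ?thesis by (intro sq_integrable_bound[OF assms(2)])
qed

lemma sq_integrable_scaleR: "sq_integrable M v \<Longrightarrow> sq_integrable M (\<lambda>\<omega>. c *\<^sub>R v \<omega>)"
  by (rule sq_integrable_linear[OF linear_scale_self])

lemma sq_integrable_diff:
  "sq_integrable M u \<Longrightarrow> sq_integrable M v \<Longrightarrow> sq_integrable M (\<lambda>\<omega>. u \<omega> - v \<omega>)"
  using sq_integrable_add[of M u "\<lambda>\<omega>. (-1) *\<^sub>R v \<omega>"] sq_integrable_scaleR[of M v "-1"] by simp

lemma (in finite_measure) sq_integrable_const: "sq_integrable M (\<lambda>_. c)"
  by (simp add: sq_integrable_def)

lemma borel_measurable_vec_nth: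
  "(\<lambda>x. x $ i) \<in> borel_measurable (borel :: ('a::euclidean_space^'n) measure)"
  by (intro borel_measurable_continuous_onI continuous_intros)

lemma borel_measurable_vec_lambda:
  fixes f :: "'n::finite \<Rightarrow> 'w \<Rightarrow> 'a::euclidean_space"
  assumes "\<And>i. f i \<in> borel_measurable N"
  shows "(\<lambda>\<omega>. \<chi> i. f i \<omega>) \<in> borel_measurable N"
proof (rule borel_measurable_euclidean_space[THEN iffD2], safe)
  fix b :: "'a^'n" assume "b \<in> Basis"
  then obtain i c where "b = axis i c" by (auto simp: Basis_vec_def)
  then have "(\<lambda>\<omega>. (\<chi> i. f i \<omega>) \<bullet> b) = (\<lambda>\<omega>. f i \<omega> \<bullet> c)"
    by (simp add: inner_axis)
  then show "(\<lambda>\<omega>. (\<chi> i. f i \<omega>) \<bullet> b) \<in> borel_measurable N"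
    using assms[of i] by simp
qed

section \<open>Independence of a random vector from a fresh seed\<close>

text \<open>\<open>\<zeta>\<close> has law \<open>R\<close> and is independent of \<open>v\<close>; \<open>indep_var\<close> cannot say so, since it
  requires both variables to take values in the same type.\<close>

definition fresh :: "'w measure \<Rightarrow> 'r measure \<Rightarrow> ('w \<Rightarrow> 'b::topological_space) \<Rightarrow> ('w \<Rightarrow> 'r) \<Rightarrow> bool" where
  "fresh M R v \<zeta> \<longleftrightarrow> v \<in> borel_measurable M \<and> \<zeta> \<in> M \<rightarrow>\<^sub>M R \<and>
     distr M borel v \<Otimes>\<^sub>M R = distr M (borel \<Otimes>\<^sub>M R) (\<lambda>\<omega>. (v \<omega>, \<zeta> \<omega>))"

text \<open>Independence of \<open>S\<close> and \<open>T\<close> passes to functions of them, since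
  the image of a product measure under a product map is the product of the images. It is applied
  with \<open>S\<close> the past seeds and \<open>T\<close> a single current seed.\<close>

lemma (in prob_space) fresh_compose:
  assumes S: "S \<in> M \<rightarrow>\<^sub>M N" and T: "T \<in> M \<rightarrow>\<^sub>M K"
    and pair: "distr M N S \<Otimes>\<^sub>M distr M K T = distr M (N \<Otimes>\<^sub>M K) (\<lambda>\<omega>. (S \<omega>, T \<omega>))"
    and g: "g \<in> borel_measurable N" and h: "h \<in> K \<rightarrow>\<^sub>M R"
    and R: "distr M R (\<lambda>\<omega>. h (T \<omega>)) = R"
  shows "fresh M R (\<lambda>\<omega>. g (S \<omega>)) (\<lambda>\<omega>. h (T \<omega>))"
proof -
  note [measurable] = S T g h
  have hT: "distr (distr M K T) R h = R"
    using R by (simp add: distr_distr[OF h T] comp_def)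
  \<comment> \<open>Being the law of \<open>h (T \<omega>)\<close> makes \<open>R\<close> a
    probability measure, which supplies the sigma-finiteness needed for
    \<open>pair_measure_distr\<close>.\<close>
  have "prob_space R"
    using prob_space_distr[of "\<lambda>\<omega>. h (T \<omega>)" R] R by simp
  then interpret R: prob_space R .
  have "distr M borel (\<lambda>\<omega>. g (S \<omega>)) \<Otimes>\<^sub>M R = distr (distr M N S) borel g \<Otimes>\<^sub>M distr (distr M K T) R h"
    by (simp add: distr_distr[OF g S] comp_def hT)
  also have "\<dots> = distr (distr M N S \<Otimes>\<^sub>M distr M K T) (borel \<Otimes>\<^sub>M R) (\<lambda>(x, y). (g x, h y))"
    by (rule pair_measure_distr) (use g h in \<open>auto simp: hT R.sigma_finite_measure_axioms\<close>)
  also have "\<dots> = distr M (borel \<Otimes>\<^sub>M R) (\<lambda>\<omega>. (g (S \<omega>), h (T \<omega>)))"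
    unfolding pair by (subst distr_distr) (auto simp: comp_def)
  finally show ?thesis by (simp add: fresh_def)
qed

lemma (in prob_space) fresh_map:
  assumes fresh: "fresh M R v \<zeta>" and \<zeta>: "distr M R \<zeta> = R" and g: "g \<in> borel_measurable borel"
  shows "fresh M R (\<lambda>\<omega>. g (v \<omega>)) \<zeta>"
proof (rule fresh_compose[where g = g and h = "\<lambda>x. x" and N = borel and K = R])
  show "distr M borel v \<Otimes>\<^sub>M distr M R \<zeta> = distr M (borel \<Otimes>\<^sub>M R) (\<lambda>\<omega>. (v \<omega>, \<zeta> \<omega>))"
    unfolding \<zeta> using fresh by (simp add: fresh_def)
qed (use fresh g \<zeta> in \<open>simp_all add: fresh_def\<close>)

text \<open>Under the product law the seed is integrated first with the vector frozen (Tonelli),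
  which turns the pointwise moment bound into an unconditional one. Nonnegative integrals are used
  so that integrability of the image is a result and not a prerequisite.\<close>

lemma (in prob_space) fresh_map_moment:
  fixes T :: "'r \<Rightarrow> 'b::euclidean_space \<Rightarrow> 'c::euclidean_space"
  assumes R: "prob_space R" and T: "case_prod T \<in> borel_measurable (R \<Otimes>\<^sub>M borel)"
    and int: "\<And>x. integrable R (\<lambda>s. (norm (T s x))\<^sup>2)"
    and le: "\<And>x. (\<integral>s. (norm (T s x))\<^sup>2 \<partial>R) \<le> c * (norm x)\<^sup>2" and c: "0 \<le> c"
    and fresh: "fresh M R v \<zeta>"
    and v: "sq_integrable M v"
  shows "sq_integrable M (\<lambda>\<omega>. T (\<zeta> \<omega>) (v \<omega>))"
    and "(\<integral>\<omega>. (norm (T (\<zeta> \<omega>) (v \<omega>)))\<^sup>2 \<partial>M) \<le> c * (\<integral>\<omega>. (norm (v \<omega>))\<^sup>2 \<partial>M)"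
proof -
  interpret R: prob_space R by fact
  have [measurable]: "v \<in> borel_measurable M" "\<zeta> \<in> M \<rightarrow>\<^sub>M R"
    using fresh by (auto simp: fresh_def)
  have pair: "distr M borel v \<Otimes>\<^sub>M R = distr M (borel \<Otimes>\<^sub>M R) (\<lambda>\<omega>. (v \<omega>, \<zeta> \<omega>))"
    using fresh by (simp add: fresh_def)
  have T': "(\<lambda>p. T (snd p) (fst p)) \<in> borel_measurable (borel \<Otimes>\<^sub>M R)"
    using measurable_compose[OF measurable_pair_swap' T] by (simp add: case_prod_beta)
  have m: "(\<lambda>\<omega>. T (\<zeta> \<omega>) (v \<omega>)) \<in> borel_measurable M"
    using measurable_compose[of "\<lambda>\<omega>. (\<zeta> \<omega>, v \<omega>)" M, OF _ T] by simp
  have iv: "integrable M (\<lambda>\<omega>. (norm (v \<omega>))\<^sup>2)" using v by (simp add: sq_integrable_def)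
  have "(\<integral>\<^sup>+\<omega>. ennreal ((norm (T (\<zeta> \<omega>) (v \<omega>)))\<^sup>2) \<partial>M)
      = (\<integral>\<^sup>+p. ennreal ((norm (T (snd p) (fst p)))\<^sup>2) \<partial>(distr M borel v \<Otimes>\<^sub>M R))"
    unfolding pair using T' by (subst nn_integral_distr) auto
  also have "\<dots> = (\<integral>\<^sup>+x. \<integral>\<^sup>+s. ennreal ((norm (T s x))\<^sup>2) \<partial>R \<partial>distr M borel v)"
    using T' by (subst R.nn_integral_fst[symmetric]) auto
  also have "\<dots> \<le> (\<integral>\<^sup>+x. ennreal (c * (norm x)\<^sup>2) \<partial>distr M borel v)"
    by (intro nn_integral_mono) (auto simp: nn_integral_eq_integral[OF int] ennreal_leI le)
  also have "\<dots> = (\<integral>\<^sup>+\<omega>. ennreal (c * (norm (v \<omega>))\<^sup>2) \<partial>M)"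
    by (subst nn_integral_distr) auto
  also have "\<dots> = ennreal (c * (\<integral>\<omega>. (norm (v \<omega>))\<^sup>2 \<partial>M))"
    using iv c by (subst nn_integral_eq_integral) auto
  finally have nn: "(\<integral>\<^sup>+\<omega>. ennreal ((norm (T (\<zeta> \<omega>) (v \<omega>)))\<^sup>2) \<partial>M) \<le> ennreal (c * (\<integral>\<omega>. (norm (v \<omega>))\<^sup>2 \<partial>M))" .
  have i: "integrable M (\<lambda>\<omega>. (norm (T (\<zeta> \<omega>) (v \<omega>)))\<^sup>2)"
    using m le_less_trans[OF nn ennreal_less_top] by (intro integrableI_bounded) auto
  with m show "sq_integrable M (\<lambda>\<omega>. T (\<zeta> \<omega>) (v \<omega>))" by (simp add: sq_integrable_def)
  show "(\<integral>\<omega>. (norm (T (\<zeta> \<omega>) (v \<omega>)))\<^sup>2 \<partial>M) \<le> c * (\<integral>\<omega>. (norm (v \<omega>))\<^sup>2 \<partial>M)"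
    using nn c by (subst (asm) nn_integral_eq_integral[OF i]) (auto simp: ennreal_le_iff)
qed

text \<open>The squared norm adds over blocks, so by linearity of the integral each agent's block is
  treated on its own, with that agent's seed.\<close>

lemma (in prob_space) fresh_blockwise_moment:
  fixes T :: "'r \<Rightarrow> 'b::euclidean_space \<Rightarrow> 'c::euclidean_space" and v :: "'a \<Rightarrow> 'b^'n"
  assumes R: "prob_space R" and T: "case_prod T \<in> borel_measurable (R \<Otimes>\<^sub>M borel)"
    and int: "\<And>x. integrable R (\<lambda>s. (norm (T s x))\<^sup>2)"
    and le: "\<And>x. (\<integral>s. (norm (T s x))\<^sup>2 \<partial>R) \<le> c * (norm x)\<^sup>2" and c: "0 \<le> c"
    and fresh: "\<And>i. fresh M R v (\<zeta> i)" and \<zeta>: "\<And>i. distr M R (\<zeta> i) = R"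
    and v: "sq_integrable M v"
  shows "sq_integrable M (\<lambda>\<omega>. \<chi> i. T (\<zeta> i \<omega>) (v \<omega> $ i))"
    and "(\<integral>\<omega>. (norm (\<chi> i. T (\<zeta> i \<omega>) (v \<omega> $ i)))\<^sup>2 \<partial>M) \<le> c * (\<integral>\<omega>. (norm (v \<omega>))\<^sup>2 \<partial>M)"
proof -
  have linear_nth: "linear (\<lambda>z::'b^'n. z $ i)" for i by (rule linearI) auto
  have fr: "fresh M R (\<lambda>\<omega>. v \<omega> $ i) (\<zeta> i)" for i
    by (rule fresh_map[OF fresh \<zeta> borel_measurable_vec_nth])
  have vi: "sq_integrable M (\<lambda>\<omega>. v \<omega> $ i)" for i
    by (rule sq_integrable_linear[OF linear_nth v])
  note Ti = fresh_map_moment[OF R T int le c fr vi]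
  have i: "integrable M (\<lambda>\<omega>. (norm (T (\<zeta> i \<omega>) (v \<omega> $ i)))\<^sup>2)" for i
    using Ti(1) by (simp add: sq_integrable_def)
  show "sq_integrable M (\<lambda>\<omega>. \<chi> i. T (\<zeta> i \<omega>) (v \<omega> $ i))"
    using Ti(1) by (auto simp: sq_integrable_def norm_vec_sq intro!: borel_measurable_vec_lambda)
  have "(\<integral>\<omega>. (norm (\<chi> i. T (\<zeta> i \<omega>) (v \<omega> $ i)))\<^sup>2 \<partial>M)
      = (\<Sum>i\<in>UNIV. \<integral>\<omega>. (norm (T (\<zeta> i \<omega>) (v \<omega> $ i)))\<^sup>2 \<partial>M)"
    using i by (simp add: norm_vec_sq)
  also have "\<dots> \<le> (\<Sum>i\<in>UNIV. c * (\<integral>\<omega>. (norm (v \<omega> $ i))\<^sup>2 \<partial>M))"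
    by (intro sum_mono Ti(2))
  also have "\<dots> = c * (\<integral>\<omega>. (norm (v \<omega>))\<^sup>2 \<partial>M)"
    using vi by (simp add: norm_vec_sq[of "v _"] sum_distrib_left sq_integrable_def)
  finally show "(\<integral>\<omega>. (norm (\<chi> i. T (\<zeta> i \<omega>) (v \<omega> $ i)))\<^sup>2 \<partial>M) \<le> c * (\<integral>\<omega>. (norm (v \<omega>))\<^sup>2 \<partial>M)" .
qed

section \<open>Second moments of the two compression residuals\<close>

lemma compression_error_moment:
  fixes \<C> :: "'r \<Rightarrow> real^'d \<Rightarrow> real^'d"
  assumes C: "compressor R \<C> r \<psi>" and r: "r > 0"
  shows "integrable R (\<lambda>s. (norm (x - \<C> s x))\<^sup>2)"
    and "(\<integral>s. (norm (x - \<C> s x))\<^sup>2 \<partial>R) \<le> (2 * r\<^sup>2 * (1 - \<psi>) + 2 * (1 - r)\<^sup>2) * (norm x)\<^sup>2"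
proof -
  interpret R: prob_space R using C by (simp add: compressor_def)
  define \<delta> where "\<delta> s = (norm (\<C> s x /\<^sub>R r - x))\<^sup>2" for s
  have \<delta>: "integrable R \<delta>" "(\<integral>s. \<delta> s \<partial>R) \<le> (1 - \<psi>) * (norm x)\<^sup>2"
    using C by (auto simp: compressor_def \<delta>_def[abs_def])
  have [measurable]: "case_prod \<C> \<in> borel_measurable (R \<Otimes>\<^sub>M borel)"
    using C by (simp add: compressor_def)
  have m: "(\<lambda>s. \<C> s x) \<in> borel_measurable R" by measurable
  have bound: "(norm (x - \<C> s x))\<^sup>2 \<le> 2 * r\<^sup>2 * \<delta> s + 2 * (1 - r)\<^sup>2 * (norm x)\<^sup>2" for s
  proof -
    \<comment> \<open>The residual is split into the scaled error of \<open>\<C> / r\<close> and the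
      mismatch \<open>1 - r\<close>; the two terms of the constant C come from these two
      parts.\<close>
    have "x - \<C> s x = - (r *\<^sub>R (\<C> s x /\<^sub>R r - x)) + (1 - r) *\<^sub>R x"
      using r by (simp add: algebra_simps)
    also have "(norm \<dots>)\<^sup>2 \<le> 2 * (norm (- (r *\<^sub>R (\<C> s x /\<^sub>R r - x))))\<^sup>2 + 2 * (norm ((1 - r) *\<^sub>R x))\<^sup>2"
      by (rule norm_add_sq_le)
    finally show ?thesis by (simp only: norm_minus_cancel norm_scaleR \<delta>_def) (simp add: power_mult_distrib)
  qed
  have i: "integrable R (\<lambda>s. 2 * r\<^sup>2 * \<delta> s + 2 * (1 - r)\<^sup>2 * (norm x)\<^sup>2)"
    using \<delta> by simp
  show int: "integrable R (\<lambda>s. (norm (x - \<C> s x))\<^sup>2)"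
    by (rule Bochner_Integration.integrable_bound[OF i])
      (use m order_trans[OF bound abs_ge_self] in auto)
  have "(\<integral>s. (norm (x - \<C> s x))\<^sup>2 \<partial>R) \<le> (\<integral>s. 2 * r\<^sup>2 * \<delta> s + 2 * (1 - r)\<^sup>2 * (norm x)\<^sup>2 \<partial>R)"
    by (rule integral_mono[OF int i bound])
  also have "\<dots> = 2 * r\<^sup>2 * (\<integral>s. \<delta> s \<partial>R) + 2 * (1 - r)\<^sup>2 * (norm x)\<^sup>2"
    using \<delta> by (simp add: R.prob_space)
  also have "2 * r\<^sup>2 * (\<integral>s. \<delta> s \<partial>R) \<le> 2 * r\<^sup>2 * ((1 - \<psi>) * (norm x)\<^sup>2)"
    by (intro mult_left_mono \<delta>) simp
  finally show "(\<integral>s. (norm (x - \<C> s x))\<^sup>2 \<partial>R) \<le> (2 * r\<^sup>2 * (1 - \<psi>) + 2 * (1 - r)\<^sup>2) * (norm x)\<^sup>2"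
    by (simp add: algebra_simps)
qed

text \<open>With \<open>t = \<phi> * r\<close> in (0,1), the damped residual is the convex
  combination of \<open>x\<close> and \<open>x - \<C> s x /\<^sub>R r\<close> with weights
  \<open>1 - t\<close> and \<open>t\<close>. Convexity of the squared norm and the compressor bound
  give the factor \<open>1 - t * \<psi>\<close>.\<close>

lemma damped_compression_moment:
  fixes \<C> :: "'r \<Rightarrow> real^'d \<Rightarrow> real^'d"
  assumes C: "compressor R \<C> r \<psi>" and r: "r > 0" and \<phi>: "0 < \<phi>" "\<phi> < 1 / r"
  shows "integrable R (\<lambda>s. (norm (x - \<phi> *\<^sub>R \<C> s x))\<^sup>2)"
    and "(\<integral>s. (norm (x - \<phi> *\<^sub>R \<C> s x))\<^sup>2 \<partial>R) \<le> (1 - \<phi> * \<psi> * r) * (norm x)\<^sup>2"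
proof -
  interpret R: prob_space R using C by (simp add: compressor_def)
  define \<delta> where "\<delta> s = (norm (\<C> s x /\<^sub>R r - x))\<^sup>2" for s
  have \<delta>: "integrable R \<delta>" "(\<integral>s. \<delta> s \<partial>R) \<le> (1 - \<psi>) * (norm x)\<^sup>2"
    using C by (auto simp: compressor_def \<delta>_def[abs_def])
  have [measurable]: "case_prod \<C> \<in> borel_measurable (R \<Otimes>\<^sub>M borel)"
    using C by (simp add: compressor_def)
  have m: "(\<lambda>s. \<C> s x) \<in> borel_measurable R" by measurable
  define t where "t = \<phi> * r"
  have t: "0 < t" "t < 1" using \<phi> r by (simp_all add: t_def field_simps)
  have bound: "(norm (x - \<phi> *\<^sub>R \<C> s x))\<^sup>2 \<le> t * \<delta> s + (1 - t) * (norm x)\<^sup>2" for s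
  proof -
    define u where "u = \<C> s x /\<^sub>R r - x"
    have eq: "x - \<phi> *\<^sub>R \<C> s x = (1 - t) *\<^sub>R x - t *\<^sub>R u"
      using r by (simp add: u_def t_def algebra_simps)
    have "(norm (x - \<phi> *\<^sub>R \<C> s x))\<^sup>2 = t * (norm u)\<^sup>2 + (1 - t) * (norm x)\<^sup>2 - t * (1 - t) * (norm (x + u))\<^sup>2"
      unfolding eq by (simp add: power2_norm_eq_inner inner_diff inner_add inner_commute algebra_simps)
    moreover have "0 \<le> t * (1 - t) * (norm (x + u))\<^sup>2" using t by simp
    ultimately show ?thesis by (simp add: \<delta>_def u_def)
  qed
  have i: "integrable R (\<lambda>s. t * \<delta> s + (1 - t) * (norm x)\<^sup>2)"
    using \<delta> by simp
  show int: "integrable R (\<lambda>s. (norm (x - \<phi> *\<^sub>R \<C> s x))\<^sup>2)"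
    by (rule Bochner_Integration.integrable_bound[OF i])
      (use m order_trans[OF bound abs_ge_self] in auto)
  have "(\<integral>s. (norm (x - \<phi> *\<^sub>R \<C> s x))\<^sup>2 \<partial>R) \<le> (\<integral>s. t * \<delta> s + (1 - t) * (norm x)\<^sup>2 \<partial>R)"
    by (rule integral_mono[OF int i bound])
  also have "\<dots> = t * (\<integral>s. \<delta> s \<partial>R) + (1 - t) * (norm x)\<^sup>2"
    using \<delta> by (simp add: R.prob_space)
  also have "t * (\<integral>s. \<delta> s \<partial>R) \<le> t * ((1 - \<psi>) * (norm x)\<^sup>2)"
    using t by (intro mult_left_mono \<delta>) simp
  finally show "(\<integral>s. (norm (x - \<phi> *\<^sub>R \<C> s x))\<^sup>2 \<partial>R) \<le> (1 - \<phi> * \<psi> * r) * (norm x)\<^sup>2"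
    by (simp add: t_def algebra_simps)
qed

section \<open>Structure of the algorithm\<close>

lemma alg_cong:
  assumes "\<And>ch i t. t \<le> k \<Longrightarrow> cmp ch i t = cmp' ch i t"
  shows "alg F W \<gamma> \<eta> \<phi>\<^sub>X \<phi>\<^sub>Y vs cmp X0 k = alg F W \<gamma> \<eta> \<phi>\<^sub>X \<phi>\<^sub>Y vs cmp' X0 k"
  using assms
proof (induction k)
  case 0
  then show ?case by (simp add: alg_init_def)
next
  case (Suc k)
  then have "alg F W \<gamma> \<eta> \<phi>\<^sub>X \<phi>\<^sub>Y vs cmp X0 k = alg F W \<gamma> \<eta> \<phi>\<^sub>X \<phi>\<^sub>Y vs cmp' X0 k" by simp
  with Suc.prems show ?case by (simp add: alg_step_def Let_def)
qed

text \<open>Nonanticipation: seeds of time \<open>k\<close> enter the state at time \<open>k\<close>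
  only through the Q fields, so these six fields are functions of the strict past. This is what
  makes the compressor inputs independent of the current seeds.\<close>

lemma alg_core_cong:
  fixes F W \<gamma> \<eta> \<phi>\<^sub>X \<phi>\<^sub>Y vs cmp cmp' X0 k
  assumes "\<And>ch i t. t < k \<Longrightarrow> cmp ch i t = cmp' ch i t"
  defines "s \<equiv> alg F W \<gamma> \<eta> \<phi>\<^sub>X \<phi>\<^sub>Y vs cmp X0 k" and "s' \<equiv> alg F W \<gamma> \<eta> \<phi>\<^sub>X \<phi>\<^sub>Y vs cmp' X0 k"
  shows "st_X s = st_X s'" "st_Y s = st_Y s'" "st_A s = st_A s'" "st_C s = st_C s'"
    "st_EX s = st_EX s'" "st_EY s = st_EY s'"
proof -
  have "st_X s = st_X s' \<and> st_Y s = st_Y s' \<and> st_A s = st_A s' \<and> st_C s = st_C s' \<and>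
    st_EX s = st_EX s' \<and> st_EY s = st_EY s'"
  proof (cases k)
    case 0
    then show ?thesis by (simp add: s_def s'_def alg_init_def Let_def)
  next
    case (Suc j)
    have "alg F W \<gamma> \<eta> \<phi>\<^sub>X \<phi>\<^sub>Y vs cmp X0 j = alg F W \<gamma> \<eta> \<phi>\<^sub>X \<phi>\<^sub>Y vs cmp' X0 j"
      by (intro alg_cong assms(1)) (simp add: Suc)
    then show ?thesis by (simp add: s_def s'_def Suc alg_step_def Let_def)
  qed
  then show "st_X s = st_X s'" "st_Y s = st_Y s'" "st_A s = st_A s'" "st_C s = st_C s'"
    "st_EX s = st_EX s'" "st_EY s = st_EY s'" by auto
qed

text \<open>The initial state is folded into the general form: at time 0 the error fields vanish, so
  the argument of Qhat reduces to that of Q, and only the channel has to be switched.\<close>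

lemma alg_Q:
  fixes F W \<gamma> \<eta> \<phi>\<^sub>X \<phi>\<^sub>Y vs cmp X0 k
  defines "s \<equiv> alg F W \<gamma> \<eta> \<phi>\<^sub>X \<phi>\<^sub>Y vs cmp X0 k"
  shows "st_QX s = (\<chi> i. cmp CQX i k ((st_X s - st_A s) $ i))"
    and "st_QY s = (\<chi> i. cmp CQY i k ((st_Y s - st_C s) $ i))"
    and "st_QhatX s = (\<chi> i. cmp (if k = 0 then CQX else CQhatX) i k ((vs *\<^sub>R st_EX s + st_X s - st_A s) $ i))"
    and "st_QhatY s = (\<chi> i. cmp (if k = 0 then CQY else CQhatY) i k ((vs *\<^sub>R st_EY s + st_Y s - st_C s) $ i))"
  unfolding s_def by (cases k; simp add: alg_init_def alg_step_def Let_def)+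

lemma alg_B:
  "st_B (alg F W \<gamma> \<eta> \<phi>\<^sub>X \<phi>\<^sub>Y vs cmp X0 k) = laplacian W (st_A (alg F W \<gamma> \<eta> \<phi>\<^sub>X \<phi>\<^sub>Y vs cmp X0 k))"
  by (induction k) (simp_all add: alg_init_def alg_step_def Let_def linear_0[OF linear_laplacian]
      linear_add[OF linear_laplacian] linear_scale[OF linear_laplacian])

lemma alg_D:
  "st_D (alg F W \<gamma> \<eta> \<phi>\<^sub>X \<phi>\<^sub>Y vs cmp X0 k) = laplacian W (st_C (alg F W \<gamma> \<eta> \<phi>\<^sub>X \<phi>\<^sub>Y vs cmp X0 k))"
  by (induction k) (simp_all add: alg_init_def alg_step_def Let_def linear_0[OF linear_laplacian]
      linear_add[OF linear_laplacian] linear_scale[OF linear_laplacian])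

lemma alg_Suc:
  fixes F W \<gamma> \<eta> \<phi>\<^sub>X \<phi>\<^sub>Y vs cmp X0 k
  defines "s \<equiv> alg F W \<gamma> \<eta> \<phi>\<^sub>X \<phi>\<^sub>Y vs cmp X0 k" and "s' \<equiv> alg F W \<gamma> \<eta> \<phi>\<^sub>X \<phi>\<^sub>Y vs cmp X0 (Suc k)"
  shows "st_X s' = st_X s - \<gamma> *\<^sub>R laplacian W (st_X s + (vs *\<^sub>R st_EX s - st_EX s')) - \<eta> *\<^sub>R st_Y s"
    and "st_Y s' = st_Y s - \<gamma> *\<^sub>R laplacian W (st_Y s + (vs *\<^sub>R st_EY s - st_EY s'))
      + (local_gradients F (st_X s') - local_gradients F (st_X s))"
    and "st_X s' - st_A s' = (st_X s - st_A s - \<phi>\<^sub>X *\<^sub>R st_QX s) + (st_X s' - st_X s)"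
    and "st_Y s' - st_C s' = (st_Y s - st_C s - \<phi>\<^sub>Y *\<^sub>R st_QY s) + (st_Y s' - st_Y s)"
    and "st_EX s' = vs *\<^sub>R st_EX s + st_X s - st_A s - st_QhatX s"
    and "st_EY s' = vs *\<^sub>R st_EY s + st_Y s - st_C s - st_QhatY s"
proof -
  have s': "s' = alg_step F W \<gamma> \<eta> \<phi>\<^sub>X \<phi>\<^sub>Y vs cmp k s" by (simp add: s_def s'_def)
  have B: "st_B s = laplacian W (st_A s)" and D: "st_D s = laplacian W (st_C s)"
    by (simp_all add: s_def alg_B alg_D)
  show EX: "st_EX s' = vs *\<^sub>R st_EX s + st_X s - st_A s - st_QhatX s"
    and EY: "st_EY s' = vs *\<^sub>R st_EY s + st_Y s - st_C s - st_QhatY s"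
    by (simp_all add: s' alg_step_def Let_def)
  show "st_X s' - st_A s' = (st_X s - st_A s - \<phi>\<^sub>X *\<^sub>R st_QX s) + (st_X s' - st_X s)"
    and "st_Y s' - st_C s' = (st_Y s - st_C s - \<phi>\<^sub>Y *\<^sub>R st_QY s) + (st_Y s' - st_Y s)"
    by (simp_all add: s' alg_step_def Let_def)
  \<comment> \<open>The error recursion identifies the mixed quantity, stored reference plus
    compressed correction, as the exact iterate plus a difference of accumulated errors.\<close>
  have hX: "st_X s + (vs *\<^sub>R st_EX s - st_EX s') = st_A s + st_QhatX s"
    and hY: "st_Y s + (vs *\<^sub>R st_EY s - st_EY s') = st_C s + st_QhatY s"
    by (simp_all add: EX EY)
  show "st_X s' = st_X s - \<gamma> *\<^sub>R laplacian W (st_X s + (vs *\<^sub>R st_EX s - st_EX s')) - \<eta> *\<^sub>R st_Y s"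
    unfolding hX by (simp add: s' alg_step_def Let_def linear_add[OF linear_laplacian] B)
  show "st_Y s' = st_Y s - \<gamma> *\<^sub>R laplacian W (st_Y s + (vs *\<^sub>R st_EY s - st_EY s'))
      + (local_gradients F (st_X s') - local_gradients F (st_X s))"
    unfolding hY by (simp add: s' alg_step_def Let_def linear_add[OF linear_laplacian] D)
qed

lemma mean_laplacian: "1 v* W = 1 \<Longrightarrow> mean (laplacian W Z) = 0"
  using replicated_mean_laplacian[of W Z] by (simp add: mean_eq_0_iff)

text \<open>Unit column sums make mixing invisible to the mean, and the gradient increments
  telescope from the initialization with local gradients. The identity holds surely, whatever the
  compressor returns.\<close>

lemma gradient_tracking:
  assumes "1 v* W = 1"
  shows "mean (st_Y (alg F W \<gamma> \<eta> \<phi>\<^sub>X \<phi>\<^sub>Y vs cmp X0 k))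
    = mean (local_gradients F (st_X (alg F W \<gamma> \<eta> \<phi>\<^sub>X \<phi>\<^sub>Y vs cmp X0 k)))"
proof (induction k)
  case 0
  then show ?case by (simp add: alg_init_def Let_def)
next
  case (Suc k)
  then show ?case
    unfolding alg_Suc(2)[of F W \<gamma> \<eta> \<phi>\<^sub>X \<phi>\<^sub>Y vs cmp X0 k]
    by (simp add: linear_add[OF linear_mean] linear_diff[OF linear_mean] linear_scale[OF linear_mean]
        mean_laplacian[OF assms] del: alg.simps)
qed

section \<open>Measurability of the run and its independence from the current seeds\<close>

lemma borel_measurable_linear:
  fixes f :: "'b::euclidean_space \<Rightarrow> 'c::euclidean_space"
  assumes "linear f"
  shows "f \<in> borel_measurable borel"
  using assms by (intro borel_measurable_continuous_onI linear_continuous_on)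
    (simp add: linear_conv_bounded_linear)

lemma borel_measurable_local_gradients:
  fixes F :: "'n::finite \<Rightarrow> real^'d \<Rightarrow> real"
  assumes "L \<ge> 0" "\<And>i x y. norm (gradient (F i) x - gradient (F i) y) \<le> L * norm (x - y)"
  shows "local_gradients F \<in> borel_measurable borel"
proof (rule borel_measurable_continuous_onI)
  have "L-lipschitz_on UNIV (local_gradients F)"
    using norm_local_gradients_diff_le[of L F] assms by (auto intro!: lipschitz_onI simp: dist_norm)
  then show "continuous_on UNIV (local_gradients F)"
    by (rule lipschitz_on_continuous_on)
qed

text \<open>The base space is arbitrary so that the result applies to the product space of the seeds
  before time \<open>k\<close>, with the coordinates as \<open>z\<close>; hence only times
  \<open>t < k\<close> occur in the hypothesis.\<close>

lemma alg_measurable: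
  fixes F :: "'n::finite \<Rightarrow> real^'d \<Rightarrow> real" and W \<gamma> \<eta> \<phi>\<^sub>X \<phi>\<^sub>Y vs X0
  assumes \<C>: "case_prod \<C> \<in> borel_measurable (R \<Otimes>\<^sub>M borel)"
    and F: "local_gradients F \<in> borel_measurable borel"
    and z: "\<And>ch i t. t < k \<Longrightarrow> z (ch, i, t) \<in> N \<rightarrow>\<^sub>M R"
  defines "S \<equiv> \<lambda>k w. alg F W \<gamma> \<eta> \<phi>\<^sub>X \<phi>\<^sub>Y vs (\<lambda>ch i t. \<C> (z (ch, i, t) w)) X0 k"
  shows "(\<lambda>w. st_X (S k w)) \<in> borel_measurable N" "(\<lambda>w. st_Y (S k w)) \<in> borel_measurable N"
    "(\<lambda>w. st_A (S k w)) \<in> borel_measurable N" "(\<lambda>w. st_C (S k w)) \<in> borel_measurable N"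
    "(\<lambda>w. st_EX (S k w)) \<in> borel_measurable N" "(\<lambda>w. st_EY (S k w)) \<in> borel_measurable N"
proof -
  have \<C>': "(\<lambda>w. \<chi> i. \<C> (\<zeta> i w) (u w $ i)) \<in> borel_measurable N"
    if "\<And>i. \<zeta> i \<in> N \<rightarrow>\<^sub>M R" "u \<in> borel_measurable N" for \<zeta> and u :: "_ \<Rightarrow> real^'d^'n"
  proof (rule borel_measurable_vec_lambda)
    fix i
    have "(\<lambda>w. (\<zeta> i w, u w $ i)) \<in> N \<rightarrow>\<^sub>M R \<Otimes>\<^sub>M borel"
      by (intro measurable_Pair that measurable_compose[OF that(2) borel_measurable_vec_nth])
    from measurable_compose[OF this \<C>] show "(\<lambda>w. \<C> (\<zeta> i w) (u w $ i)) \<in> borel_measurable N"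
      by simp
  qed
  have L: "(\<lambda>w. laplacian W (u w)) \<in> borel_measurable N" if "u \<in> borel_measurable N"
    for u :: "_ \<Rightarrow> real^'d^'n"
    by (rule measurable_compose[OF that borel_measurable_linear[OF linear_laplacian]])
  have G: "(\<lambda>w. local_gradients F (u w)) \<in> borel_measurable N" if "u \<in> borel_measurable N" for u
    by (rule measurable_compose[OF that F])
  let ?B = "borel_measurable N"
  have "(\<lambda>w. st_X (S k w)) \<in> ?B \<and> (\<lambda>w. st_Y (S k w)) \<in> ?B \<and> (\<lambda>w. st_A (S k w)) \<in> ?B \<and>
    (\<lambda>w. st_C (S k w)) \<in> ?B \<and> (\<lambda>w. st_EX (S k w)) \<in> ?B \<and> (\<lambda>w. st_EY (S k w)) \<in> ?B"
    using z
  proof (induction k)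
    case 0
    then show ?case by (simp add: S_def alg_init_def Let_def)
  next
    case (Suc k)
    then have [measurable]: "(\<lambda>w. st_X (S k w)) \<in> ?B" "(\<lambda>w. st_Y (S k w)) \<in> ?B"
      "(\<lambda>w. st_A (S k w)) \<in> ?B" "(\<lambda>w. st_C (S k w)) \<in> ?B"
      "(\<lambda>w. st_EX (S k w)) \<in> ?B" "(\<lambda>w. st_EY (S k w)) \<in> ?B"
      by auto
    have z: "z (ch, i, k) \<in> N \<rightarrow>\<^sub>M R" for ch i using Suc.prems by simp
    have Q: "st_QX (S k w) = (\<chi> i. \<C> (z (CQX, i, k) w) ((st_X (S k w) - st_A (S k w)) $ i))"
      "st_QY (S k w) = (\<chi> i. \<C> (z (CQY, i, k) w) ((st_Y (S k w) - st_C (S k w)) $ i))"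
      "st_QhatX (S k w) = (\<chi> i. \<C> (z (if k = 0 then CQX else CQhatX, i, k) w)
        ((vs *\<^sub>R st_EX (S k w) + st_X (S k w) - st_A (S k w)) $ i))"
      "st_QhatY (S k w) = (\<chi> i. \<C> (z (if k = 0 then CQY else CQhatY, i, k) w)
        ((vs *\<^sub>R st_EY (S k w) + st_Y (S k w) - st_C (S k w)) $ i))" for w
      unfolding S_def by (rule alg_Q)+
    have [measurable]: "(\<lambda>w. st_QX (S k w)) \<in> ?B" "(\<lambda>w. st_QY (S k w)) \<in> ?B"
      "(\<lambda>w. st_QhatX (S k w)) \<in> ?B" "(\<lambda>w. st_QhatY (S k w)) \<in> ?B"
      unfolding Q by (rule \<C>'[OF z]; measurable)+
    have BD: "st_B (S k w) = laplacian W (st_A (S k w))" "st_D (S k w) = laplacian W (st_C (S k w))" for w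
      unfolding S_def by (rule alg_B alg_D)+
    have [measurable]: "(\<lambda>w. st_B (S k w)) \<in> ?B" "(\<lambda>w. st_D (S k w)) \<in> ?B"
      unfolding BD by (rule L; measurable)+
    have S: "S (Suc k) w = alg_step F W \<gamma> \<eta> \<phi>\<^sub>X \<phi>\<^sub>Y vs (\<lambda>ch i t. \<C> (z (ch, i, t) w)) k (S k w)" for w
      by (simp add: S_def)
    note [measurable (raw)] = L G
    have [measurable]: "(\<lambda>w. st_X (S (Suc k) w)) \<in> ?B" "(\<lambda>w. st_A (S (Suc k) w)) \<in> ?B"
       "(\<lambda>w. st_C (S (Suc k) w)) \<in> ?B" "(\<lambda>w. st_EX (S (Suc k) w)) \<in> ?B" "(\<lambda>w. st_EY (S (Suc k) w)) \<in> ?B"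
      by (simp_all add: S alg_step_def Let_def)
    \<comment> \<open>\<open>st_Y\<close> comes last because it contains the gradients at the new
      \<open>st_X\<close>.\<close>
    have "st_Y (S (Suc k) w) = st_Y (S k w) - \<gamma> *\<^sub>R (st_D (S k w) + laplacian W (st_QhatY (S k w)))
                + local_gradients F (st_X (S (Suc k) w)) - local_gradients F (st_X (S k w))" for w
      by (simp add: S alg_step_def Let_def)
    then have "(\<lambda>w. st_Y (S (Suc k) w)) \<in> ?B" by simp
    then show ?case by simp
  qed
  then show "(\<lambda>w. st_X (S k w)) \<in> borel_measurable N" "(\<lambda>w. st_Y (S k w)) \<in> borel_measurable N"
    "(\<lambda>w. st_A (S k w)) \<in> borel_measurable N" "(\<lambda>w. st_C (S k w)) \<in> borel_measurable N"
    "(\<lambda>w. st_EX (S k w)) \<in> borel_measurable N" "(\<lambda>w. st_EY (S k w)) \<in> borel_measurable N"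
    by auto
qed

text \<open>The seeds before time \<open>k\<close> and one seed of time \<open>k\<close> have
  disjoint index sets, so their restrictions are independent; \<open>H\<close> of the state is a
  function of the former.\<close>

lemma (in prob_space) fresh_alg:
  fixes F :: "'n::finite \<Rightarrow> real^'d \<Rightarrow> real" and \<xi> :: "channel \<times> 'n \<times> nat \<Rightarrow> 'a \<Rightarrow> 'r"
    and H :: "('d, 'n) alg_state \<Rightarrow> 'b::topological_space"
  assumes \<xi>: "indep_vars (\<lambda>_. R) \<xi> UNIV" "\<And>a. distr M R (\<xi> a) = R"
    and meas: "(\<lambda>w. H (alg F W \<gamma> \<eta> \<phi>\<^sub>X \<phi>\<^sub>Y vs (\<lambda>ch i t. \<C> (w (ch, i, t))) X0 k))
      \<in> borel_measurable (\<Pi>\<^sub>M a\<in>{a. snd (snd a) < k}. R)"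
    and cong: "\<And>cmp cmp'. (\<And>ch i t. t < k \<Longrightarrow> cmp ch i t = cmp' ch i t) \<Longrightarrow>
      H (alg F W \<gamma> \<eta> \<phi>\<^sub>X \<phi>\<^sub>Y vs cmp X0 k) = H (alg F W \<gamma> \<eta> \<phi>\<^sub>X \<phi>\<^sub>Y vs cmp' X0 k)"
  shows "fresh M R (\<lambda>\<omega>. H (alg F W \<gamma> \<eta> \<phi>\<^sub>X \<phi>\<^sub>Y vs (\<lambda>ch i t. \<C> (\<xi> (ch, i, t) \<omega>)) X0 k)) (\<xi> (ch, i, k))"
proof -
  let ?I = "{a :: channel \<times> 'n \<times> nat. snd (snd a) < k}" and ?a = "(ch, i, k)"
  let ?S = "\<lambda>\<omega>. restrict (\<lambda>a. \<xi> a \<omega>) ?I" and ?T = "\<lambda>\<omega>. restrict (\<lambda>a. \<xi> a \<omega>) {?a}"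
  have "indep_var (PiM ?I (\<lambda>_. R)) ?S (PiM {?a} (\<lambda>_. R)) ?T"
    by (rule indep_var_restrict[OF \<xi>(1)]) auto
  then have ST: "?S \<in> M \<rightarrow>\<^sub>M PiM ?I (\<lambda>_. R)" "?T \<in> M \<rightarrow>\<^sub>M PiM {?a} (\<lambda>_. R)"
    "distr M (PiM ?I (\<lambda>_. R)) ?S \<Otimes>\<^sub>M distr M (PiM {?a} (\<lambda>_. R)) ?T
      = distr M (PiM ?I (\<lambda>_. R) \<Otimes>\<^sub>M PiM {?a} (\<lambda>_. R)) (\<lambda>\<omega>. (?S \<omega>, ?T \<omega>))"
    by (simp_all only: indep_var_distribution_eq)
  have "fresh M R (\<lambda>\<omega>. H (alg F W \<gamma> \<eta> \<phi>\<^sub>X \<phi>\<^sub>Y vs (\<lambda>ch i t. \<C> (?S \<omega> (ch, i, t))) X0 k)) (\<lambda>\<omega>. ?T \<omega> ?a)"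
    by (rule fresh_compose[OF ST meas, where h = "\<lambda>w. w ?a"]) (use \<xi>(2) in simp_all)
  \<comment> \<open>Outside its index set \<open>?S\<close> takes the value
    \<open>undefined\<close>; \<open>cong\<close> applies because \<open>H\<close> reads only
    earlier seeds, on which \<open>?S\<close> agrees with \<open>\<xi>\<close>.\<close>
  moreover have "H (alg F W \<gamma> \<eta> \<phi>\<^sub>X \<phi>\<^sub>Y vs (\<lambda>ch i t. \<C> (?S \<omega> (ch, i, t))) X0 k)
      = H (alg F W \<gamma> \<eta> \<phi>\<^sub>X \<phi>\<^sub>Y vs (\<lambda>ch i t. \<C> (\<xi> (ch, i, t) \<omega>)) X0 k)" for \<omega>
    by (rule cong) simp
  ultimately show ?thesis by simp
qed

section \<open>Contraction of the Lyapunov function\<close>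

text \<open>Linear bookkeeping: the inequalities are added with their weights, then
  \<open>\<Delta>\<close>, \<open>hx\<close> and \<open>hy\<close> are replaced by their own bounds.
  \<open>K\<close> and \<open>H\<close> are the collected coefficients of \<open>\<Delta>\<close>
  and \<open>hy\<close>, and \<open>u + K * m\<close> that of \<open>hx\<close>. Each remaining
  coefficient is compared with \<open>T\<close> times its weight, while \<open>z\<close> and
  \<open>g\<close> end with nonpositive coefficients.\<close>

lemma weighted_sum_contraction:
  fixes x y a b e f F x1 y1 a1 b1 e1 f1 F1 z g \<Delta> hx hy :: real
  assumes step: "x1 \<le> \<alpha> * x + u * hx + v * y"
      "y1 \<le> \<alpha> * y - d * z + u * hy + w * \<Delta>"
      "\<Delta> \<le> m * x + m * hx + l * y + l * g"
      "a1 \<le> k\<^sub>a * a + p * \<Delta>"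
      "b1 \<le> k\<^sub>b * b + q * (m2 * z + m3 * hy + m4 * \<Delta>)"
      "hx \<le> 2 * e + 4 * C * a" "hy \<le> 2 * f + 4 * C * b"
      "e1 \<le> e / 2 + 2 * C * a" "f1 \<le> f / 2 + 2 * C * b"
      "F1 \<le> k\<^sub>F * F - n * g + j * x"
    and nonneg: "0 \<le> x" "0 \<le> y" "0 \<le> a" "0 \<le> b" "0 \<le> e" "0 \<le> f" "0 \<le> F" "0 \<le> z" "0 \<le> g"
    and weights: "0 \<le> \<phi>" "0 \<le> \<beta>" "0 \<le> \<rho>" "0 \<le> \<tau>"
  defines "K \<equiv> \<phi> * w + p + \<beta> * q * m4" and "H \<equiv> \<phi> * u + \<beta> * q * m3"
  assumes K: "0 \<le> K" "0 \<le> u + K * m" "0 \<le> H"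
    and coeffs: "\<alpha> + K * m + j \<le> T" "\<phi> * \<alpha> + v + K * l \<le> T * \<phi>"
      "k\<^sub>a + 4 * C * (u + K * m) + 2 * C * \<rho> \<le> T"
      "\<beta> * k\<^sub>b + 4 * C * H + 2 * C * \<tau> \<le> T * \<beta>"
      "2 * (u + K * m) + \<rho> / 2 \<le> T * \<rho>" "2 * H + \<tau> / 2 \<le> T * \<tau>"
      "\<beta> * q * m2 \<le> \<phi> * d" "K * l \<le> n" "k\<^sub>F \<le> T"
  shows "x1 + \<phi> * y1 + a1 + \<beta> * b1 + \<rho> * e1 + \<tau> * f1 + F1
    \<le> T * (x + \<phi> * y + a + \<beta> * b + \<rho> * e + \<tau> * f + F)"
proof -
  have "x1 + \<phi> * y1 + a1 + \<beta> * b1 + \<rho> * e1 + \<tau> * f1 + F1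
      \<le> (\<alpha> * x + u * hx + v * y) + \<phi> * (\<alpha> * y - d * z + u * hy + w * \<Delta>) + (k\<^sub>a * a + p * \<Delta>)
        + \<beta> * (k\<^sub>b * b + q * (m2 * z + m3 * hy + m4 * \<Delta>)) + \<rho> * (e / 2 + 2 * C * a) + \<tau> * (f / 2 + 2 * C * b)
        + (k\<^sub>F * F - n * g + j * x)"
    by (intro add_mono step mult_left_mono[OF _ weights(1)] mult_left_mono[OF _ weights(2)]
        mult_left_mono[OF _ weights(3)] mult_left_mono[OF _ weights(4)])
  also have "\<dots> = (\<alpha> + j) * x + u * hx + (\<phi> * \<alpha> + v) * y + (\<beta> * q * m2 - \<phi> * d) * z + H * hy + K * \<Delta>
      + (k\<^sub>a + 2 * C * \<rho>) * a + (\<beta> * k\<^sub>b + 2 * C * \<tau>) * b + \<rho> / 2 * e + \<tau> / 2 * f + k\<^sub>F * F - n * g"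
    unfolding K_def H_def by (simp add: algebra_simps)
  also have "\<dots> \<le> (\<alpha> + j) * x + u * hx + (\<phi> * \<alpha> + v) * y + (\<beta> * q * m2 - \<phi> * d) * z + H * hy
      + K * (m * x + m * hx + l * y + l * g)
      + (k\<^sub>a + 2 * C * \<rho>) * a + (\<beta> * k\<^sub>b + 2 * C * \<tau>) * b + \<rho> / 2 * e + \<tau> / 2 * f + k\<^sub>F * F - n * g"
    using mult_left_mono[OF step(3) K(1)] by linarith
  also have "\<dots> = (\<alpha> + K * m + j) * x + (u + K * m) * hx + (\<phi> * \<alpha> + v + K * l) * y
      + (\<beta> * q * m2 - \<phi> * d) * z + H * hy + (K * l - n) * g
      + (k\<^sub>a + 2 * C * \<rho>) * a + (\<beta> * k\<^sub>b + 2 * C * \<tau>) * b + \<rho> / 2 * e + \<tau> / 2 * f + k\<^sub>F * F"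
    by (simp add: algebra_simps)
  also have "\<dots> \<le> (\<alpha> + K * m + j) * x + (u + K * m) * (2 * e + 4 * C * a) + (\<phi> * \<alpha> + v + K * l) * y
      + 0 + H * (2 * f + 4 * C * b) + 0
      + (k\<^sub>a + 2 * C * \<rho>) * a + (\<beta> * k\<^sub>b + 2 * C * \<tau>) * b + \<rho> / 2 * e + \<tau> / 2 * f + k\<^sub>F * F"
  proof -
    have "(\<beta> * q * m2 - \<phi> * d) * z \<le> 0" "(K * l - n) * g \<le> 0"
      using coeffs(7,8) nonneg(8,9) by (simp_all add: mult_nonpos_nonneg)
    then show ?thesis
      using mult_left_mono[OF step(6) K(2)] mult_left_mono[OF step(7) K(3)]
      by (intro add_mono order_refl)
  qed
  also have "\<dots> = (\<alpha> + K * m + j) * x + (\<phi> * \<alpha> + v + K * l) * y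
      + (k\<^sub>a + 4 * C * (u + K * m) + 2 * C * \<rho>) * a + (\<beta> * k\<^sub>b + 4 * C * H + 2 * C * \<tau>) * b
      + (2 * (u + K * m) + \<rho> / 2) * e + (2 * H + \<tau> / 2) * f + k\<^sub>F * F"
    by (simp add: algebra_simps)
  also have "\<dots> \<le> T * x + (T * \<phi>) * y + T * a + (T * \<beta>) * b + (T * \<rho>) * e + (T * \<tau>) * f + T * F"
    by (intro add_mono mult_right_mono coeffs nonneg)
  finally show ?thesis by (simp add: algebra_simps)
qed

text \<open>\<open>\<rho>\<close> and \<open>\<tau>\<close> are multiples of \<open>\<gamma>\<close>, whereas \<open>\<phi>hat\<close> is a multiple of \<open>1 / C\<close>; so \<open>C = 0\<close> is not a
  special case.\<close>

lemma lyapunov_contraction: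
  fixes x y a b e f F x1 y1 a1 b1 e1 f1 F1 z g \<Delta> hx hy :: real
  assumes pos: "0 < s" "s < 1" "0 < L" "0 < p" "0 < q" "0 < \<gamma>" "0 < \<eta>" "0 \<le> C" "0 < \<kappa>\<^sub>1" "0 < \<kappa>\<^sub>2"
    and \<gamma>: "160 * p * \<gamma> \<le> s" "40000 * q * \<gamma> * L\<^sup>2 \<le> s" "4 * C * \<gamma> \<le> \<kappa>\<^sub>2 * L\<^sup>2"
      "640 * C * \<gamma> \<le> s * \<kappa>\<^sub>1" "640 * C * \<gamma> \<le> s * \<kappa>\<^sub>2" "5 * q * \<gamma> \<le> 1"
    and \<eta>: "40 * L * \<eta> \<le> s\<^sup>2 * \<gamma>" "L\<^sup>2 * \<eta> \<le> 2 / 5 * s * \<gamma>" "6400 * L\<^sup>2 * p * \<eta>\<^sup>2 \<le> s ^ 4 * \<gamma>" "\<eta> \<le> \<gamma>"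
    and \<theta>: "\<theta> \<le> 7 / 100 * s * \<gamma>" "\<theta> \<le> 24 / 100 * \<kappa>\<^sub>1" "\<theta> \<le> 57 / 100 * \<kappa>\<^sub>2" "\<theta> \<le> 1 / 4" "\<theta> \<le> \<eta> * \<nu>"
  defines "\<phi> \<equiv> s\<^sup>2 / (320 * L\<^sup>2)" and "\<rho> \<equiv> 80 * \<gamma> / s"
    and "\<tau> \<equiv> 8 * (s\<^sup>2 / (320 * L\<^sup>2) * (8 * \<gamma> / s) + s * q * (16 * \<gamma>\<^sup>2))"
  assumes step: "x1 \<le> (1 - 23 / 25 * \<gamma> * s) * x + 8 * \<gamma> / s * hx + 2 / (\<gamma> * s) * \<eta>\<^sup>2 * y"
      "y1 \<le> (1 - 23 / 25 * \<gamma> * s) * y - 2 / 25 * \<gamma> * z + 8 * \<gamma> / s * hy + 2 / (\<gamma> * s) * L\<^sup>2 * \<Delta>"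
      "\<Delta> \<le> 16 * \<gamma>\<^sup>2 * x + 16 * \<gamma>\<^sup>2 * hx + 4 * \<eta>\<^sup>2 * y + 4 * \<eta>\<^sup>2 * g"
      "a1 \<le> (1 - \<kappa>\<^sub>1) * a + p * \<Delta>"
      "b1 \<le> (1 - \<kappa>\<^sub>2) * b + q * (2 * \<gamma>\<^sup>2 * z + 16 * \<gamma>\<^sup>2 * hy + 4 * L\<^sup>2 * \<Delta>)"
      "hx \<le> 2 * e + 4 * C * a" "hy \<le> 2 * f + 4 * C * b"
      "e1 \<le> e / 2 + 2 * C * a" "f1 \<le> f / 2 + 2 * C * b"
      "F1 \<le> (1 - \<eta> * \<nu>) * F - \<eta> / 4 * g + \<eta> * L\<^sup>2 / 2 * x"
    and nonneg: "0 \<le> x" "0 \<le> y" "0 \<le> a" "0 \<le> b" "0 \<le> e" "0 \<le> f" "0 \<le> F" "0 \<le> z" "0 \<le> g"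
  shows "x1 + \<phi> * y1 + a1 + s * b1 + \<rho> * e1 + \<tau> * f1 + F1
    \<le> (1 - \<theta>) * (x + \<phi> * y + a + s * b + \<rho> * e + \<tau> * f + F)"
proof -
  define K where "K = \<phi> * (2 / (\<gamma> * s) * L\<^sup>2) + p + s * q * (4 * L\<^sup>2)"
  define H where "H = \<phi> * (8 * \<gamma> / s) + s * q * (16 * \<gamma>\<^sup>2)"
  have \<phi>: "0 < \<phi>" using pos by (simp add: \<phi>_def)
  have H: "0 \<le> H" and K0: "0 \<le> K" using pos \<phi> by (simp_all add: H_def K_def)
  have \<tau>: "\<tau> = 8 * H" by (simp add: \<tau>_def H_def \<phi>_def)
  \<comment> \<open>126/10000 is 1/160 + 1/160 + 1/10000, one summand for each of the three routes
    by which the increment of X enters.\<close>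
  have K\<gamma>: "K * \<gamma> \<le> 126 / 10000 * s"
  proof -
    have "K * \<gamma> = s / 160 + p * \<gamma> + s * (40000 * q * \<gamma> * L\<^sup>2) / 10000"
      using pos by (simp add: K_def \<phi>_def field_simps power2_eq_square)
    also have "s * (40000 * q * \<gamma> * L\<^sup>2) \<le> 1 * s" using pos \<gamma>(2) by (intro mult_mono) auto
    finally show ?thesis using \<gamma>(1) by simp
  qed
  have K\<gamma>2: "K * (16 * \<gamma>\<^sup>2) \<le> 1 / 4 * s * \<gamma>"
    using mult_right_mono[OF K\<gamma>, of "16 * \<gamma>"] pos by (simp add: power2_eq_square algebra_simps)
  have s2: "s * \<gamma> \<le> \<gamma> / s" using pos mult_mono[of s 1 s 1] by (simp add: field_simps)
  \<comment> \<open>33/4 is 8 + 1/4.\<close>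
  have hx: "8 * \<gamma> / s + K * (16 * \<gamma>\<^sup>2) \<le> 33 / 4 * (\<gamma> / s)"
    using K\<gamma>2 s2 by (simp add: field_simps)
  have C1: "C * (\<gamma> / s) \<le> \<kappa>\<^sub>1 / 640" using \<gamma>(4) pos by (simp add: field_simps)
  \<comment> \<open>9/800 is 1/160 + 1/200, from the consensus part and the tracking part of
    \<open>H\<close>.\<close>
  have CH: "C * H \<le> 9 / 800 * (s * \<kappa>\<^sub>2)"
  proof -
    have "C * H = s * (4 * C * \<gamma>) / (160 * L\<^sup>2) + s * (5 * q * \<gamma>) * (640 * C * \<gamma>) / 200"
      using pos by (simp add: H_def \<phi>_def field_simps power2_eq_square)
    also have "s * (4 * C * \<gamma>) / (160 * L\<^sup>2) \<le> s * (\<kappa>\<^sub>2 * L\<^sup>2) / (160 * L\<^sup>2)"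
      using pos \<gamma>(3) by (intro divide_right_mono mult_left_mono) auto
    also have "s * (5 * q * \<gamma>) * (640 * C * \<gamma>) / 200 \<le> s * 1 * \<kappa>\<^sub>2 / 200"
    proof -
      have "s * \<kappa>\<^sub>2 \<le> 1 * \<kappa>\<^sub>2" using pos by (intro mult_right_mono) auto
      with \<gamma>(5) have "640 * C * \<gamma> \<le> \<kappa>\<^sub>2" by linarith
      moreover have "s * (5 * q * \<gamma>) \<le> s * 1" using pos \<gamma>(6) by (intro mult_left_mono) auto
      ultimately show ?thesis
        using pos by (intro divide_right_mono mult_mono[of "s * (5 * q * \<gamma>)" "s * 1" "640 * C * \<gamma>" \<kappa>\<^sub>2]) auto
    qed
    finally show ?thesis using pos by (simp add: mult.commute)
  qed
  have \<eta>2: "\<eta>\<^sup>2 \<le> s ^ 4 * \<gamma>\<^sup>2 / (1600 * L\<^sup>2)"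
  proof -
    have "(40 * L * \<eta>)\<^sup>2 \<le> (s\<^sup>2 * \<gamma>)\<^sup>2" using \<eta>(1) pos by (intro power_mono) auto
    then show ?thesis using pos by (simp add: field_simps power_mult_distrib flip: power_mult)
  qed
  \<comment> \<open>\<open>B\<close> is one fifth of \<open>\<phi> * (\<gamma> * s)\<close>. The
    decay 92/100 less the rate 7/100 leaves 85/100 of that quantity, which is 17/4 of
    \<open>B\<close>, for the terms in \<open>y\<close>; \<open>yK\<close> shows that they take at
    most 4 of \<open>B\<close>.\<close>
  define B where "B = s ^ 3 * \<gamma> / (1600 * L\<^sup>2)"
  have B: "0 < B" using pos by (simp add: B_def)
  have B1: "\<eta>\<^sup>2 / \<gamma> \<le> s * B"
    using divide_right_mono[OF \<eta>2, of \<gamma>] pos by (simp add: B_def field_simps power2_eq_square eval_nat_numeral)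
  have sB: "s * B \<le> B" using pos B mult_right_mono[of s 1 B] by simp
  have B2: "\<eta>\<^sup>2 / \<gamma> \<le> 1 * B" using order_trans[OF B1 sB] by simp
  have yK: "2 / (\<gamma> * s) * \<eta>\<^sup>2 + K * (4 * \<eta>\<^sup>2) \<le> 4 * B"
  proof -
    have "2 / (\<gamma> * s) * \<eta>\<^sup>2 = 2 / s * (\<eta>\<^sup>2 / \<gamma>)" by simp
    also have "\<dots> \<le> 2 / s * (s * B)" using B1 pos by (intro mult_left_mono) auto
    finally have 1: "2 / (\<gamma> * s) * \<eta>\<^sup>2 \<le> 2 * B" using pos by simp
    have "K * (4 * \<eta>\<^sup>2) = s / 40 * (\<eta>\<^sup>2 / \<gamma>) + 4 * p * \<eta>\<^sup>2 + 16 * s * (q * \<gamma> * L\<^sup>2) * (\<eta>\<^sup>2 / \<gamma>)"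
      using pos by (simp add: K_def \<phi>_def field_simps power2_eq_square)
    moreover have "4 * p * \<eta>\<^sup>2 \<le> s * B"
      using \<eta>(3) pos by (simp add: B_def field_simps eval_nat_numeral)
    moreover have "s / 40 * (\<eta>\<^sup>2 / \<gamma>) \<le> 1 / 40 * (1 * B)"
      using B2 pos by (intro mult_mono) auto
    moreover have "16 * s * (q * \<gamma> * L\<^sup>2) * (\<eta>\<^sup>2 / \<gamma>) \<le> 16 * 1 * (1 / 40000) * (1 * B)"
      using B2 pos \<gamma>(2) by (intro mult_mono) auto
    ultimately show ?thesis using 1 B sB by linarith
  qed
  have \<phi>B: "\<phi> * (\<gamma> * s) = 5 * B"
    by (simp add: \<phi>_def B_def field_simps eval_nat_numeral)
  show ?thesis
  proof (rule weighted_sum_contraction[OF step nonneg, where \<phi> = \<phi> and \<beta> = s and \<rho> = \<rho> and \<tau> = \<tau>,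
        folded K_def H_def])
    show "0 \<le> \<phi>" "0 \<le> s" "0 \<le> \<rho>" "0 \<le> \<tau>" "0 \<le> K" "0 \<le> H" "0 \<le> 8 * \<gamma> / s + K * (16 * \<gamma>\<^sup>2)"
      using pos \<phi> K0 H by (simp_all add: \<rho>_def \<tau>)
    show "1 - 23 / 25 * \<gamma> * s + K * (16 * \<gamma>\<^sup>2) + \<eta> * L\<^sup>2 / 2 \<le> 1 - \<theta>"
    proof -
      have "K * (16 * \<gamma>\<^sup>2) \<le> 1 / 4 * (\<gamma> * s)" "L\<^sup>2 * \<eta> \<le> 2 / 5 * (\<gamma> * s)" "\<theta> \<le> 7 / 100 * (\<gamma> * s)"
        using K\<gamma>2 \<eta>(2) \<theta>(1) by (simp_all add: mult_ac)
      then show ?thesis using mult_pos_pos[OF pos(6) pos(1)] by (simp add: mult.commute[of \<eta> "L\<^sup>2"])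
    qed
    have "2 / (\<gamma> * s) * \<eta>\<^sup>2 + K * (4 * \<eta>\<^sup>2) \<le> 85 / 100 * (\<phi> * (\<gamma> * s))"
      using yK B by (simp add: \<phi>B)
    moreover have "\<phi> * \<theta> \<le> \<phi> * (7 / 100 * s * \<gamma>)" using \<phi> \<theta>(1) by simp
    ultimately show "\<phi> * (1 - 23 / 25 * \<gamma> * s) + 2 / (\<gamma> * s) * \<eta>\<^sup>2 + K * (4 * \<eta>\<^sup>2) \<le> (1 - \<theta>) * \<phi>"
      by (simp add: algebra_simps)
    \<comment> \<open>With the \<open>\<rho>\<close> term the total is at most 193 times
      \<open>C * (\<gamma> / s)\<close>, hence 193/640 of \<open>\<kappa>\<^sub>1\<close>; adding
      24/100 stays below 1.\<close>
    have "C * (8 * \<gamma> / s + K * (16 * \<gamma>\<^sup>2)) \<le> C * (33 / 4 * (\<gamma> / s))"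
      using hx pos by (intro mult_left_mono) auto
    then show "1 - \<kappa>\<^sub>1 + 4 * C * (8 * \<gamma> / s + K * (16 * \<gamma>\<^sup>2)) + 2 * C * \<rho> \<le> 1 - \<theta>"
      using C1 \<theta>(2) pos by (simp add: \<rho>_def)
    show "s * (1 - \<kappa>\<^sub>2) + 4 * C * H + 2 * C * \<tau> \<le> (1 - \<theta>) * s"
    proof -
      have "s * \<theta> \<le> s * (57 / 100 * \<kappa>\<^sub>2)" using pos \<theta>(3) by (intro mult_left_mono) auto
      \<comment> \<open>Since \<open>\<tau> = 8 * H\<close>, the two compression terms sum to 20
        times \<open>C * H\<close>, at most 0.225 of \<open>s * \<kappa>\<^sub>2\<close>, and 0.225
        + 0.57 is below 1.\<close>
      then have "20 * (C * H) \<le> s * \<kappa>\<^sub>2 - s * \<theta>"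
        using CH mult_pos_pos[OF pos(1) pos(10)] by linarith
      then show ?thesis by (simp add: \<tau> algebra_simps)
    qed
    \<comment> \<open>Error feedback keeps half of \<open>\<rho>\<close> and the rate takes at most
      a quarter, so a quarter, 20 times \<open>\<gamma> / s\<close>, must cover the injection of
      33/2 times \<open>\<gamma> / s\<close>.\<close>
    have "1 / 4 * \<rho> \<ge> \<theta> * \<rho>" using \<theta>(4) pos by (intro mult_right_mono) (auto simp: \<rho>_def)
    moreover have "2 * (8 * \<gamma> / s + K * (16 * \<gamma>\<^sup>2)) \<le> \<rho> / 4"
      using hx divide_pos_pos[OF pos(6) pos(1)] by (simp add: \<rho>_def)
    ultimately show "2 * (8 * \<gamma> / s + K * (16 * \<gamma>\<^sup>2)) + \<rho> / 2 \<le> (1 - \<theta>) * \<rho>"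
      by (simp add: left_diff_distrib)
    \<comment> \<open>The same budget is exhausted here: 2 H + 4 H is three quarters of 8 H, whence
      the factor 8 in \<open>\<tau>\<close>.\<close>
    have "\<theta> * \<tau> \<le> 1 / 4 * \<tau>" using \<theta>(4) H by (intro mult_right_mono) (auto simp: \<tau>)
    then show "2 * H + \<tau> / 2 \<le> (1 - \<theta>) * \<tau>" by (simp add: left_diff_distrib \<tau>)
    \<comment> \<open>One factor \<open>s\<close> comes from the weight of the tracking error and
      one from the bound on \<open>\<gamma>\<close>; together they match the squared
      \<open>s\<close> in \<open>\<phi>\<close>.\<close>
    have "s * q * (2 * \<gamma>\<^sup>2) = s * \<gamma> / (20000 * L\<^sup>2) * (40000 * q * \<gamma> * L\<^sup>2)"
      using pos by (simp add: field_simps power2_eq_square)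
    also have "\<dots> \<le> s * \<gamma> / (20000 * L\<^sup>2) * s" using \<gamma>(2) pos by (intro mult_left_mono) auto
    also have "\<dots> \<le> \<phi> * (2 / 25 * \<gamma>)"
      using pos by (simp add: \<phi>_def field_simps power2_eq_square)
    finally show "s * q * (2 * \<gamma>\<^sup>2) \<le> \<phi> * (2 / 25 * \<gamma>)" .
    \<comment> \<open>One factor \<open>\<eta>\<close> is exchanged for \<open>\<gamma>\<close> so
      that \<open>K\<gamma>\<close> applies; the drift caused by the mean of Y then fits into the
      gradient-step dissipation.\<close>
    have "K * (4 * \<eta>\<^sup>2) \<le> (K * \<gamma>) * (4 * \<eta>)"
      using K0 \<eta>(4) pos mult_left_mono[of \<eta> \<gamma> "K * (4 * \<eta>)"] by (simp add: power2_eq_square mult_ac)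
    also have "\<dots> \<le> 126 / 10000 * 1 * (4 * \<eta>)"
      using K\<gamma> pos by (intro mult_right_mono) auto
    finally show "K * (4 * \<eta>\<^sup>2) \<le> \<eta> / 4" using pos by simp
    show "1 - \<eta> * \<nu> \<le> 1 - \<theta>" using \<theta>(5) by simp
  qed
qed

section \<open>Second-moment versions of the norm inequalities\<close>

definition mean_sq :: "'w measure \<Rightarrow> ('w \<Rightarrow> 'b::euclidean_space) \<Rightarrow> real" where
  "mean_sq M v = (\<integral>\<omega>. (norm (v \<omega>))\<^sup>2 \<partial>M)"

lemma mean_sq_nonneg: "0 \<le> mean_sq M v"
  by (simp add: mean_sq_def)

text \<open>Four summands cover the longest pointwise bound to which it is applied, and shorter
  bounds are padded with coefficient 0. Coefficients may be negative, so dissipation terms survive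
  integration.\<close>

lemma mean_sq_mono:
  assumes "sq_integrable M v"
    and "sq_integrable M u1" "sq_integrable M u2" "sq_integrable M u3" "sq_integrable M u4"
    and "\<And>\<omega>. (norm (v \<omega>))\<^sup>2 \<le> a1 * (norm (u1 \<omega>))\<^sup>2 + a2 * (norm (u2 \<omega>))\<^sup>2
      + a3 * (norm (u3 \<omega>))\<^sup>2 + a4 * (norm (u4 \<omega>))\<^sup>2"
  shows "mean_sq M v \<le> a1 * mean_sq M u1 + a2 * mean_sq M u2 + a3 * mean_sq M u3 + a4 * mean_sq M u4"
proof -
  have "mean_sq M v \<le> (\<integral>\<omega>. a1 * (norm (u1 \<omega>))\<^sup>2 + a2 * (norm (u2 \<omega>))\<^sup>2
      + a3 * (norm (u3 \<omega>))\<^sup>2 + a4 * (norm (u4 \<omega>))\<^sup>2 \<partial>M)"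
    unfolding mean_sq_def using assms by (intro integral_mono) (auto simp: sq_integrable_def)
  also have "\<dots> = a1 * mean_sq M u1 + a2 * mean_sq M u2 + a3 * mean_sq M u3 + a4 * mean_sq M u4"
    using assms by (simp add: mean_sq_def sq_integrable_def)
  finally show ?thesis .
qed

lemma mean_sq_add_le_weighted:
  assumes "sq_integrable M u" "sq_integrable M v" "0 < t" "t < 1"
  shows "mean_sq M (\<lambda>\<omega>. u \<omega> + v \<omega>) \<le> mean_sq M u / (1 - t) + mean_sq M v / t"
proof -
  have "mean_sq M (\<lambda>\<omega>. u \<omega> + v \<omega>) \<le> (\<integral>\<omega>. (norm (u \<omega>))\<^sup>2 / (1 - t) + (norm (v \<omega>))\<^sup>2 / t \<partial>M)"
    unfolding mean_sq_def using sq_integrable_add[OF assms(1,2)] assms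
    by (intro integral_mono norm_add_sq_le_weighted) (auto simp: sq_integrable_def)
  also have "\<dots> = mean_sq M u / (1 - t) + mean_sq M v / t"
    using assms by (simp add: mean_sq_def sq_integrable_def)
  finally show ?thesis .
qed

lemma mean_sq_add_le:
  assumes "sq_integrable M u" "sq_integrable M v"
  shows "mean_sq M (\<lambda>\<omega>. u \<omega> + v \<omega>) \<le> 2 * mean_sq M u + 2 * mean_sq M v"
  using mean_sq_add_le_weighted[OF assms, of "1 / 2"] by simp

lemma mean_sq_scaleR: "mean_sq M (\<lambda>\<omega>. c *\<^sub>R v \<omega>) = c\<^sup>2 * mean_sq M v"
  by (simp add: mean_sq_def power_mult_distrib)

text \<open>Splitting the compressor input with factor 2 leaves \<open>2 * C * vs\<^sup>2\<close> on
  the old error. The first condition on \<open>vs\<close> makes this at most 1/2; the second bounds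
  the total coefficient of the old error in \<open>vs *\<^sub>R E \<omega> - E' \<omega>\<close> by
  2.\<close>

lemma error_feedback_moments:
  assumes E: "sq_integrable M E" and E': "sq_integrable M E'" and u: "sq_integrable M u"
    and le: "mean_sq M E' \<le> C * mean_sq M (\<lambda>\<omega>. vs *\<^sub>R E \<omega> + u \<omega>)" and C: "0 \<le> C"
    and vs: "4 * C * vs\<^sup>2 \<le> 1" "(2 * C + 1) * vs\<^sup>2 \<le> 1"
  shows "mean_sq M E' \<le> mean_sq M E / 2 + 2 * C * mean_sq M u"
    and "mean_sq M (\<lambda>\<omega>. vs *\<^sub>R E \<omega> - E' \<omega>) \<le> 2 * mean_sq M E + 4 * C * mean_sq M u"
proof -
  have vsE: "sq_integrable M (\<lambda>\<omega>. vs *\<^sub>R E \<omega>)" by (rule sq_integrable_scaleR[OF E])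
  have "C * mean_sq M (\<lambda>\<omega>. vs *\<^sub>R E \<omega> + u \<omega>) \<le> C * (2 * (vs\<^sup>2 * mean_sq M E) + 2 * mean_sq M u)"
    using mean_sq_add_le[OF vsE u] C by (intro mult_left_mono) (auto simp: mean_sq_scaleR)
  with le have le': "mean_sq M E' \<le> 2 * C * vs\<^sup>2 * mean_sq M E + 2 * C * mean_sq M u"
    by (simp add: algebra_simps)
  have "4 * C * vs\<^sup>2 * mean_sq M E \<le> 1 * mean_sq M E"
    by (intro mult_right_mono vs mean_sq_nonneg)
  with le' show "mean_sq M E' \<le> mean_sq M E / 2 + 2 * C * mean_sq M u" by simp
  have "mean_sq M (\<lambda>\<omega>. vs *\<^sub>R E \<omega> - E' \<omega>) \<le> 2 * (vs\<^sup>2 * mean_sq M E) + 2 * mean_sq M E'"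
    using mean_sq_add_le[OF vsE sq_integrable_scaleR[OF E', of "-1"]]
    by (simp add: mean_sq_scaleR) (simp add: mean_sq_def)
  also have "\<dots> \<le> 2 * ((2 * C + 1) * vs\<^sup>2 * mean_sq M E) + 4 * C * mean_sq M u"
    using le' by (simp add: algebra_simps)
  also have "(2 * C + 1) * vs\<^sup>2 * mean_sq M E \<le> 1 * mean_sq M E"
    by (intro mult_right_mono vs mean_sq_nonneg)
  finally show "mean_sq M (\<lambda>\<omega>. vs *\<^sub>R E \<omega> - E' \<omega>) \<le> 2 * mean_sq M E + 4 * C * mean_sq M u" by simp
qed

text \<open>Young's inequality with weight \<open>c / (1 + c)\<close> multiplies the compressed part
  by \<open>1 + c\<close>, and (1 + c)(1 - 2 c) = 1 - c (2 c + 1). This is the origin of the rates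
  \<open>\<kappa>\<^sub>1\<close> and \<open>\<kappa>\<^sub>2\<close>.\<close>

lemma compressed_tracking_moment:
  assumes v: "sq_integrable M v" and d: "sq_integrable M d" and c: "0 < c"
    and le: "mean_sq M v \<le> (1 - 2 * c) * mean_sq M u"
  shows "mean_sq M (\<lambda>\<omega>. v \<omega> + d \<omega>) \<le> (1 - c * (2 * c + 1)) * mean_sq M u + (1 + inverse c) * mean_sq M d"
proof -
  have t: "0 < c / (1 + c)" "c / (1 + c) < 1" "1 - c / (1 + c) = 1 / (1 + c)"
    using c by (simp_all add: field_simps)
  have "mean_sq M (\<lambda>\<omega>. v \<omega> + d \<omega>) \<le> (1 + c) * mean_sq M v + (1 + inverse c) * mean_sq M d"
    using mean_sq_add_le_weighted[OF v d t(1,2)] c unfolding t(3) by (simp add: field_simps)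
  also have "(1 + c) * mean_sq M v \<le> (1 + c) * ((1 - 2 * c) * mean_sq M u)"
    using le c by (intro mult_left_mono) auto
  finally show ?thesis by (simp add: algebra_simps)
qed

section \<open>Second moments along a run\<close>

text \<open>All parameter bounds are stated multiplied out, without division by \<open>C\<close>, so
  that C = 0 is included; \<open>s\<close> stands for 1 - \<sigma>, and \<open>\<theta>\<close> is
  any number below the listed rates.\<close>

locale error_feedback = prob_space M
  for M :: "'w measure" +
  fixes W :: "real^'n^'n" and F :: "'n::finite \<Rightarrow> real^'d \<Rightarrow> real"
    and L \<nu> m r \<psi> \<phi>\<^sub>X \<phi>\<^sub>Y \<gamma> \<eta> vs s \<theta> :: real
    and R :: "'r measure" and \<C> :: "'r \<Rightarrow> real^'d \<Rightarrow> real^'d"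
    and \<xi> :: "channel \<times> 'n \<times> nat \<Rightarrow> 'w \<Rightarrow> 'r" and X0 :: "real^'d^'n"
    and c\<^sub>1 c\<^sub>2 C p q \<kappa>\<^sub>1 \<kappa>\<^sub>2
  assumes c\<^sub>1_def: "c\<^sub>1 = \<phi>\<^sub>X * \<psi> * r / 2" and c\<^sub>2_def: "c\<^sub>2 = \<phi>\<^sub>Y * \<psi> * r / 2"
    and C_def: "C = 2 * r\<^sup>2 * (1 - \<psi>) + 2 * (1 - r)\<^sup>2"
    and p_def: "p = 1 + inverse c\<^sub>1" and q_def: "q = 1 + inverse c\<^sub>2"
    and \<kappa>\<^sub>1_def: "\<kappa>\<^sub>1 = c\<^sub>1 * (2 * c\<^sub>1 + 1)" and \<kappa>\<^sub>2_def: "\<kappa>\<^sub>2 = c\<^sub>2 * (2 * c\<^sub>2 + 1)"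
    and W: "W *v 1 = 1" "1 v* W = 1" "spectral_norm (W - averaging_matrix) = 1 - s"
    and s: "0 < s" "s < 1"
    and differentiable: "\<And>i x. F i differentiable (at x)"
    and minimum: "\<And>x. m \<le> mean_cost F x"
    and L: "0 < L" "\<And>i x y. norm (gradient (F i) x - gradient (F i) y) \<le> L * norm (x - y)"
    and PL: "0 < \<nu>" "\<And>x. 1 / 2 * (norm (gradient (mean_cost F) x))\<^sup>2 \<ge> \<nu> * (mean_cost F x - m)"
    and r: "0 < r" and \<psi>: "0 < \<psi>" "\<psi> \<le> 1" and \<C>: "compressor R \<C> r \<psi>"
    and \<xi>: "indep_vars (\<lambda>_. R) \<xi> UNIV" "\<And>a. distr M R (\<xi> a) = R"
    and \<phi>XY: "0 < \<phi>\<^sub>X" "\<phi>\<^sub>X < 1 / r" "0 < \<phi>\<^sub>Y" "\<phi>\<^sub>Y < 1 / r"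
    and \<gamma>: "0 < \<gamma>" "160 * p * \<gamma> \<le> s" "40000 * q * \<gamma> * L\<^sup>2 \<le> s" "4 * C * \<gamma> \<le> \<kappa>\<^sub>2 * L\<^sup>2"
      "640 * C * \<gamma> \<le> s * \<kappa>\<^sub>1" "640 * C * \<gamma> \<le> s * \<kappa>\<^sub>2" "5 * q * \<gamma> \<le> 1"
    and \<eta>: "0 < \<eta>" "40 * L * \<eta> \<le> s\<^sup>2 * \<gamma>" "L\<^sup>2 * \<eta> \<le> 2 / 5 * s * \<gamma>" "6400 * L\<^sup>2 * p * \<eta>\<^sup>2 \<le> s ^ 4 * \<gamma>"
      "2 * L * \<eta> \<le> 1" "\<eta> \<le> \<gamma>"
    and vs: "4 * C * vs\<^sup>2 \<le> 1" "(2 * C + 1) * vs\<^sup>2 \<le> 1"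
    and \<theta>: "\<theta> \<le> 7 / 100 * s * \<gamma>" "\<theta> \<le> 24 / 100 * \<kappa>\<^sub>1" "\<theta> \<le> 57 / 100 * \<kappa>\<^sub>2" "\<theta> \<le> 1 / 4" "\<theta> \<le> \<eta> * \<nu>"
begin

definition S :: "nat \<Rightarrow> 'w \<Rightarrow> ('d, 'n) alg_state" where
  "S k \<omega> = alg F W \<gamma> \<eta> \<phi>\<^sub>X \<phi>\<^sub>Y vs (\<lambda>ch i t. \<C> (\<xi> (ch, i, t) \<omega>)) X0 k"

abbreviation "X k \<omega> \<equiv> st_X (S k \<omega>)"
abbreviation "Y k \<omega> \<equiv> st_Y (S k \<omega>)"
abbreviation "A k \<omega> \<equiv> st_A (S k \<omega>)"
abbreviation "Cs k \<omega> \<equiv> st_C (S k \<omega>)"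
abbreviation "ErrX k \<omega> \<equiv> st_EX (S k \<omega>)"
abbreviation "ErrY k \<omega> \<equiv> st_EY (S k \<omega>)"
abbreviation "gap k \<omega> \<equiv> real CARD('n) * (mean_cost F (mean (X k \<omega>)) - m)"

lemma \<C>_measurable: "case_prod \<C> \<in> borel_measurable (R \<Otimes>\<^sub>M borel)" and R: "prob_space R"
  using \<C> by (simp_all add: compressor_def)

lemma gradients_measurable: "local_gradients F \<in> borel_measurable borel"
  by (rule borel_measurable_local_gradients[of L]) (use L in auto)

lemma parameter_bounds: "0 < c\<^sub>1" "0 < c\<^sub>2" "0 \<le> C" "1 \<le> p" "1 \<le> q" "0 < \<kappa>\<^sub>1" "0 < \<kappa>\<^sub>2"
    "2 * c\<^sub>1 = \<phi>\<^sub>X * \<psi> * r" "2 * c\<^sub>2 = \<phi>\<^sub>Y * \<psi> * r" "2 * c\<^sub>1 < 1" "2 * c\<^sub>2 < 1"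
proof -
  show "0 < c\<^sub>1" "0 < c\<^sub>2" "2 * c\<^sub>1 = \<phi>\<^sub>X * \<psi> * r" "2 * c\<^sub>2 = \<phi>\<^sub>Y * \<psi> * r"
    using \<phi>XY \<psi> r by (simp_all add: c\<^sub>1_def c\<^sub>2_def)
  then show "1 \<le> p" "1 \<le> q" "0 < \<kappa>\<^sub>1" "0 < \<kappa>\<^sub>2" by (simp_all add: p_def q_def \<kappa>\<^sub>1_def \<kappa>\<^sub>2_def)
  show "0 \<le> C" using \<psi> by (simp add: C_def)
  have "\<phi> * \<psi> * r < 1" if "0 < \<phi>" "\<phi> < 1 / r" for \<phi>
  proof -
    have "\<phi> * r < 1" using that r by (simp add: field_simps)
    moreover have "\<phi> * r * \<psi> \<le> \<phi> * r * 1" using that r \<psi> by (intro mult_left_mono) auto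
    ultimately show ?thesis by (simp add: mult_ac)
  qed
  from this[OF \<phi>XY(1,2)] this[OF \<phi>XY(3,4)] show "2 * c\<^sub>1 < 1" "2 * c\<^sub>2 < 1"
    by (simp_all add: c\<^sub>1_def c\<^sub>2_def)
qed

text \<open>The four cases are the four vectors handed to the compressor at time
  \<open>k\<close>.\<close>

lemma fresh_S:
  fixes H :: "('d, 'n) alg_state \<Rightarrow> real^'d^'n"
  assumes "H = (\<lambda>s. st_X s - st_A s) \<or> H = (\<lambda>s. st_Y s - st_C s) \<or>
    H = (\<lambda>s. vs *\<^sub>R st_EX s + st_X s - st_A s) \<or> H = (\<lambda>s. vs *\<^sub>R st_EY s + st_Y s - st_C s)"
  shows "fresh M R (\<lambda>\<omega>. H (S k \<omega>)) (\<xi> (ch, i, k))"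
  unfolding S_def
proof (rule fresh_alg[OF \<xi>])
  let ?N = "\<Pi>\<^sub>M a\<in>{a :: channel \<times> 'n \<times> nat. snd (snd a) < k}. R"
  note [measurable] = alg_measurable[OF \<C>_measurable gradients_measurable, of k "\<lambda>a w. w a" ?N W \<gamma> \<eta> \<phi>\<^sub>X \<phi>\<^sub>Y vs X0, simplified]
  show "(\<lambda>w. H (alg F W \<gamma> \<eta> \<phi>\<^sub>X \<phi>\<^sub>Y vs (\<lambda>ch i t. \<C> (w (ch, i, t))) X0 k)) \<in> borel_measurable ?N"
    using assms by (elim disjE) (simp; measurable)+
next
  fix cmp cmp' :: "channel \<Rightarrow> 'n \<Rightarrow> nat \<Rightarrow> real^'d \<Rightarrow> real^'d"
  assume "\<And>ch i t. t < k \<Longrightarrow> cmp ch i t = cmp' ch i t"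
  note cong = alg_core_cong[of k cmp cmp' F W \<gamma> \<eta> \<phi>\<^sub>X \<phi>\<^sub>Y vs X0, OF this]
  show "H (alg F W \<gamma> \<eta> \<phi>\<^sub>X \<phi>\<^sub>Y vs cmp X0 k) = H (alg F W \<gamma> \<eta> \<phi>\<^sub>X \<phi>\<^sub>Y vs cmp' X0 k)"
    using assms by (elim disjE) (simp_all add: cong)
qed

lemma compression_error_stacked:
  assumes "\<And>i. fresh M R v (\<xi> (ch, i, k))" "sq_integrable M v"
  shows "sq_integrable M (\<lambda>\<omega>. v \<omega> - (\<chi> i. \<C> (\<xi> (ch, i, k) \<omega>) (v \<omega> $ i)))"
    and "mean_sq M (\<lambda>\<omega>. v \<omega> - (\<chi> i. \<C> (\<xi> (ch, i, k) \<omega>) (v \<omega> $ i))) \<le> C * mean_sq M v"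
proof -
  have T: "(\<lambda>(s, x). x - \<C> s x) \<in> borel_measurable (R \<Otimes>\<^sub>M borel)"
    using \<C>_measurable by measurable
  have eq: "v \<omega> - (\<chi> i. \<C> (\<xi> (ch, i, k) \<omega>) (v \<omega> $ i))
      = (\<chi> i. v \<omega> $ i - \<C> (\<xi> (ch, i, k) \<omega>) (v \<omega> $ i))" for \<omega>
    by (simp add: vec_eq_iff)
  note * = fresh_blockwise_moment[OF R T compression_error_moment[OF \<C> r, folded C_def] parameter_bounds(3)
      assms(1) \<xi>(2) assms(2)]
  show "sq_integrable M (\<lambda>\<omega>. v \<omega> - (\<chi> i. \<C> (\<xi> (ch, i, k) \<omega>) (v \<omega> $ i)))"
    "mean_sq M (\<lambda>\<omega>. v \<omega> - (\<chi> i. \<C> (\<xi> (ch, i, k) \<omega>) (v \<omega> $ i))) \<le> C * mean_sq M v"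
    unfolding eq mean_sq_def by (rule *)+
qed

lemma damped_compression_stacked:
  assumes "\<And>i. fresh M R v (\<xi> (ch, i, k))" "sq_integrable M v" "0 < \<phi>" "\<phi> < 1 / r" "0 \<le> 1 - \<phi> * \<psi> * r"
  shows "sq_integrable M (\<lambda>\<omega>. v \<omega> - \<phi> *\<^sub>R (\<chi> i. \<C> (\<xi> (ch, i, k) \<omega>) (v \<omega> $ i)))"
    and "mean_sq M (\<lambda>\<omega>. v \<omega> - \<phi> *\<^sub>R (\<chi> i. \<C> (\<xi> (ch, i, k) \<omega>) (v \<omega> $ i))) \<le> (1 - \<phi> * \<psi> * r) * mean_sq M v"
proof -
  have T: "(\<lambda>(s, x). x - \<phi> *\<^sub>R \<C> s x) \<in> borel_measurable (R \<Otimes>\<^sub>M borel)"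
    using \<C>_measurable by measurable
  have eq: "v \<omega> - \<phi> *\<^sub>R (\<chi> i. \<C> (\<xi> (ch, i, k) \<omega>) (v \<omega> $ i))
      = (\<chi> i. v \<omega> $ i - \<phi> *\<^sub>R \<C> (\<xi> (ch, i, k) \<omega>) (v \<omega> $ i))" for \<omega>
    by (simp add: vec_eq_iff)
  note * = fresh_blockwise_moment[OF R T damped_compression_moment[OF \<C> r assms(3,4)] assms(5)
      assms(1) \<xi>(2) assms(2)]
  show "sq_integrable M (\<lambda>\<omega>. v \<omega> - \<phi> *\<^sub>R (\<chi> i. \<C> (\<xi> (ch, i, k) \<omega>) (v \<omega> $ i)))"
    "mean_sq M (\<lambda>\<omega>. v \<omega> - \<phi> *\<^sub>R (\<chi> i. \<C> (\<xi> (ch, i, k) \<omega>) (v \<omega> $ i))) \<le> (1 - \<phi> * \<psi> * r) * mean_sq M v"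
    unfolding eq mean_sq_def by (rule *)+
qed

lemma sq_integrable_gradients_diff:
  assumes "sq_integrable M u" "sq_integrable M v"
  shows "sq_integrable M (\<lambda>\<omega>. local_gradients F (u \<omega>) - local_gradients F (v \<omega>))"
proof (rule sq_integrable_bound[OF sq_integrable_diff[OF assms]])
  have "(\<lambda>\<omega>. local_gradients F (w \<omega>)) \<in> borel_measurable M" if "sq_integrable M w" for w
    using that by (intro measurable_compose[OF _ gradients_measurable]) (simp add: sq_integrable_def)
  then show "(\<lambda>\<omega>. local_gradients F (u \<omega>) - local_gradients F (v \<omega>)) \<in> borel_measurable M"
    using assms by (intro borel_measurable_diff) auto
  show "norm (local_gradients F (u \<omega>) - local_gradients F (v \<omega>)) \<le> L * norm (u \<omega> - v \<omega>)" for \<omega>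
    using L by (intro norm_local_gradients_diff_le) auto
qed

lemma S_Q:
  "st_QX (S k \<omega>) = (\<chi> i. \<C> (\<xi> (CQX, i, k) \<omega>) ((X k \<omega> - A k \<omega>) $ i))"
  "st_QY (S k \<omega>) = (\<chi> i. \<C> (\<xi> (CQY, i, k) \<omega>) ((Y k \<omega> - Cs k \<omega>) $ i))"
  "st_QhatX (S k \<omega>) = (\<chi> i. \<C> (\<xi> (if k = 0 then CQX else CQhatX, i, k) \<omega>)
    ((vs *\<^sub>R ErrX k \<omega> + X k \<omega> - A k \<omega>) $ i))"
  "st_QhatY (S k \<omega>) = (\<chi> i. \<C> (\<xi> (if k = 0 then CQY else CQhatY, i, k) \<omega>)
    ((vs *\<^sub>R ErrY k \<omega> + Y k \<omega> - Cs k \<omega>) $ i))"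
  unfolding S_def by (rule alg_Q)+

lemma S_Suc:
  "X (Suc k) \<omega> = X k \<omega> - \<gamma> *\<^sub>R laplacian W (X k \<omega> + (vs *\<^sub>R ErrX k \<omega> - ErrX (Suc k) \<omega>)) - \<eta> *\<^sub>R Y k \<omega>"
  "Y (Suc k) \<omega> = Y k \<omega> - \<gamma> *\<^sub>R laplacian W (Y k \<omega> + (vs *\<^sub>R ErrY k \<omega> - ErrY (Suc k) \<omega>))
      + (local_gradients F (X (Suc k) \<omega>) - local_gradients F (X k \<omega>))"
  "X (Suc k) \<omega> - A (Suc k) \<omega> = (X k \<omega> - A k \<omega> - \<phi>\<^sub>X *\<^sub>R st_QX (S k \<omega>)) + (X (Suc k) \<omega> - X k \<omega>)"
  "Y (Suc k) \<omega> - Cs (Suc k) \<omega> = (Y k \<omega> - Cs k \<omega> - \<phi>\<^sub>Y *\<^sub>R st_QY (S k \<omega>)) + (Y (Suc k) \<omega> - Y k \<omega>)"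
  "ErrX (Suc k) \<omega> = vs *\<^sub>R ErrX k \<omega> + X k \<omega> - A k \<omega> - st_QhatX (S k \<omega>)"
  "ErrY (Suc k) \<omega> = vs *\<^sub>R ErrY k \<omega> + Y k \<omega> - Cs k \<omega> - st_QhatY (S k \<omega>)"
  unfolding S_def by (rule alg_Suc)+

lemma S_0: "X 0 \<omega> = X0" "Y 0 \<omega> = local_gradients F X0" "A 0 \<omega> = 0" "Cs 0 \<omega> = 0" "ErrX 0 \<omega> = 0" "ErrY 0 \<omega> = 0"
  by (simp_all add: S_def alg_init_def Let_def)

text \<open>This collects all consequences of independence; the later estimates combine these
  moments with pointwise inequalities.\<close>

lemma one_step_moments:
  assumes X: "sq_integrable M (X k)" and Y: "sq_integrable M (Y k)"
    and A: "sq_integrable M (\<lambda>\<omega>. X k \<omega> - A k \<omega>)" and Cs: "sq_integrable M (\<lambda>\<omega>. Y k \<omega> - Cs k \<omega>)"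
    and ErrX: "sq_integrable M (ErrX k)" and ErrY: "sq_integrable M (ErrY k)"
  shows "sq_integrable M (\<lambda>\<omega>. X k \<omega> - A k \<omega> - \<phi>\<^sub>X *\<^sub>R st_QX (S k \<omega>))"
    "mean_sq M (\<lambda>\<omega>. X k \<omega> - A k \<omega> - \<phi>\<^sub>X *\<^sub>R st_QX (S k \<omega>)) \<le> (1 - 2 * c\<^sub>1) * mean_sq M (\<lambda>\<omega>. X k \<omega> - A k \<omega>)"
    "sq_integrable M (\<lambda>\<omega>. Y k \<omega> - Cs k \<omega> - \<phi>\<^sub>Y *\<^sub>R st_QY (S k \<omega>))"
    "mean_sq M (\<lambda>\<omega>. Y k \<omega> - Cs k \<omega> - \<phi>\<^sub>Y *\<^sub>R st_QY (S k \<omega>)) \<le> (1 - 2 * c\<^sub>2) * mean_sq M (\<lambda>\<omega>. Y k \<omega> - Cs k \<omega>)"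
    "sq_integrable M (ErrX (Suc k))"
    "mean_sq M (ErrX (Suc k)) \<le> C * mean_sq M (\<lambda>\<omega>. vs *\<^sub>R ErrX k \<omega> + (X k \<omega> - A k \<omega>))"
    "sq_integrable M (ErrY (Suc k))"
    "mean_sq M (ErrY (Suc k)) \<le> C * mean_sq M (\<lambda>\<omega>. vs *\<^sub>R ErrY k \<omega> + (Y k \<omega> - Cs k \<omega>))"
proof -
  have fA: "fresh M R (\<lambda>\<omega>. X k \<omega> - A k \<omega>) (\<xi> (ch, i, k))" for ch i
    using fresh_S[of "\<lambda>s. st_X s - st_A s"] by simp
  have fC: "fresh M R (\<lambda>\<omega>. Y k \<omega> - Cs k \<omega>) (\<xi> (ch, i, k))" for ch i
    using fresh_S[of "\<lambda>s. st_Y s - st_C s"] by simp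
  have fEX: "fresh M R (\<lambda>\<omega>. vs *\<^sub>R ErrX k \<omega> + X k \<omega> - A k \<omega>) (\<xi> (ch, i, k))" for ch i
    using fresh_S[of "\<lambda>s. vs *\<^sub>R st_EX s + st_X s - st_A s"] by simp
  have fEY: "fresh M R (\<lambda>\<omega>. vs *\<^sub>R ErrY k \<omega> + Y k \<omega> - Cs k \<omega>) (\<xi> (ch, i, k))" for ch i
    using fresh_S[of "\<lambda>s. vs *\<^sub>R st_EY s + st_Y s - st_C s"] by simp
  have iEX: "sq_integrable M (\<lambda>\<omega>. vs *\<^sub>R ErrX k \<omega> + X k \<omega> - A k \<omega>)"
    using sq_integrable_add[OF sq_integrable_scaleR[OF ErrX, of vs] A] by (simp add: algebra_simps)
  have iEY: "sq_integrable M (\<lambda>\<omega>. vs *\<^sub>R ErrY k \<omega> + Y k \<omega> - Cs k \<omega>)"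
    using sq_integrable_add[OF sq_integrable_scaleR[OF ErrY, of vs] Cs] by (simp add: algebra_simps)
  show "sq_integrable M (\<lambda>\<omega>. X k \<omega> - A k \<omega> - \<phi>\<^sub>X *\<^sub>R st_QX (S k \<omega>))"
    "mean_sq M (\<lambda>\<omega>. X k \<omega> - A k \<omega> - \<phi>\<^sub>X *\<^sub>R st_QX (S k \<omega>)) \<le> (1 - 2 * c\<^sub>1) * mean_sq M (\<lambda>\<omega>. X k \<omega> - A k \<omega>)"
    unfolding S_Q parameter_bounds(8) using parameter_bounds by (intro damped_compression_stacked fA A \<phi>XY; simp)+
  show "sq_integrable M (\<lambda>\<omega>. Y k \<omega> - Cs k \<omega> - \<phi>\<^sub>Y *\<^sub>R st_QY (S k \<omega>))"
    "mean_sq M (\<lambda>\<omega>. Y k \<omega> - Cs k \<omega> - \<phi>\<^sub>Y *\<^sub>R st_QY (S k \<omega>)) \<le> (1 - 2 * c\<^sub>2) * mean_sq M (\<lambda>\<omega>. Y k \<omega> - Cs k \<omega>)"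
    unfolding S_Q parameter_bounds(9) using parameter_bounds by (intro damped_compression_stacked fC Cs \<phi>XY; simp)+
  show "sq_integrable M (ErrX (Suc k))" "sq_integrable M (ErrY (Suc k))"
    unfolding S_Suc(5,6) S_Q by (rule compression_error_stacked fEX fEY iEX iEY)+
  show "mean_sq M (ErrX (Suc k)) \<le> C * mean_sq M (\<lambda>\<omega>. vs *\<^sub>R ErrX k \<omega> + (X k \<omega> - A k \<omega>))"
    "mean_sq M (ErrY (Suc k)) \<le> C * mean_sq M (\<lambda>\<omega>. vs *\<^sub>R ErrY k \<omega> + (Y k \<omega> - Cs k \<omega>))"
    unfolding S_Suc(5,6) S_Q add_diff_eq by (rule compression_error_stacked fEX fEY iEX iEY)+
qed

lemma sq_integrable_S:
  "sq_integrable M (X k) \<and> sq_integrable M (Y k) \<and> sq_integrable M (\<lambda>\<omega>. X k \<omega> - A k \<omega>) \<and>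
   sq_integrable M (\<lambda>\<omega>. Y k \<omega> - Cs k \<omega>) \<and> sq_integrable M (ErrX k) \<and> sq_integrable M (ErrY k)"
proof (induction k)
  case 0
  then show ?case by (simp add: S_0 sq_integrable_const)
next
  case (Suc k)
  then have IH: "sq_integrable M (X k)" "sq_integrable M (Y k)" "sq_integrable M (\<lambda>\<omega>. X k \<omega> - A k \<omega>)"
   "sq_integrable M (\<lambda>\<omega>. Y k \<omega> - Cs k \<omega>)" "sq_integrable M (ErrX k)" "sq_integrable M (ErrY k)" by auto
  note step = one_step_moments[OF IH]
  note closed = sq_integrable_add sq_integrable_diff sq_integrable_scaleR sq_integrable_linear[OF linear_laplacian]
  have X': "sq_integrable M (X (Suc k))"
    unfolding S_Suc(1) by (intro closed IH step)
  moreover have Y': "sq_integrable M (Y (Suc k))"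
    unfolding S_Suc(2) by (intro sq_integrable_add[OF _ sq_integrable_gradients_diff] closed IH step X')
  moreover have "sq_integrable M (\<lambda>\<omega>. X (Suc k) \<omega> - A (Suc k) \<omega>)" "sq_integrable M (\<lambda>\<omega>. Y (Suc k) \<omega> - Cs (Suc k) \<omega>)"
    unfolding S_Suc(3,4) by (intro sq_integrable_add step sq_integrable_diff X' Y' IH)+
  ultimately show ?case using step by simp
qed

text \<open>The Polyak-Lojasiewicz inequality bounds the nonnegative gap from above by a multiple of
  the squared gradient norm, and the gradient at the mean is square integrable by Lipschitz
  continuity.\<close>

lemma integrable_gap: "integrable M (gap k)"
proof -
  have X: "sq_integrable M (X k)" using sq_integrable_S by simp
  let ?G = "\<lambda>\<omega>. mean (local_gradients F (replicated_mean (X k \<omega>)))"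
  \<comment> \<open>Lipschitz continuity controls only differences of gradients, so the gradient at
    0 is subtracted here and added back below.\<close>
  have "sq_integrable M (\<lambda>\<omega>. local_gradients F (replicated_mean (X k \<omega>)) - local_gradients F 0)"
    by (rule sq_integrable_gradients_diff[OF sq_integrable_linear[OF linear_replicated_mean X] sq_integrable_const])
  from sq_integrable_linear[OF linear_mean sq_integrable_add[OF this sq_integrable_const[of "local_gradients F 0"]]]
  have G: "sq_integrable M ?G" by simp
  have grad: "gradient (mean_cost F) (mean (X k \<omega>)) = ?G \<omega>" for \<omega>
    using gradient_eqI[OF gradient_mean_cost[OF differentiable]] by (simp add: replicated_mean_def)
  have cont: "continuous_on UNIV (mean_cost F)"
    unfolding mean_cost_def[abs_def] using differentiable
    by (intro continuous_intros) (auto intro!: continuous_at_imp_continuous_on differentiable_imp_continuous_within)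
  have "(\<lambda>\<omega>. mean (X k \<omega>)) \<in> borel_measurable M"
    using sq_integrable_linear[OF linear_mean X] by (simp add: sq_integrable_def)
  then have m: "gap k \<in> borel_measurable M"
    by (intro borel_measurable_times borel_measurable_diff borel_measurable_const
        measurable_compose[OF _ borel_measurable_continuous_onI[OF cont]])
  have "integrable M (\<lambda>\<omega>. real CARD('n) * (1 / (2 * \<nu>) * (norm (?G \<omega>))\<^sup>2))"
    using G by (simp add: sq_integrable_def)
  then show ?thesis
  proof (rule Bochner_Integration.integrable_bound[OF _ m])
    have "gap k \<omega> \<le> real CARD('n) * (1 / (2 * \<nu>) * (norm (?G \<omega>))\<^sup>2)" for \<omega>
      using PL(2)[of "mean (X k \<omega>)"] PL(1) unfolding grad
      by (intro mult_left_mono) (auto simp: field_simps)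
    moreover have "0 \<le> gap k \<omega>" for \<omega> using minimum by simp
    ultimately show "AE \<omega> in M. norm (gap k \<omega>) \<le> norm (real CARD('n) * (1 / (2 * \<nu>) * (norm (?G \<omega>))\<^sup>2))"
      using PL(1) by (intro AE_I2) (simp only: real_norm_def abs_of_nonneg mult_nonneg_nonneg, simp)
  qed
qed

section \<open>One-step inequalities and decay of the Lyapunov function\<close>

abbreviation "dev Z \<equiv> Z - replicated_mean Z" for Z :: "real^'d^'n"

lemma norm_laplacian_sq_le:
  "(norm (laplacian W Z))\<^sup>2 \<le> 4 * (norm (dev Z))\<^sup>2" "(norm (laplacian W Z))\<^sup>2 \<le> 4 * (norm Z)\<^sup>2"
  for Z :: "real^'d^'n"
proof -
  have "spectral_norm (W - averaging_matrix) \<le> 1" using W(3) s by simp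
  note * = norm_laplacian_le[OF W(1) this, of Z] norm_laplacian_le'[OF W(1) this, of Z]
  show "(norm (laplacian W Z))\<^sup>2 \<le> 4 * (norm (dev Z))\<^sup>2" "(norm (laplacian W Z))\<^sup>2 \<le> 4 * (norm Z)\<^sup>2"
    using *[THEN power_mono, of 2] by (simp_all add: power_mult_distrib)
qed

lemma norm_gradients_sq_le:
  "(norm (local_gradients F U - local_gradients F V))\<^sup>2 \<le> L\<^sup>2 * (norm (U - V))\<^sup>2" for U V :: "real^'d^'n"
  using norm_local_gradients_diff_le[of L F U V, THEN power_mono, of 2] L by (simp add: power_mult_distrib)

lemma mean_X_Suc: "mean (X (Suc k) \<omega>) = mean (X k \<omega>) - \<eta> *\<^sub>R mean (Y k \<omega>)"
  unfolding S_Suc(1)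
  by (simp add: linear_diff[OF linear_mean] linear_scale[OF linear_mean] mean_laplacian[OF W(2)])

lemma mean_Y: "mean (Y k \<omega>) = mean (local_gradients F (X k \<omega>))"
  unfolding S_def by (rule gradient_tracking[OF W(2)])

definition "weight_Y = s\<^sup>2 / (320 * L\<^sup>2)"
definition "weight_EX = 80 * \<gamma> / s"
definition "weight_EY = 8 * (s\<^sup>2 / (320 * L\<^sup>2) * (8 * \<gamma> / s) + s * q * (16 * \<gamma>\<^sup>2))"

definition V :: "nat \<Rightarrow> real" where
  "V k = mean_sq M (\<lambda>\<omega>. dev (X k \<omega>)) + weight_Y * mean_sq M (\<lambda>\<omega>. dev (Y k \<omega>))
    + mean_sq M (\<lambda>\<omega>. X k \<omega> - A k \<omega>) + s * mean_sq M (\<lambda>\<omega>. Y k \<omega> - Cs k \<omega>)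
    + weight_EX * mean_sq M (ErrX k) + weight_EY * mean_sq M (ErrY k) + (\<integral>\<omega>. gap k \<omega> \<partial>M)"

text \<open>The facts 1 to 5, the two pairs from error feedback and fact 10 are the ten scalar
  inequalities that \<open>lyapunov_contraction\<close> takes as input.\<close>

lemma V_Suc: "V (Suc k) \<le> (1 - \<theta>) * V k"
proof -
  have IH: "sq_integrable M (X k)" "sq_integrable M (Y k)" "sq_integrable M (\<lambda>\<omega>. X k \<omega> - A k \<omega>)"
   "sq_integrable M (\<lambda>\<omega>. Y k \<omega> - Cs k \<omega>)" "sq_integrable M (ErrX k)" "sq_integrable M (ErrY k)"
    using sq_integrable_S[of k] by auto
  have IH': "sq_integrable M (X (Suc k))" "sq_integrable M (Y (Suc k))"
    "sq_integrable M (ErrX (Suc k))" "sq_integrable M (ErrY (Suc k))"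
    using sq_integrable_S[of "Suc k"] by auto
  note step = one_step_moments[OF IH]
  define hX hY where "hX \<omega> = vs *\<^sub>R ErrX k \<omega> - ErrX (Suc k) \<omega>" and "hY \<omega> = vs *\<^sub>R ErrY k \<omega> - ErrY (Suc k) \<omega>" for \<omega>
  define dX dY where "dX \<omega> = X (Suc k) \<omega> - X k \<omega>" and "dY \<omega> = Y (Suc k) \<omega> - Y k \<omega>" for \<omega>
  define LY where "LY \<omega> = laplacian W (Y k \<omega>)" for \<omega>
  have h: "sq_integrable M hX" "sq_integrable M hY"
    unfolding hX_def hY_def by (intro sq_integrable_diff sq_integrable_scaleR IH IH')+
  have d: "sq_integrable M dX" "sq_integrable M dY"
    unfolding dX_def dY_def by (intro sq_integrable_diff IH IH')+
  have LY: "sq_integrable M LY" unfolding LY_def by (rule sq_integrable_linear[OF linear_laplacian IH(2)])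
  have rm: "sq_integrable M (\<lambda>\<omega>. replicated_mean (v \<omega>))" if "sq_integrable M v" for v :: "_ \<Rightarrow> real^'d^'n"
    by (rule sq_integrable_linear[OF linear_replicated_mean that])
  have dev: "sq_integrable M (\<lambda>\<omega>. dev (v \<omega>))" if "sq_integrable M v" for v :: "_ \<Rightarrow> real^'d^'n"
    by (rule sq_integrable_diff[OF that rm[OF that]])
  have \<gamma>5: "\<gamma> \<le> 1 / 5"
  proof -
    have "5 * \<gamma> * 1 \<le> 5 * \<gamma> * q" using \<gamma>(1) parameter_bounds(5) by (intro mult_left_mono) auto
    with \<gamma>(7) show ?thesis by (simp add: mult_ac)
  qed
  note cs = consensus_step[OF W s \<gamma>(1) \<gamma>5]

  have X': "X (Suc k) \<omega> = X k \<omega> - \<gamma> *\<^sub>R laplacian W (X k \<omega> + hX \<omega>) + - \<eta> *\<^sub>R Y k \<omega>" for \<omega>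
    unfolding S_Suc(1) hX_def by simp
  have Y': "Y (Suc k) \<omega> = Y k \<omega> - \<gamma> *\<^sub>R laplacian W (Y k \<omega> + hY \<omega>)
      + (local_gradients F (X (Suc k) \<omega>) - local_gradients F (X k \<omega>))" for \<omega>
    unfolding S_Suc(2)[of k \<omega>] hY_def by simp

  have "mean_sq M (\<lambda>\<omega>. dev (X (Suc k) \<omega>)) \<le> (1 - 23 / 25 * \<gamma> * s) * mean_sq M (\<lambda>\<omega>. dev (X k \<omega>))
      + 8 * \<gamma> / s * mean_sq M hX + 2 / (\<gamma> * s) * \<eta>\<^sup>2 * mean_sq M (\<lambda>\<omega>. dev (Y k \<omega>)) + 0 * mean_sq M LY"
  proof (rule mean_sq_mono)
    fix \<omega>
    have "dev (- \<eta> *\<^sub>R Y k \<omega>) = - \<eta> *\<^sub>R dev (Y k \<omega>)"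
      unfolding linear_scale[OF linear_replicated_mean] by (simp add: scaleR_diff_right)
    then have eq: "(norm (dev (- \<eta> *\<^sub>R Y k \<omega>)))\<^sup>2 = \<eta>\<^sup>2 * (norm (dev (Y k \<omega>)))\<^sup>2"
      by (simp only: norm_scaleR power_mult_distrib) simp
    \<comment> \<open>For X the dissipation term of \<open>consensus_step\<close> is dropped; for Y
      it is kept as the negative coefficient of \<open>LY\<close>, where it has to pay for the
      tracking error.\<close>
    have "0 \<le> 2 / 25 * \<gamma> * (norm (laplacian W (X k \<omega>)))\<^sup>2" using \<gamma>(1) by simp
    with cs[OF X', of \<omega>, unfolded eq]
    show "(norm (dev (X (Suc k) \<omega>)))\<^sup>2 \<le> (1 - 23 / 25 * \<gamma> * s) * (norm (dev (X k \<omega>)))\<^sup>2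
      + 8 * \<gamma> / s * (norm (hX \<omega>))\<^sup>2 + 2 / (\<gamma> * s) * \<eta>\<^sup>2 * (norm (dev (Y k \<omega>)))\<^sup>2 + 0 * (norm (LY \<omega>))\<^sup>2"
      unfolding mult.assoc[of "2 / (\<gamma> * s)"] by linarith
  qed (intro dev IH IH' h LY)+
  then have 1: "mean_sq M (\<lambda>\<omega>. dev (X (Suc k) \<omega>)) \<le> (1 - 23 / 25 * \<gamma> * s) * mean_sq M (\<lambda>\<omega>. dev (X k \<omega>))
      + 8 * \<gamma> / s * mean_sq M hX + 2 / (\<gamma> * s) * \<eta>\<^sup>2 * mean_sq M (\<lambda>\<omega>. dev (Y k \<omega>))" by simp

  have "mean_sq M (\<lambda>\<omega>. dev (Y (Suc k) \<omega>)) \<le> (1 - 23 / 25 * \<gamma> * s) * mean_sq M (\<lambda>\<omega>. dev (Y k \<omega>))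
      + (- (2 / 25 * \<gamma>)) * mean_sq M LY + 8 * \<gamma> / s * mean_sq M hY + 2 / (\<gamma> * s) * L\<^sup>2 * mean_sq M dX"
  proof (rule mean_sq_mono)
    fix \<omega>
    let ?w = "local_gradients F (X (Suc k) \<omega>) - local_gradients F (X k \<omega>)"
    have "(norm (dev ?w))\<^sup>2 \<le> (norm ?w)\<^sup>2"
      by (intro power_mono norm_deviation_le norm_ge_zero)
    also have "\<dots> \<le> L\<^sup>2 * (norm (dX \<omega>))\<^sup>2" unfolding dX_def by (rule norm_gradients_sq_le)
    finally have "2 / (\<gamma> * s) * (norm (dev ?w))\<^sup>2 \<le> 2 / (\<gamma> * s) * (L\<^sup>2 * (norm (dX \<omega>))\<^sup>2)"
      using \<gamma>(1) s by (intro mult_left_mono) auto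
    then show "(norm (dev (Y (Suc k) \<omega>)))\<^sup>2 \<le> (1 - 23 / 25 * \<gamma> * s) * (norm (dev (Y k \<omega>)))\<^sup>2
      + (- (2 / 25 * \<gamma>)) * (norm (LY \<omega>))\<^sup>2 + 8 * \<gamma> / s * (norm (hY \<omega>))\<^sup>2 + 2 / (\<gamma> * s) * L\<^sup>2 * (norm (dX \<omega>))\<^sup>2"
      using cs[OF Y', of \<omega>] unfolding LY_def by (simp add: mult.assoc)
  qed (intro dev IH IH' h LY d)+
  then have 2: "mean_sq M (\<lambda>\<omega>. dev (Y (Suc k) \<omega>)) \<le> (1 - 23 / 25 * \<gamma> * s) * mean_sq M (\<lambda>\<omega>. dev (Y k \<omega>))
      - 2 / 25 * \<gamma> * mean_sq M LY + 8 * \<gamma> / s * mean_sq M hY + 2 / (\<gamma> * s) * L\<^sup>2 * mean_sq M dX" by simp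

  have 3: "mean_sq M dX \<le> 16 * \<gamma>\<^sup>2 * mean_sq M (\<lambda>\<omega>. dev (X k \<omega>)) + 16 * \<gamma>\<^sup>2 * mean_sq M hX
      + 4 * \<eta>\<^sup>2 * mean_sq M (\<lambda>\<omega>. dev (Y k \<omega>)) + 4 * \<eta>\<^sup>2 * mean_sq M (\<lambda>\<omega>. replicated_mean (Y k \<omega>))"
  proof (rule mean_sq_mono)
    fix \<omega>
    let ?a = "\<gamma> *\<^sub>R laplacian W (X k \<omega>)" and ?b = "\<gamma> *\<^sub>R laplacian W (hX \<omega>)"
      and ?c = "\<eta> *\<^sub>R dev (Y k \<omega>)" and ?d = "\<eta> *\<^sub>R replicated_mean (Y k \<omega>)"
    have "dX \<omega> = - ((?a + ?b) + (?c + ?d))"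
      unfolding dX_def X' linear_add[OF linear_laplacian] by (simp add: algebra_simps)
    then have "(norm (dX \<omega>))\<^sup>2 \<le> 2 * (norm (?a + ?b))\<^sup>2 + 2 * (norm (?c + ?d))\<^sup>2"
      using norm_add_sq_le[of "?a + ?b" "?c + ?d"] by (simp only: norm_minus_cancel)
    also have "\<dots> \<le> 4 * (norm ?a)\<^sup>2 + 4 * (norm ?b)\<^sup>2 + 4 * (norm ?c)\<^sup>2 + 4 * (norm ?d)\<^sup>2"
      using norm_add_sq_le[of ?a ?b] norm_add_sq_le[of ?c ?d] by linarith
    also have "(norm ?a)\<^sup>2 \<le> \<gamma>\<^sup>2 * (4 * (norm (dev (X k \<omega>)))\<^sup>2)"
      unfolding norm_scaleR power_mult_distrib power2_abs by (intro mult_left_mono norm_laplacian_sq_le) simp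
    also have "(norm ?b)\<^sup>2 \<le> \<gamma>\<^sup>2 * (4 * (norm (hX \<omega>))\<^sup>2)"
      unfolding norm_scaleR power_mult_distrib power2_abs by (intro mult_left_mono norm_laplacian_sq_le) simp
    also have "(norm ?c)\<^sup>2 = \<eta>\<^sup>2 * (norm (dev (Y k \<omega>)))\<^sup>2"
      unfolding norm_scaleR power_mult_distrib power2_abs ..
    also have "(norm ?d)\<^sup>2 = \<eta>\<^sup>2 * (norm (replicated_mean (Y k \<omega>)))\<^sup>2"
      unfolding norm_scaleR power_mult_distrib power2_abs ..
    finally show "(norm (dX \<omega>))\<^sup>2 \<le> 16 * \<gamma>\<^sup>2 * (norm (dev (X k \<omega>)))\<^sup>2 + 16 * \<gamma>\<^sup>2 * (norm (hX \<omega>))\<^sup>2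
      + 4 * \<eta>\<^sup>2 * (norm (dev (Y k \<omega>)))\<^sup>2 + 4 * \<eta>\<^sup>2 * (norm (replicated_mean (Y k \<omega>)))\<^sup>2"
      by simp
  qed (intro dev rm IH h d)+

  have dY_le: "mean_sq M dY \<le> 2 * \<gamma>\<^sup>2 * mean_sq M LY + 16 * \<gamma>\<^sup>2 * mean_sq M hY + 4 * L\<^sup>2 * mean_sq M dX + 0 * mean_sq M dX"
  proof (rule mean_sq_mono)
    fix \<omega>
    let ?a = "- \<gamma> *\<^sub>R LY \<omega>" and ?b = "- \<gamma> *\<^sub>R laplacian W (hY \<omega>)"
      and ?c = "local_gradients F (X (Suc k) \<omega>) - local_gradients F (X k \<omega>)"
    \<comment> \<open>The bracketing gives the \<open>LY\<close> term the factor 2 and the other two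
      the factor 4.\<close>
    have "dY \<omega> = ?a + (?b + ?c)"
      unfolding dY_def Y' linear_add[OF linear_laplacian] LY_def by (simp add: algebra_simps)
    then have "(norm (dY \<omega>))\<^sup>2 \<le> 2 * (norm ?a)\<^sup>2 + 2 * (norm (?b + ?c))\<^sup>2"
      using norm_add_sq_le[of ?a "?b + ?c"] by (simp only:)
    also have "\<dots> \<le> 2 * (norm ?a)\<^sup>2 + 4 * (norm ?b)\<^sup>2 + 4 * (norm ?c)\<^sup>2"
      using norm_add_sq_le[of ?b ?c] by linarith
    also have "(norm ?a)\<^sup>2 = \<gamma>\<^sup>2 * (norm (LY \<omega>))\<^sup>2"
      unfolding norm_scaleR power_mult_distrib power2_abs power2_minus ..
    also have "(norm ?b)\<^sup>2 \<le> \<gamma>\<^sup>2 * (4 * (norm (hY \<omega>))\<^sup>2)"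
      unfolding norm_scaleR power_mult_distrib power2_abs power2_minus
      by (intro mult_left_mono norm_laplacian_sq_le) simp
    also have "(norm ?c)\<^sup>2 \<le> L\<^sup>2 * (norm (dX \<omega>))\<^sup>2" unfolding dX_def by (rule norm_gradients_sq_le)
    finally show "(norm (dY \<omega>))\<^sup>2 \<le> 2 * \<gamma>\<^sup>2 * (norm (LY \<omega>))\<^sup>2 + 16 * \<gamma>\<^sup>2 * (norm (hY \<omega>))\<^sup>2
      + 4 * L\<^sup>2 * (norm (dX \<omega>))\<^sup>2 + 0 * (norm (dX \<omega>))\<^sup>2"
      by simp
  qed (intro h d LY)+

  have 4: "mean_sq M (\<lambda>\<omega>. X (Suc k) \<omega> - A (Suc k) \<omega>) \<le> (1 - \<kappa>\<^sub>1) * mean_sq M (\<lambda>\<omega>. X k \<omega> - A k \<omega>) + p * mean_sq M dX"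
    unfolding S_Suc(3) \<kappa>\<^sub>1_def p_def dX_def
    by (rule compressed_tracking_moment) (use step parameter_bounds d in \<open>simp_all add: dX_def[abs_def]\<close>)
  have "mean_sq M (\<lambda>\<omega>. Y (Suc k) \<omega> - Cs (Suc k) \<omega>) \<le> (1 - \<kappa>\<^sub>2) * mean_sq M (\<lambda>\<omega>. Y k \<omega> - Cs k \<omega>) + q * mean_sq M dY"
    unfolding S_Suc(4) \<kappa>\<^sub>2_def q_def dY_def
    by (rule compressed_tracking_moment) (use step parameter_bounds d in \<open>simp_all add: dY_def[abs_def]\<close>)
  also have "q * mean_sq M dY \<le> q * (2 * \<gamma>\<^sup>2 * mean_sq M LY + 16 * \<gamma>\<^sup>2 * mean_sq M hY + 4 * L\<^sup>2 * mean_sq M dX)"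
    using dY_le parameter_bounds by (intro mult_left_mono) auto
  finally have 5: "mean_sq M (\<lambda>\<omega>. Y (Suc k) \<omega> - Cs (Suc k) \<omega>) \<le> (1 - \<kappa>\<^sub>2) * mean_sq M (\<lambda>\<omega>. Y k \<omega> - Cs k \<omega>)
      + q * (2 * \<gamma>\<^sup>2 * mean_sq M LY + 16 * \<gamma>\<^sup>2 * mean_sq M hY + 4 * L\<^sup>2 * mean_sq M dX)"
    by simp
  note errX = error_feedback_moments[OF IH(5) step(5) IH(3) step(6) parameter_bounds(3) vs]
  note errY = error_feedback_moments[OF IH(6) step(7) IH(4) step(8) parameter_bounds(3) vs]

  have 10: "(\<integral>\<omega>. gap (Suc k) \<omega> \<partial>M) \<le> (1 - \<eta> * \<nu>) * (\<integral>\<omega>. gap k \<omega> \<partial>M)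
      - \<eta> / 4 * mean_sq M (\<lambda>\<omega>. replicated_mean (Y k \<omega>)) + \<eta> * L\<^sup>2 / 2 * mean_sq M (\<lambda>\<omega>. dev (X k \<omega>))"
  proof -
    have i: "integrable M (\<lambda>\<omega>. (norm (replicated_mean (Y k \<omega>)))\<^sup>2)" "integrable M (\<lambda>\<omega>. (norm (dev (X k \<omega>)))\<^sup>2)"
      using rm[OF IH(2)] dev[OF IH(1)] by (simp_all add: sq_integrable_def)
    have "(\<integral>\<omega>. gap (Suc k) \<omega> \<partial>M) \<le> (\<integral>\<omega>. (1 - \<eta> * \<nu>) * gap k \<omega>
      - \<eta> / 4 * (norm (replicated_mean (Y k \<omega>)))\<^sup>2 + \<eta> * L\<^sup>2 / 2 * (norm (dev (X k \<omega>)))\<^sup>2 \<partial>M)"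
    proof (rule integral_mono)
      show "integrable M (\<lambda>\<omega>. (1 - \<eta> * \<nu>) * gap k \<omega>
        - \<eta> / 4 * (norm (replicated_mean (Y k \<omega>)))\<^sup>2 + \<eta> * L\<^sup>2 / 2 * (norm (dev (X k \<omega>)))\<^sup>2)"
        by (intro Bochner_Integration.integrable_add Bochner_Integration.integrable_diff integrable_mult_right i integrable_gap)
      show "gap (Suc k) \<omega> \<le> (1 - \<eta> * \<nu>) * gap k \<omega>
        - \<eta> / 4 * (norm (replicated_mean (Y k \<omega>)))\<^sup>2 + \<eta> * L\<^sup>2 / 2 * (norm (dev (X k \<omega>)))\<^sup>2" for \<omega>
        unfolding mean_X_Suc
        by (rule gradient_step[OF differentiable _ _ PL(2) \<eta>(1,5) mean_Y]) (use L in auto)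
    qed (rule integrable_gap)
    also have "\<dots> = (1 - \<eta> * \<nu>) * (\<integral>\<omega>. gap k \<omega> \<partial>M)
      - \<eta> / 4 * mean_sq M (\<lambda>\<omega>. replicated_mean (Y k \<omega>)) + \<eta> * L\<^sup>2 / 2 * mean_sq M (\<lambda>\<omega>. dev (X k \<omega>))"
      unfolding mean_sq_def
      by (simp only: Bochner_Integration.integral_add Bochner_Integration.integral_diff integral_mult_right_zero
          Bochner_Integration.integrable_diff integrable_mult_right i integrable_gap)
    finally show ?thesis .
  qed
  have gap: "0 \<le> (\<integral>\<omega>. gap k \<omega> \<partial>M)" using minimum by (intro Bochner_Integration.integral_nonneg) simp
  show ?thesis
    unfolding V_def weight_Y_def weight_EX_def weight_EY_def
    by (rule lyapunov_contraction[OF s L(1) _ _ \<gamma>(1) \<eta>(1) parameter_bounds(3,6,7) \<gamma>(2-7) \<eta>(2-4,6) \<theta>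
          1 2 3 4 5 errX(2)[folded hX_def] errY(2)[folded hY_def] errX(1) errY(1) 10])
      (use parameter_bounds gap in \<open>simp_all add: mean_sq_nonneg\<close>)
qed

text \<open>The claimed quantity consists of two of the nonnegative terms of \<open>V k\<close>, and
  iterating \<open>V_Suc\<close> brings it down to the deterministic initial state.\<close>

lemma expected_error_bound:
  "integrable M (\<lambda>\<omega>. (norm (dev (X k \<omega>)))\<^sup>2 + gap k \<omega>)"
  "(\<integral>\<omega>. ((norm (dev (X k \<omega>)))\<^sup>2 + gap k \<omega>) \<partial>M) \<le> (1 - \<theta>) ^ k * initial_U F m (s\<^sup>2 / (320 * L\<^sup>2)) X0"
proof -
  have X: "sq_integrable M (X k)" using sq_integrable_S by simp
  have i: "integrable M (\<lambda>\<omega>. (norm (dev (X k \<omega>)))\<^sup>2)"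
    using sq_integrable_diff[OF X sq_integrable_linear[OF linear_replicated_mean X]] by (simp add: sq_integrable_def)
  show "integrable M (\<lambda>\<omega>. (norm (dev (X k \<omega>)))\<^sup>2 + gap k \<omega>)"
    by (rule Bochner_Integration.integrable_add[OF i integrable_gap])
  have w: "0 \<le> weight_Y" "0 \<le> weight_EX" "0 \<le> weight_EY"
    using s L \<gamma>(1) parameter_bounds by (simp_all add: weight_Y_def weight_EX_def weight_EY_def)
  have "(\<integral>\<omega>. ((norm (dev (X k \<omega>)))\<^sup>2 + gap k \<omega>) \<partial>M) = mean_sq M (\<lambda>\<omega>. dev (X k \<omega>)) + (\<integral>\<omega>. gap k \<omega> \<partial>M)"
    unfolding mean_sq_def by (rule Bochner_Integration.integral_add[OF i integrable_gap])
  also have "\<dots> \<le> V k"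
    unfolding V_def using s w by (simp add: mean_sq_nonneg)
  also have "V k \<le> (1 - \<theta>) ^ k * V 0"
  proof (induction k)
    case (Suc k)
    \<comment> \<open>The bound 1/4 on \<open>\<theta>\<close> makes \<open>1 - \<theta>\<close>
      nonnegative, so the induction hypothesis may be multiplied by it.\<close>
    have "(1 - \<theta>) * V k \<le> (1 - \<theta>) * ((1 - \<theta>) ^ k * V 0)"
      using Suc \<theta>(4) by (intro mult_left_mono) auto
    with V_Suc[of k] show ?case by (simp add: mult_ac)
  qed simp
  also have "\<dots> \<le> (1 - \<theta>) ^ k * initial_U F m (s\<^sup>2 / (320 * L\<^sup>2)) X0"
  proof (intro mult_left_mono)
    have "s * (norm (local_gradients F X0))\<^sup>2 \<le> 1 * (norm (local_gradients F X0))\<^sup>2"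
      using s by (intro mult_right_mono) auto
    then show "V 0 \<le> initial_U F m (s\<^sup>2 / (320 * L\<^sup>2)) X0"
      by (simp add: V_def S_0 mean_sq_def initial_U_def lyap_U_def lyap_V_def weight_Y_def prob_space)
  qed (use \<theta>(4) in simp)
  finally show "(\<integral>\<omega>. ((norm (dev (X k \<omega>)))\<^sup>2 + gap k \<omega>) \<partial>M) \<le> (1 - \<theta>) ^ k * initial_U F m (s\<^sup>2 / (320 * L\<^sup>2)) X0" .
qed

end

section \<open>Convergence\<close>

text \<open>For \<open>b = 0\<close> the extended quotient is infinite and the bound says nothing,
  but the multiplied-out form then reads \<open>0 \<le> a\<close> and still holds.\<close>

lemma ereal_less_divideD:
  assumes "0 < a" "0 \<le> b" "ereal x < ereal a / ereal b"
  shows "x * b \<le> a"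
proof (cases "b = 0")
  case False
  with assms have "x < a / b" by simp
  with assms False show ?thesis by (simp add: field_simps)
qed (use assms in simp)

lemma ereal_less_times_divideD:
  assumes "0 < a" "0 < b" "0 \<le> c" "0 < d" "0 < e" "ereal x < ereal a * (ereal b / ereal c * ereal d) / ereal e"
  shows "x * (c * e) \<le> a * b * d"
proof (cases "c = 0")
  case False
  with assms have "x < a * (b / c * d) / e" by simp
  with assms False show ?thesis by (simp add: field_simps)
qed (use assms in simp)

theorem theorem4:
  fixes G :: "'n::finite pair_pre_digraph"
    and W :: "real^'n^'n"
    and F :: "'n \<Rightarrow> real^'d \<Rightarrow> real"
    and Fstar L\<^sub>f \<nu> r \<psi> \<phi>\<^sub>X \<phi>\<^sub>Y \<gamma> \<eta> varsigma :: real
    and R :: "'r measure"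
    and \<C> :: "'r \<Rightarrow> real^'d \<Rightarrow> real^'d"
    and M :: "'w measure"
    and \<xi> :: "channel \<times> 'n \<times> nat \<Rightarrow> 'w \<Rightarrow> 'r"
    and X0 :: "real^'d^'n"
  defines "\<sigma> \<equiv> spectral_norm (W - averaging_matrix)"
    and "c\<^sub>1 \<equiv> \<phi>\<^sub>X * \<psi> * r / 2"
    and "c\<^sub>2 \<equiv> \<phi>\<^sub>Y * \<psi> * r / 2"
    and "C \<equiv> 2 * r\<^sup>2 * (1 - \<psi>) + 2 * (1 - r)\<^sup>2"
  defines "\<phi> \<equiv> (1 - \<sigma>)\<^sup>2 / (320 * L\<^sub>f\<^sup>2)"
    and "\<phi>hat \<equiv> ereal 0.1 / ereal C * ereal (min (c\<^sub>1 * (2 * c\<^sub>1 + 1)) (c\<^sub>2 * (2 * c\<^sub>2 + 1)))"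
    and "PiBound \<equiv> Min {ereal ((1 - \<sigma>) / (160 * (1 + inverse c\<^sub>1))),
                  ereal ((1 - \<sigma>) / (40000 * (1 + inverse c\<^sub>2) * L\<^sub>f\<^sup>2)),
                  ereal (c\<^sub>1 * (1 - \<sigma>)) / ereal (40 * C),
                  ereal c\<^sub>1 / ereal (8 * sqrt C),
                  ereal c\<^sub>1 / ereal (10 * L\<^sub>f * sqrt (C * (1 + inverse c\<^sub>2))),
                  ereal (c\<^sub>2 * L\<^sub>f\<^sup>2) / ereal C,
                  ereal c\<^sub>2 / ereal (10 * sqrt C)}"
  defines "\<epsilon>\<^sub>1 \<equiv> 8 * L\<^sub>f\<^sup>2 / ((1 - \<sigma>) * \<gamma>) * \<eta>\<^sup>2"
    and "\<epsilon>\<^sub>2 \<equiv> 4 * (1 + inverse c\<^sub>1) * \<eta>\<^sup>2"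
    and "\<epsilon>\<^sub>3 \<equiv> 5 * (1 + inverse c\<^sub>2) * \<eta>\<^sup>2"
  defines "\<theta>\<^sub>2 \<equiv> \<eta> / 4 - (\<phi> * \<epsilon>\<^sub>1 + \<epsilon>\<^sub>2 + \<epsilon>\<^sub>3)"
    and "\<theta>hat\<^sub>2 \<equiv> Min {0.07 * (1 - \<sigma>) * \<gamma>, 0.24 * c\<^sub>1 * (2 * c\<^sub>1 + 1), 0.57 * c\<^sub>2 * (2 * c\<^sub>2 + 1), 0.25}"
  defines "\<theta>hat\<^sub>3 \<equiv> min \<theta>hat\<^sub>2 (2 * \<nu> * \<theta>\<^sub>2)"
  defines "X \<equiv> \<lambda>k \<omega>. st_X (alg F W \<gamma> \<eta> \<phi>\<^sub>X \<phi>\<^sub>Y varsigma (\<lambda>ch i t. \<C> (\<xi> (ch, i, t) \<omega>)) X0 k)"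
  assumes differentiable: "\<And>i x. F i differentiable (at x)"
    and Fstar: "\<exists>x. is_arg_min (mean_cost F) (\<lambda>_. True) x \<and> mean_cost F x = Fstar"
    and graph: "pverts G = UNIV" "strongly_connected (with_proj G)"
    and weights: "doubly_stochastic_weights G W"
    and sigma: "\<sigma> \<in> {0<..<1}"
    and smooth: "L\<^sub>f > 0"
      "\<And>i x y. norm (gradient (F i) x - gradient (F i) y) \<le> L\<^sub>f * norm (x - y)"
    and PL: "\<nu> > 0"
      "\<And>x. 1 / 2 * (norm (gradient (mean_cost F) x))\<^sup>2 \<ge> \<nu> * (mean_cost F x - Fstar)"
    and compressor: "r > 0" "\<psi> \<in> {0<..1}" "compressor R \<C> r \<psi>"
    and fresh_randomness: "prob_space M" "prob_space.indep_vars M (\<lambda>_. R) \<xi> UNIV"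
      "\<And>a. distr M R (\<xi> a) = R"
    and phi_XY: "\<phi>\<^sub>X \<in> {0<..<1 / r}" "\<phi>\<^sub>Y \<in> {0<..<1 / r}"
    and gamma: "\<gamma> > 0"
      "ereal \<gamma> < Min {ereal (c\<^sub>1 * (1 - \<sigma>)) / ereal (160 * C),
                       ereal c\<^sub>1 / ereal (16 * sqrt C),
                       ereal c\<^sub>1 / ereal (20 * L\<^sub>f * sqrt (C * (1 + inverse c\<^sub>2))),
                       ereal (c\<^sub>2 * L\<^sub>f\<^sup>2) / ereal (4 * C),
                       ereal c\<^sub>2 / ereal (20 * sqrt C),
                       ereal (1 / (4 * (1 + inverse c\<^sub>1) + 5 * (1 + inverse c\<^sub>2) * L\<^sub>f\<^sup>2)),
                       ereal (1 - \<sigma>) * \<phi>hat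
                         / ereal (4 * (16 * (1 + 4 * \<phi> * L\<^sub>f\<^sup>2) + 8 * (1 - \<sigma>))),
                       ereal (1 / (5 * (1 + inverse c\<^sub>2))),
                       ereal (1 - \<sigma>) * \<phi>hat / ereal (32 * (2 * \<phi> + (1 - \<sigma>))),
                       PiBound}"
    and eta: "\<eta> > 0"
      "\<eta> < Min {(1 - \<sigma>)\<^sup>2 * \<gamma> / (40 * L\<^sub>f),
                0.4 * (1 - \<sigma>) * \<gamma> / L\<^sub>f\<^sup>2,
                (1 - \<sigma>)\<^sup>2 / (80 * L\<^sub>f) * sqrt (\<gamma> / (1 + inverse c\<^sub>1)),
                9 / (40 * (4 * (1 + inverse c\<^sub>1) + 5 * (1 + inverse c\<^sub>2))),
                1 / (2 * L\<^sub>f),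
                \<gamma>}"
    and varsigma: "varsigma > 0"
      "ereal varsigma < min (1 / ereal (2 * sqrt C)) (ereal (1 / sqrt (2 * C + 1)))"
  shows "\<forall>k. integrable M (\<lambda>\<omega>. (norm (X k \<omega> - replicated_mean (X k \<omega>)))\<^sup>2
                 + real CARD('n) * (mean_cost F (mean (X k \<omega>)) - Fstar)) \<and>
             (\<integral>\<omega>. ((norm (X k \<omega> - replicated_mean (X k \<omega>)))\<^sup>2
                 + real CARD('n) * (mean_cost F (mean (X k \<omega>)) - Fstar)) \<partial>M)
               \<le> (1 - \<theta>hat\<^sub>3) ^ k * initial_U F Fstar \<phi> X0"
proof -
  let ?s = "1 - \<sigma>"
  have s: "0 < ?s" "?s < 1" using sigma by auto
  have W: "W *v 1 = 1" "1 v* W = 1"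
    using weights by (simp_all add: doubly_stochastic_weights_def)
  have c: "0 < c\<^sub>1" "0 < c\<^sub>2" using compressor phi_XY by (simp_all add: c\<^sub>1_def c\<^sub>2_def)
  have C: "0 \<le> C" using compressor by (simp add: C_def)
  have \<phi>: "0 < \<phi>" using s smooth by (simp add: \<phi>_def)
  define p q where "p = 1 + inverse c\<^sub>1" and "q = 1 + inverse c\<^sub>2"
  have pq: "1 \<le> p" "1 \<le> q" using c by (simp_all add: p_def q_def)
  define \<kappa>\<^sub>1 \<kappa>\<^sub>2 where "\<kappa>\<^sub>1 = c\<^sub>1 * (2 * c\<^sub>1 + 1)" and "\<kappa>\<^sub>2 = c\<^sub>2 * (2 * c\<^sub>2 + 1)"
  have \<kappa>: "0 < \<kappa>\<^sub>1" "0 < \<kappa>\<^sub>2" "c\<^sub>2 \<le> \<kappa>\<^sub>2" using c by (simp_all add: \<kappa>\<^sub>1_def \<kappa>\<^sub>2_def)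

  have g: "ereal \<gamma> < ereal (c\<^sub>2 * L\<^sub>f\<^sup>2) / ereal (4 * C)"
      "ereal \<gamma> < ereal ?s * \<phi>hat / ereal (4 * (16 * (1 + 4 * \<phi> * L\<^sub>f\<^sup>2) + 8 * ?s))"
      "ereal \<gamma> < ereal (1 / (5 * (1 + inverse c\<^sub>2)))" "ereal \<gamma> < PiBound"
    by (rule less_le_trans[OF gamma(2) Min_le]; blast)+
  have g': "ereal \<gamma> < ereal (?s / (160 * (1 + inverse c\<^sub>1)))"
      "ereal \<gamma> < ereal (?s / (40000 * (1 + inverse c\<^sub>2) * L\<^sub>f\<^sup>2))"
    by (rule less_le_trans[OF g(4)[unfolded PiBound_def] Min_le]; blast)+
  have g3: "4 * C * \<gamma> \<le> \<kappa>\<^sub>2 * L\<^sub>f\<^sup>2"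
  proof -
    have "\<gamma> * (4 * C) \<le> c\<^sub>2 * L\<^sub>f\<^sup>2" using g(1) c C smooth by (intro ereal_less_divideD) auto
    also have "\<dots> \<le> \<kappa>\<^sub>2 * L\<^sub>f\<^sup>2" using \<kappa> by (intro mult_right_mono) auto
    finally show ?thesis by (simp add: mult_ac)
  qed
  have C\<gamma>: "640 * C * \<gamma> \<le> ?s * min \<kappa>\<^sub>1 \<kappa>\<^sub>2"
  proof -
    \<comment> \<open>\<open>K\<close> is at least 64, and the 0.1 in \<open>\<phi>hat\<close> turns
      64 into the 640 of the claim.\<close>
    define K where "K = 4 * (16 * (1 + 4 * \<phi> * L\<^sub>f\<^sup>2) + 8 * ?s)"
    have "K = 64 + (256 * (\<phi> * L\<^sub>f\<^sup>2) + 32 * ?s)" by (simp add: K_def algebra_simps)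
    moreover have "0 \<le> 256 * (\<phi> * L\<^sub>f\<^sup>2) + 32 * ?s"
      using s \<phi> by (intro add_nonneg_nonneg) simp_all
    ultimately have K: "64 \<le> K" by linarith
    have "\<gamma> * (C * K) \<le> ?s * 0.1 * min \<kappa>\<^sub>1 \<kappa>\<^sub>2"
      using g(2) s C \<kappa> K unfolding \<phi>hat_def \<kappa>\<^sub>1_def \<kappa>\<^sub>2_def K_def
      by (intro ereal_less_times_divideD) auto
    moreover have "\<gamma> * (C * 64) \<le> \<gamma> * (C * K)"
      using gamma(1) C K by (intro mult_left_mono) auto
    ultimately have "\<gamma> * (C * 64) \<le> ?s * 0.1 * min \<kappa>\<^sub>1 \<kappa>\<^sub>2" by linarith
    then show ?thesis by (simp add: mult_ac)
  qed
  have min: "?s * min \<kappa>\<^sub>1 \<kappa>\<^sub>2 \<le> ?s * \<kappa>\<^sub>1" "?s * min \<kappa>\<^sub>1 \<kappa>\<^sub>2 \<le> ?s * \<kappa>\<^sub>2"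
    using s by (intro mult_left_mono; simp)+
  have e: "\<eta> < ?s\<^sup>2 * \<gamma> / (40 * L\<^sub>f)" "\<eta> < 0.4 * ?s * \<gamma> / L\<^sub>f\<^sup>2"
      "\<eta> < ?s\<^sup>2 / (80 * L\<^sub>f) * sqrt (\<gamma> / p)" "\<eta> < 1 / (2 * L\<^sub>f)" "\<eta> < \<gamma>"
    unfolding p_def by (rule less_le_trans[OF eta(2) Min_le]; blast)+
  have e3: "6400 * L\<^sub>f\<^sup>2 * p * \<eta>\<^sup>2 \<le> ?s ^ 4 * \<gamma>"
  proof -
    have "\<eta>\<^sup>2 \<le> (?s\<^sup>2 / (80 * L\<^sub>f) * sqrt (\<gamma> / p))\<^sup>2"
      using e(3) eta(1) by (intro power_mono) auto
    also have "\<dots> = ?s ^ 4 / (6400 * L\<^sub>f\<^sup>2) * (\<gamma> / p)"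
      using gamma(1) pq by (simp add: power_mult_distrib power_divide flip: power_mult)
    finally show ?thesis using pq smooth(1) by (simp add: field_simps)
  qed
  have vs: "4 * C * varsigma\<^sup>2 \<le> 1" "(2 * C + 1) * varsigma\<^sup>2 \<le> 1"
  proof -
    have "varsigma * (2 * sqrt C) \<le> 1"
      using varsigma C by (intro ereal_less_divideD) (auto simp: one_ereal_def)
    then have "(varsigma * (2 * sqrt C))\<^sup>2 \<le> 1\<^sup>2" using varsigma(1) C by (intro power_mono) auto
    then show "4 * C * varsigma\<^sup>2 \<le> 1" using C by (simp add: power_mult_distrib mult_ac)
    have "varsigma * sqrt (2 * C + 1) \<le> 1"
      using varsigma(2) C by (simp add: field_simps)
    then have "(varsigma * sqrt (2 * C + 1))\<^sup>2 \<le> 1\<^sup>2" using varsigma(1) C by (intro power_mono) auto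
    then show "(2 * C + 1) * varsigma\<^sup>2 \<le> 1" using C by (simp add: power_mult_distrib mult_ac)
  qed
  have \<epsilon>: "0 \<le> \<epsilon>\<^sub>1" "0 \<le> \<epsilon>\<^sub>2" "0 \<le> \<epsilon>\<^sub>3"
    using s gamma(1) c by (simp_all add: \<epsilon>\<^sub>1_def \<epsilon>\<^sub>2_def \<epsilon>\<^sub>3_def)
  have "\<theta>hat\<^sub>2 \<le> 0.07 * ?s * \<gamma>" "\<theta>hat\<^sub>2 \<le> 0.24 * c\<^sub>1 * (2 * c\<^sub>1 + 1)"
      "\<theta>hat\<^sub>2 \<le> 0.57 * c\<^sub>2 * (2 * c\<^sub>2 + 1)" "\<theta>hat\<^sub>2 \<le> 0.25"
    unfolding \<theta>hat\<^sub>2_def by (rule Min_le; blast)+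
  then have \<theta>: "\<theta>hat\<^sub>3 \<le> 7 / 100 * ?s * \<gamma>" "\<theta>hat\<^sub>3 \<le> 24 / 100 * \<kappa>\<^sub>1" "\<theta>hat\<^sub>3 \<le> 57 / 100 * \<kappa>\<^sub>2" "\<theta>hat\<^sub>3 \<le> 1 / 4"
    unfolding \<theta>hat\<^sub>3_def \<kappa>\<^sub>1_def \<kappa>\<^sub>2_def by (simp_all add: min_def mult.assoc)
  have \<theta>5: "\<theta>hat\<^sub>3 \<le> \<eta> * \<nu>"
  proof -
    \<comment> \<open>The epsilon terms only lower \<open>\<theta>\<^sub>2\<close>, so
      \<open>2 * \<nu> * \<theta>\<^sub>2\<close> stays below the rate \<open>\<eta> * \<nu>\<close>
      of the gradient step.\<close>
    have "0 \<le> \<phi> * \<epsilon>\<^sub>1" using \<phi> \<epsilon> by simp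
    then have "\<theta>\<^sub>2 \<le> \<eta> / 2" using \<epsilon> eta(1) by (simp add: \<theta>\<^sub>2_def)
    then have "2 * \<nu> * \<theta>\<^sub>2 \<le> 2 * \<nu> * (\<eta> / 2)" using PL(1) by (intro mult_left_mono) auto
    then show ?thesis by (simp add: \<theta>hat\<^sub>3_def mult_ac)
  qed
  interpret error_feedback M W F L\<^sub>f \<nu> Fstar r \<psi> \<phi>\<^sub>X \<phi>\<^sub>Y \<gamma> \<eta> varsigma ?s \<theta>hat\<^sub>3 R \<C> \<xi> X0 c\<^sub>1 c\<^sub>2 C p q \<kappa>\<^sub>1 \<kappa>\<^sub>2
  proof (intro error_feedback.intro error_feedback_axioms.intro)
    show "Fstar \<le> mean_cost F x" for x
      using Fstar by (auto simp: is_arg_min_linorder)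
    show "160 * p * \<gamma> \<le> ?s" "40000 * q * \<gamma> * L\<^sub>f\<^sup>2 \<le> ?s" "5 * q * \<gamma> \<le> 1"
      using g(3) g' pq smooth(1) unfolding p_def[symmetric] q_def[symmetric] less_ereal.simps
      by (simp_all add: pos_less_divide_eq mult_ac)
    show "640 * C * \<gamma> \<le> ?s * \<kappa>\<^sub>1" "640 * C * \<gamma> \<le> ?s * \<kappa>\<^sub>2"
      using C\<gamma> min by linarith+
    show "40 * L\<^sub>f * \<eta> \<le> ?s\<^sup>2 * \<gamma>" "L\<^sub>f\<^sup>2 * \<eta> \<le> 2 / 5 * ?s * \<gamma>" "2 * L\<^sub>f * \<eta> \<le> 1" "\<eta> \<le> \<gamma>"
      using e smooth(1) by (simp_all add: field_simps)
    show "spectral_norm (W - averaging_matrix) = 1 - ?s" by (simp add: \<sigma>_def)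
    show "c\<^sub>1 = \<phi>\<^sub>X * \<psi> * r / 2" "c\<^sub>2 = \<phi>\<^sub>Y * \<psi> * r / 2" "C = 2 * r\<^sup>2 * (1 - \<psi>) + 2 * (1 - r)\<^sup>2"
      by (simp_all add: c\<^sub>1_def c\<^sub>2_def C_def)
    show "0 < \<psi>" "\<psi> \<le> 1" "0 < \<phi>\<^sub>X" "\<phi>\<^sub>X < 1 / r" "0 < \<phi>\<^sub>Y" "\<phi>\<^sub>Y < 1 / r"
      using compressor(2) phi_XY by simp_all
  qed (rule p_def q_def \<kappa>\<^sub>1_def \<kappa>\<^sub>2_def s W differentiable smooth PL compressor(1,3) fresh_randomness
      gamma(1) eta(1) g3 e3 vs \<theta> \<theta>5)+
  show ?thesis
    unfolding X_def \<phi>_def by (intro allI conjI expected_error_bound[unfolded S_def])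
qed

end
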